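(* Let $Y=(Y_t)_{t\in\mathbb{R}}$ and $X=(X_t)_{t\in\mathbb{R}}$ be the processes of the supOUSV model defined in the context, with $\overline{Y}=\mathbb{E}[Y_t]$ and $\overline{V}=\mathbb{V}[Y_t]$. Then for any $t\in\mathbb{R}$ and $h\ge 0$, the autocorrelation $\mathrm{AC}_X(h)$ of $X$ with time lag $h$ is $$\mathrm{AC}_X(h)=\frac{1}{\mathbb{V}[X_t]}\left(\frac{\sigma^2\overline{Y}}{2}I_1(h)+\mu^2\overline{V}\left(\int_0^{+\infty}\frac{\pi(\mathrm{d}r)}{r}\right)^{-1}\bigl(I_2(h)+I_3(h)\bigr)\right),$$ where $$I_1(h)=\int_{R=0}^{R=+\infty}e^{-Rh}\rho(\mathrm{d}R),$$ $$I_2(h)=\int_{R=0}^{R=+\infty}\int_{P=0}^{P=+\infty}\int_{r=0}^{r=+\infty}\frac{RP}{r(P+R)}\left(\frac{1}{P+r}+\frac{1}{R+r}\right)e^{-Ph}\,\pi(\mathrm{d}r)\rho(\mathrm{d}R)\rho(\mathrm{d}P),$$ and $$I_3(h)=\int_{R=0}^{R=+\infty}\int_{P=0}^{P=+\infty}\int_{r=0}^{r=+\infty}\frac{RP}{r(R+r)(P-r)}\left(e^{-rh}-e^{-Ph}\right)\pi(\mathrm{d}r)\rho(\mathrm{d}R)\rho(\mathrm{d}P).$$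
   Context: Work on a complete (filtered) probability space; $\mathbb{E}$ and $\mathbb{V}$ denote expectation and variance. Measures and parameters. $\nu$ is the (nonzero) Lévy measure on $(0,+\infty)$ of a pure-jump subordinator with $\int_0^{+\infty}z^k\,\nu(\mathrm{d}z)<+\infty$ for $k=1,2,3,\dots$; $\pi$ is a probability measure on $(0,+\infty)$ with $\int_0^{+\infty}r^{-1}\pi(\mathrm{d}r)<+\infty$; $\rho$ is a probability measure on $(0,+\infty)$; $\mu\in\mathbb{R}$ and $\sigma>0$ are constants. Noises. $N$ is a Poisson random measure on $\mathbb{R}\times(0,+\infty)\times(0,+\infty)$ with compensator (intensity) $\mathrm{d}s\,\nu(\mathrm{d}z)\,\pi(\mathrm{d}r)$. $B(\mathrm{d}R,\mathrm{d}s)$ is a centered space-time Gaussian random measure (white noise) on $(0,+\infty)\times\mathbb{R}$ with control measure $\rho(\mathrm{d}R)\,\mathrm{d}s$, i.e. $\mathbb{E}[B(A)B(A')]=(\rho\otimes\mathrm{Leb})(A\cap A')$ for Borel sets $A,A'$ of finite measure. $B$ and $N$ are mutually independent. supOUSV model (in its stationary state). For $t\in\mathbb{R}$, $$Y_t=\int_{s=-\infty}^{s=t}\int_{z=0}^{z=+\infty}\int_{r=0}^{r=+\infty}z\,e^{-r(t-s)}N(\mathrm{d}s,\mathrm{d}z,\mathrm{d}r),$$ $$X_t=\int_{R=0}^{R=+\infty}\int_{s=-\infty}^{s=t}e^{-R(t-s)}\left\{R\mu\,(Y_s-\overline{Y})\,\rho(\mathrm{d}R)\,\mathrm{d}s+\sigma\sqrt{R\,Y_s}\,B(\mathrm{d}R,\mathrm{d}s)\right\},$$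 where $\overline{Y}=\mathbb{E}[Y_t]$ (independent of $t$ because $Y$ is stationary), $\overline{V}=\mathbb{V}[Y_t]$, and the integral against $B$ is in the Itô sense. The autocorrelation of $X$ at lag $h\ge0$ is $\mathrm{AC}_X(h)=\mathbb{E}\bigl[(X_t-\mathbb{E}[X_t])(X_{t+h}-\mathbb{E}[X_{t+h}])\bigr]/\mathbb{V}[X_t]$, where $X$ is stationary with $\mathbb{E}[X_t]=0$. Convention: at $P=r$ the quotient $(e^{-rh}-e^{-Ph})/(P-r)$ is understood as its limit $h e^{-rh}$. *)

theory Defs
  imports "HOL-Probability.Probability"
begin

section \<open>Random measures\<close>

definition gen_events :: "'w measure \<Rightarrow> ('i \<Rightarrow> 'w \<Rightarrow> 'b::topological_space) \<Rightarrow> 'i set \<Rightarrow> 'w set set" where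
  "gen_events M Z I =
     sigma_sets (space M) {Z i -` U \<inter> space M | i U. i \<in> I \<and> U \<in> sets borel}"

text \<open>The counts on sets of infinite intensity are almost surely infinite; sets of zero
  intensity are covered by the second clause, with \<open>0 ^ 0 = 1\<close>.\<close>

definition poisson_random_measure ::
    "'w measure \<Rightarrow> 'a measure \<Rightarrow> ('w \<Rightarrow> 'a measure) \<Rightarrow> bool" where
  "poisson_random_measure M L N \<longleftrightarrow>
     (\<forall>\<omega>\<in>space M. sets (N \<omega>) = sets L) \<and>
     (\<forall>A\<in>sets L. (\<lambda>\<omega>. emeasure (N \<omega>) A) \<in> borel_measurable M) \<and>
     (\<forall>A\<in>sets L. emeasure L A < \<infinity> \<longrightarrow>
        (\<forall>k::nat. measure M {\<omega> \<in> space M. emeasure (N \<omega>) A = of_nat k} =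
           measure L A ^ k / fact k * exp (- measure L A))) \<and>
     (\<forall>A\<in>sets L. emeasure L A = \<infinity> \<longrightarrow> (AE \<omega> in M. emeasure (N \<omega>) A = \<infinity>)) \<and>
     (\<forall>(n::nat) A. (\<forall>i<n. A i \<in> sets L) \<and> disjoint_family_on A {..<n} \<longrightarrow>
        prob_space.indep_vars M (\<lambda>_. borel) (\<lambda>i \<omega>. emeasure (N \<omega>) (A i)) {..<n})"

text \<open>The almost surely constant case is the normal law with variance zero.\<close>

definition gaussian_var :: "'w measure \<Rightarrow> ('w \<Rightarrow> real) \<Rightarrow> bool" where
  "gaussian_var M Z \<longleftrightarrow> Z \<in> borel_measurable M \<and>
     (\<exists>m. (AE \<omega> in M. Z \<omega> = m) \<or> (\<exists>s>0. distributed M lborel Z (normal_density m s)))"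

definition gaussian_family :: "'w measure \<Rightarrow> 'i set \<Rightarrow> ('i \<Rightarrow> 'w \<Rightarrow> real) \<Rightarrow> bool" where
  "gaussian_family M I Z \<longleftrightarrow>
     (\<forall>J c. finite J \<and> J \<subseteq> I \<longrightarrow> gaussian_var M (\<lambda>\<omega>. \<Sum>j\<in>J. c j * Z j \<omega>))"

definition finite_sets :: "'a measure \<Rightarrow> 'a set set" where
  "finite_sets L = {A \<in> sets L. emeasure L A < \<infinity>}"

definition white_noise :: "'w measure \<Rightarrow> 'a measure \<Rightarrow> ('a set \<Rightarrow> 'w \<Rightarrow> real) \<Rightarrow> bool" where
  "white_noise M L B \<longleftrightarrow>
     gaussian_family M (finite_sets L) B \<and>
     (\<forall>A\<in>finite_sets L. prob_space.expectation M (B A) = 0) \<and>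
     (\<forall>A\<in>finite_sets L. \<forall>A'\<in>finite_sets L.
        prob_space.expectation M (\<lambda>\<omega>. B A \<omega> * B A' \<omega>) = measure L (A \<inter> A'))"

text \<open>Measures on \<open>(0,\<infinity>)\<close> have \<open>{0<..}\<close> as their underlying space, so integrals
  against them need no further restriction of the domain.\<close>

abbreviation pos_borel :: "real measure" where
  "pos_borel \<equiv> restrict_space borel {0<..}"

definition subordinator_levy_measure :: "real measure \<Rightarrow> bool" where
  "subordinator_levy_measure \<nu> \<longleftrightarrow> sets \<nu> = sets pos_borel \<and> integrable \<nu> (\<lambda>z. min 1 z)"

text \<open>Points of the two noises are \<open>(s, z, r)\<close> and \<open>(R, s)\<close> respectively.\<close>

abbreviation jump_intensity :: "real measure \<Rightarrow> real measure \<Rightarrow> (real \<times> real \<times> real) measure" where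
  "jump_intensity \<nu> \<pi> \<equiv> lborel \<Otimes>\<^sub>M (\<nu> \<Otimes>\<^sub>M \<pi>)"

abbreviation control_measure :: "real measure \<Rightarrow> (real \<times> real) measure" where
  "control_measure \<rho> \<equiv> \<rho> \<Otimes>\<^sub>M lborel"

definition independent_noises ::
    "'w measure \<Rightarrow> 'a measure \<Rightarrow> ('w \<Rightarrow> 'a measure) \<Rightarrow> 'b measure \<Rightarrow> ('b set \<Rightarrow> 'w \<Rightarrow> real) \<Rightarrow> bool" where
  "independent_noises M LN N LB B \<longleftrightarrow>
     prob_space.indep_set M
       (gen_events M (\<lambda>A \<omega>. emeasure (N \<omega>) A) (sets LN))
       (gen_events M B (finite_sets LB))"

section \<open>Filtration\<close>

definition complete_filtration :: "'w measure \<Rightarrow> (real \<Rightarrow> 'w measure) \<Rightarrow> bool" where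
  "complete_filtration M F \<longleftrightarrow>
     filtration (space M) F \<and> (\<forall>t. subalgebra M (F t) \<and> null_sets M \<subseteq> sets (F t))"

text \<open>The noises up to time \<open>t\<close> are measurable with respect to \<open>F t\<close>, and the noises after
  time \<open>t\<close> are independent of \<open>F t\<close>.\<close>

definition adapted_noises ::
    "'w measure \<Rightarrow> (real \<Rightarrow> 'w measure) \<Rightarrow> (real \<times> real \<times> real) measure \<Rightarrow>
     ('w \<Rightarrow> (real \<times> real \<times> real) measure) \<Rightarrow> (real \<times> real) measure \<Rightarrow>
     ((real \<times> real) set \<Rightarrow> 'w \<Rightarrow> real) \<Rightarrow> bool" where
  "adapted_noises M F LN N LB B \<longleftrightarrow> (\<forall>t.
     (\<forall>A\<in>sets LN. A \<subseteq> {..t} \<times> UNIV \<longrightarrow> (\<lambda>\<omega>. emeasure (N \<omega>) A) \<in> borel_measurable (F t)) \<and>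
     (\<forall>A\<in>finite_sets LB. A \<subseteq> UNIV \<times> {..t} \<longrightarrow> B A \<in> borel_measurable (F t)) \<and>
     prob_space.indep_set M (sets (F t))
       (sigma_sets (space M)
         (gen_events M (\<lambda>A \<omega>. emeasure (N \<omega>) A) {A \<in> sets LN. A \<subseteq> {t<..} \<times> UNIV} \<union>
          gen_events M B {A \<in> finite_sets LB. A \<subseteq> UNIV \<times> {t<..}})))"

section \<open>Ito integral against the white noise\<close>

text \<open>An elementary predictable integrand is a finite sum of terms
  \<open>\<xi> \<cdot> 1\<^bsub>A\<^esub>(R) \<cdot> 1\<^bsub>(a,b]\<^esub>(s)\<close> with \<open>\<xi>\<close> bounded and \<open>F a\<close>-measurable; it is represented by
  the list of the tuples \<open>(\<xi>, A, a, b)\<close>.\<close>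

type_synonym 'w elem = "(('w \<Rightarrow> real) \<times> real set \<times> real \<times> real) list"

definition elem_integrand :: "(real \<Rightarrow> 'w measure) \<Rightarrow> real measure \<Rightarrow> 'w elem \<Rightarrow> bool" where
  "elem_integrand F \<rho> S \<longleftrightarrow>
     (\<forall>(\<xi>, A, a, b)\<in>set S. \<xi> \<in> borel_measurable (F a) \<and> bounded (\<xi> ` space (F a)) \<and>
        A \<in> sets \<rho> \<and> a \<le> b)"

definition elem_fun :: "'w elem \<Rightarrow> 'w \<Rightarrow> real \<Rightarrow> real \<Rightarrow> real" where
  "elem_fun S \<omega> R s =
     (\<Sum>(\<xi>, A, a, b)\<leftarrow>S. \<xi> \<omega> * indicator A R * indicator {a<..b} s)"

definition elem_integral :: "((real \<times> real) set \<Rightarrow> 'w \<Rightarrow> real) \<Rightarrow> 'w elem \<Rightarrow> 'w \<Rightarrow> real" where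
  "elem_integral B S \<omega> = (\<Sum>(\<xi>, A, a, b)\<leftarrow>S. \<xi> \<omega> * B (A \<times> {a<..b}) \<omega>)"

text \<open>The Ito integral is the \<open>L\<^sup>2\<close>-extension of the elementary integral, hence determined
  up to almost sure equality. Passing to the completion of the product measure makes the
  notion insensitive to changes of the integrand on null sets.\<close>

definition has_ito_integral ::
    "'w measure \<Rightarrow> (real \<Rightarrow> 'w measure) \<Rightarrow> real measure \<Rightarrow> ((real \<times> real) set \<Rightarrow> 'w \<Rightarrow> real) \<Rightarrow>
     ('w \<Rightarrow> real \<Rightarrow> real \<Rightarrow> real) \<Rightarrow> ('w \<Rightarrow> real) \<Rightarrow> bool" where
  "has_ito_integral M F \<rho> B \<Phi> J \<longleftrightarrow>
     (\<lambda>(\<omega>, R, s). \<Phi> \<omega> R s) \<in> borel_measurable (completion (M \<Otimes>\<^sub>M control_measure \<rho>)) \<and>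
     J \<in> borel_measurable M \<and>
     (\<exists>S. (\<forall>n::nat. elem_integrand F \<rho> (S n)) \<and>
        (\<lambda>n. \<integral>\<^sup>+ (\<omega>, R, s). ennreal ((\<Phi> \<omega> R s - elem_fun (S n) \<omega> R s)\<^sup>2)
               \<partial>completion (M \<Otimes>\<^sub>M control_measure \<rho>)) \<longlonglongrightarrow> 0 \<and>
        (\<lambda>n. \<integral>\<^sup>+ \<omega>. ennreal ((J \<omega> - elem_integral B (S n) \<omega>)\<^sup>2) \<partial>M) \<longlonglongrightarrow> 0)"

section \<open>The supOUSV model\<close>

definition supOU :: "('w \<Rightarrow> (real \<times> real \<times> real) measure) \<Rightarrow> real \<Rightarrow> 'w \<Rightarrow> real" where
  "supOU N t \<omega> = (\<integral>(s, z, r). indicator {..t} s * (z * exp (- r * (t - s))) \<partial>N \<omega>)"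

text \<open>The mean of \<open>supOU N s\<close> does not depend on \<open>s\<close>; below it plays the role of the
  constant stationary mean.\<close>

definition supOUSV_drift ::
    "'w measure \<Rightarrow> ('w \<Rightarrow> (real \<times> real \<times> real) measure) \<Rightarrow> real measure \<Rightarrow> real \<Rightarrow>
     real \<Rightarrow> 'w \<Rightarrow> real" where
  "supOUSV_drift M N \<rho> \<mu> t \<omega> =
     (\<integral>(R, s). indicator {..t} s *
        (exp (- R * (t - s)) * (R * \<mu> * (supOU N s \<omega> - prob_space.expectation M (supOU N s))))
      \<partial>control_measure \<rho>)"

definition supOUSV_diffusion ::
    "('w \<Rightarrow> (real \<times> real \<times> real) measure) \<Rightarrow> real \<Rightarrow> real \<Rightarrow> 'w \<Rightarrow> real \<Rightarrow> real \<Rightarrow> real" where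
  "supOUSV_diffusion N \<sigma> t \<omega> R s =
     indicator {..t} s * (exp (- R * (t - s)) * (\<sigma> * sqrt (R * supOU N s \<omega>)))"

definition is_supOUSV ::
    "'w measure \<Rightarrow> (real \<Rightarrow> 'w measure) \<Rightarrow> ('w \<Rightarrow> (real \<times> real \<times> real) measure) \<Rightarrow>
     ((real \<times> real) set \<Rightarrow> 'w \<Rightarrow> real) \<Rightarrow> real measure \<Rightarrow> real \<Rightarrow> real \<Rightarrow>
     (real \<Rightarrow> 'w \<Rightarrow> real) \<Rightarrow> bool" where
  "is_supOUSV M F N B \<rho> \<mu> \<sigma> X \<longleftrightarrow>
     (\<forall>t. X t \<in> borel_measurable M \<and>
        (\<exists>J. has_ito_integral M F \<rho> B (supOUSV_diffusion N \<sigma> t) J \<and>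
           (AE \<omega> in M. X t \<omega> = supOUSV_drift M N \<rho> \<mu> t \<omega> + J \<omega>)))"

definition autocorr :: "'w measure \<Rightarrow> (real \<Rightarrow> 'w \<Rightarrow> real) \<Rightarrow> real \<Rightarrow> real \<Rightarrow> real" where
  "autocorr M X t h =
     prob_space.expectation M (\<lambda>\<omega>. (X t \<omega> - prob_space.expectation M (X t)) *
        (X (t + h) \<omega> - prob_space.expectation M (X (t + h))))
     / prob_space.variance M (X t)"

section \<open>The integrals in the autocorrelation formula\<close>

definition exp_quot :: "real \<Rightarrow> real \<Rightarrow> real \<Rightarrow> real" where
  "exp_quot h P r =
     (if P = r then h * exp (- r * h) else (exp (- r * h) - exp (- P * h)) / (P - r))"

definition I1 :: "real measure \<Rightarrow> real \<Rightarrow> real" where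
  "I1 \<rho> h = (\<integral>R. exp (- R * h) \<partial>\<rho>)"

definition I2 :: "real measure \<Rightarrow> real measure \<Rightarrow> real \<Rightarrow> real" where
  "I2 \<rho> \<pi> h = (\<integral>R. \<integral>P. \<integral>r.
     R * P / (r * (P + R)) * (1 / (P + r) + 1 / (R + r)) * exp (- P * h) \<partial>\<pi> \<partial>\<rho> \<partial>\<rho>)"

definition I3 :: "real measure \<Rightarrow> real measure \<Rightarrow> real \<Rightarrow> real" where
  "I3 \<rho> \<pi> h = (\<integral>R. \<integral>P. \<integral>r. R * P / (r * (R + r)) * exp_quot h P r \<partial>\<pi> \<partial>\<rho> \<partial>\<rho>)"

end

theory Submission
  imports Defs
begin

text \<open>
  The process is a drift plus an Ito integral, \<open>X\<^sub>t = \<mu> D\<^sub>t + J\<^sub>t\<close>, both centred, and its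
  autocovariance is the sum of four products of which the two mixed ones vanish.

  The Ito part. By the isometry, \<open>E[J\<^sub>t J\<^bsub>t+h\<^esub>]\<close> is the integral of the product of the two integrands,
  which lives on the common past \<open>s \<le> t\<close> and sees only the mean of the volatility \<open>Y\<close>. Integrating the
  two exponentials in \<open>s\<close> leaves the first integral of the formula (\<open>ito_isometry\<close>,
  \<open>diffusion_covariance\<close>).

  The drift part. The weight \<open>R e\<^bsup>-R(t-s)\<^esup>\<close> is a probability density in the past time \<open>s\<close>, so that
  \<open>D\<^sub>t\<close> is an average of \<open>Y\<^sub>s - E[Y\<^sub>s]\<close> over random past times (\<open>drift_average\<close>). Hence
  \<open>E[D\<^sub>t D\<^bsub>t+h\<^esub>]\<close> is the average of the covariance of \<open>Y\<^sub>s\<close> and \<open>Y\<^sub>u\<close> over two past times. By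
  Campbell's formula for Poisson integrals (\<open>integral_N_product_mean\<close>) this covariance is half the second
  moment of the jumps times the \<open>\<pi>\<close>-integral of \<open>e\<^bsup>-r|u-s|\<^esup> / r\<close>; at \<open>u = s\<close> it is the variance,
  and division by the integral of \<open>1 / r\<close> recovers the half second moment. The integral over the two
  times is elementary: the regions \<open>u \<le> s\<close>, \<open>s < u \<le> t\<close> and \<open>t < u\<close> yield the two summands of the second
  integral of the formula and the third integral (\<open>memory_double_integral\<close>).

  The mixed part. It suffices that Ito integrals are orthogonal to \<open>Y\<^sub>s\<close>, at all times \<open>s\<close>. The
  integrand is itself built from \<open>N\<close>, so independence of \<open>B\<close> and \<open>N\<close> is not enough. For one elementary
  term over an interval that starts at \<open>a\<close>, however, \<open>Y\<^sub>s\<close> splits into the contributions of the points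
  before and after \<open>a\<close>. The first belongs to the past at \<open>a\<close>, of which the increment of \<open>B\<close> is independent;
  the second forms with that increment a pair that is independent of the past and has independent
  components (\<open>elem_term_orthogonal\<close>, \<open>supOU_splits\<close>).

  All interchanges of expectation and time integral rest on joint measurability of the volatility in
  scenario and time (\<open>integral_N_parametric_measurable\<close>).
\<close>

section \<open>Square integrable functions\<close>

definition square_integrable :: "'a measure \<Rightarrow> ('a \<Rightarrow> real) \<Rightarrow> bool" where
  "square_integrable M f \<longleftrightarrow> f \<in> borel_measurable M \<and> integrable M (\<lambda>x. (f x)\<^sup>2)"

lemma square_integrable_measurable:
  "square_integrable M f \<Longrightarrow> f \<in> borel_measurable M"
  by (simp add: square_integrable_def)

lemma square_integrable_mult:
  assumes "square_integrable M f" "square_integrable M g"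
  shows "integrable M (\<lambda>x. f x * g x)"
proof (rule Bochner_Integration.integrable_bound)
  have [measurable]: "f \<in> borel_measurable M" "g \<in> borel_measurable M"
    using assms by (auto simp: square_integrable_def)
  show "integrable M (\<lambda>x. (f x)\<^sup>2 + (g x)\<^sup>2)"
    using assms by (auto simp: square_integrable_def)
  show "(\<lambda>x. f x * g x) \<in> borel_measurable M" by simp
  have "\<bar>u * v\<bar> \<le> u\<^sup>2 + v\<^sup>2" for u v :: real
    using sum_squares_bound[of "\<bar>u\<bar>" "\<bar>v\<bar>"] abs_ge_zero[of "u * v"]
    unfolding abs_mult power2_abs by linarith
  then show "AE x in M. norm (f x * g x) \<le> norm ((f x)\<^sup>2 + (g x)\<^sup>2)"
    by simp
qed

lemma square_integrable_cmult:
  "square_integrable M f \<Longrightarrow> square_integrable M (\<lambda>x. c * f x)"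
  by (auto simp: square_integrable_def power_mult_distrib)

lemma square_integrable_add:
  assumes "square_integrable M f" "square_integrable M g"
  shows "square_integrable M (\<lambda>x. f x + g x)"
proof -
  have "integrable M (\<lambda>x. (f x)\<^sup>2 + (g x)\<^sup>2 + 2 * (f x * g x))"
    using assms square_integrable_mult[OF assms] by (auto simp: square_integrable_def)
  then show ?thesis
    using assms by (auto simp: square_integrable_def power2_sum mult.assoc)
qed

lemma square_integrable_diff:
  assumes "square_integrable M f" "square_integrable M g"
  shows "square_integrable M (\<lambda>x. f x - g x)"
  using square_integrable_add[OF assms(1) square_integrable_cmult[OF assms(2), of "-1"]] by simp

lemma square_integrable_cong_AE:
  assumes "square_integrable M f" "g \<in> borel_measurable M" "AE x in M. f x = g x"
  shows "square_integrable M g"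
proof -
  have [measurable]: "f \<in> borel_measurable M" "g \<in> borel_measurable M"
    using assms by (auto simp: square_integrable_def)
  have "integrable M (\<lambda>x. (g x)\<^sup>2) = integrable M (\<lambda>x. (f x)\<^sup>2)"
    using assms(3) by (intro integrable_cong_AE) auto
  then show ?thesis using assms by (simp add: square_integrable_def)
qed

lemma (in finite_measure) square_integrable_const: "square_integrable M (\<lambda>_. c)"
  by (simp add: square_integrable_def)

lemma (in finite_measure) square_integrable_integrable:
  "square_integrable M f \<Longrightarrow> integrable M f"
  using square_integrable_mult[OF _ square_integrable_const[of 1]] by simp

lemma square_integrable_bounded_mult:
  assumes f: "square_integrable M f" and g: "g \<in> borel_measurable M"
    and b: "\<And>x. x \<in> space M \<Longrightarrow> \<bar>g x\<bar> \<le> b"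
  shows "square_integrable M (\<lambda>x. g x * f x)"
proof -
  have [measurable]: "f \<in> borel_measurable M" "g \<in> borel_measurable M"
    using f g by (auto simp: square_integrable_def)
  have "integrable M (\<lambda>x. (g x * f x)\<^sup>2)"
  proof (rule Bochner_Integration.integrable_bound)
    show "integrable M (\<lambda>x. b\<^sup>2 * (f x)\<^sup>2)"
      using f by (simp add: square_integrable_def)
    have "(g x)\<^sup>2 \<le> b\<^sup>2" if "x \<in> space M" for x
      using b[OF that] by (metis abs_ge_zero order_trans power2_abs power_mono)
    then show "AE x in M. norm ((g x * f x)\<^sup>2) \<le> norm (b\<^sup>2 * (f x)\<^sup>2)"
      by (intro AE_I2) (auto simp: power_mult_distrib intro!: mult_right_mono)
  qed simp
  then show ?thesis by (simp add: square_integrable_def)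
qed

lemma square_integrable_nn_integral:
  assumes "f \<in> borel_measurable M" "(\<integral>\<^sup>+ x. ennreal ((f x)\<^sup>2) \<partial>M) < \<infinity>"
  shows "square_integrable M f"
  unfolding square_integrable_def
  using assms by (auto intro!: integrableI_nonneg)

lemma integral_Cauchy_Schwarz:
  assumes f: "square_integrable M f" and g: "square_integrable M g"
  shows "\<bar>\<integral>x. f x * g x \<partial>M\<bar> \<le> sqrt (\<integral>x. (f x)\<^sup>2 \<partial>M) * sqrt (\<integral>x. (g x)\<^sup>2 \<partial>M)"
proof -
  define a b d where "a = (\<integral>x. (f x)\<^sup>2 \<partial>M)" and "b = (\<integral>x. f x * g x \<partial>M)"
    and "d = (\<integral>x. (g x)\<^sup>2 \<partial>M)"
  have fg: "integrable M (\<lambda>x. f x * g x)" by (rule square_integrable_mult[OF f g])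
  have f2: "integrable M (\<lambda>x. (f x)\<^sup>2)" and g2: "integrable M (\<lambda>x. (g x)\<^sup>2)"
    using f g by (auto simp: square_integrable_def)
  have quad: "0 \<le> a + 2 * c * b + c\<^sup>2 * d" for c
  proof -
    have "0 \<le> (\<integral>x. (f x + c * g x)\<^sup>2 \<partial>M)" by simp
    also have "(\<lambda>x. (f x + c * g x)\<^sup>2) = (\<lambda>x. (f x)\<^sup>2 + 2 * c * (f x * g x) + c\<^sup>2 * (g x)\<^sup>2)"
      by (auto simp: power2_sum power_mult_distrib)
    also have "(\<integral>x. (f x)\<^sup>2 + 2 * c * (f x * g x) + c\<^sup>2 * (g x)\<^sup>2 \<partial>M) = a + 2 * c * b + c\<^sup>2 * d"
      using fg f2 g2 by (simp add: a_def b_def d_def)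
    finally show ?thesis .
  qed
  have "d \<ge> 0" by (simp add: d_def)
  have "b\<^sup>2 \<le> a * d"
  proof (cases "d = 0")
    case True
    have "b = 0"
    proof (rule ccontr)
      assume "b \<noteq> 0"
      \<comment> \<open>a coefficient at which the quadratic, now linear, takes the value -1\<close>
      then show False using quad[of "- (a + 1) / (2 * b)"] True by (simp add: field_simps)
    qed
    then show ?thesis using True by simp
  next
    case False
    then have "0 < d" using \<open>d \<ge> 0\<close> by simp
    \<comment> \<open>the minimiser of the quadratic\<close>
    then show ?thesis using quad[of "- b / d"]
      by (simp add: field_simps power2_eq_square)
  qed
  then have "\<bar>b\<bar> \<le> sqrt (a * d)"
    by (simp add: real_le_rsqrt)
  then show ?thesis by (simp add: a_def b_def d_def real_sqrt_mult)
qed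

text \<open>Convergence in mean square is stated with nonnegative integrals, which presuppose no
  integrability of the limit: it inherits square integrability from the approximations.\<close>

lemma L2_limit_square_integrable:
  assumes f: "f \<in> borel_measurable M" and fn: "\<And>n. square_integrable M (fn n)"
    and lim: "(\<lambda>n. \<integral>\<^sup>+ x. ennreal ((f x - fn n x)\<^sup>2) \<partial>M) \<longlonglongrightarrow> 0"
  shows "square_integrable M f"
proof -
  have "eventually (\<lambda>n. (\<integral>\<^sup>+ x. ennreal ((f x - fn n x)\<^sup>2) \<partial>M) < 1) sequentially"
    using lim by (rule order_tendstoD) simp
  then obtain n where "(\<integral>\<^sup>+ x. ennreal ((f x - fn n x)\<^sup>2) \<partial>M) < 1"
    by (auto simp: eventually_sequentially)
  then have "(\<integral>\<^sup>+ x. ennreal ((f x - fn n x)\<^sup>2) \<partial>M) < \<infinity>"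
    by (metis ennreal_one_less_top infinity_ennreal_def order_less_trans)
  then have "square_integrable M (\<lambda>x. f x - fn n x)"
    using f fn[of n] by (intro square_integrable_nn_integral) (auto simp: square_integrable_def)
  from square_integrable_add[OF this fn[of n]] show ?thesis by simp
qed

lemma L2_limit_inner:
  assumes f: "f \<in> borel_measurable M" and fn: "\<And>n. square_integrable M (fn n)"
    and f_lim: "(\<lambda>n. \<integral>\<^sup>+ x. ennreal ((f x - fn n x)\<^sup>2) \<partial>M) \<longlonglongrightarrow> 0"
    and g: "g \<in> borel_measurable M" and gn: "\<And>n. square_integrable M (gn n)"
    and g_lim: "(\<lambda>n. \<integral>\<^sup>+ x. ennreal ((g x - gn n x)\<^sup>2) \<partial>M) \<longlonglongrightarrow> 0"
  shows "(\<lambda>n. \<integral>x. fn n x * gn n x \<partial>M) \<longlonglongrightarrow> (\<integral>x. f x * g x \<partial>M)"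
proof -
  have f2: "square_integrable M f" and g2: "square_integrable M g"
    using L2_limit_square_integrable[OF f fn f_lim] L2_limit_square_integrable[OF g gn g_lim] .
  have fd: "square_integrable M (\<lambda>x. f x - fn n x)" for n
    by (rule square_integrable_diff[OF f2 fn])
  have gd: "square_integrable M (\<lambda>x. g x - gn n x)" for n
    by (rule square_integrable_diff[OF g2 gn])
  have to_real: "(\<lambda>n. \<integral>x. (u n x)\<^sup>2 \<partial>M) \<longlonglongrightarrow> 0"
    if u: "\<And>n. square_integrable M (u n)" and "(\<lambda>n. \<integral>\<^sup>+ x. ennreal ((u n x)\<^sup>2) \<partial>M) \<longlonglongrightarrow> 0"
    for u :: "nat \<Rightarrow> 'a \<Rightarrow> real"
  proof -
    have "(\<integral>\<^sup>+ x. ennreal ((u n x)\<^sup>2) \<partial>M) = ennreal (\<integral>x. (u n x)\<^sup>2 \<partial>M)" for n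
      using u[of n] by (intro nn_integral_eq_integral) (auto simp: square_integrable_def)
    then show ?thesis using that(2) by (simp add: tendsto_ennreal_iff flip: ennreal_0)
  qed
  define a b where "a n = sqrt (\<integral>x. (f x - fn n x)\<^sup>2 \<partial>M)"
    and "b n = sqrt (\<integral>x. (g x - gn n x)\<^sup>2 \<partial>M)" for n
  define \<alpha> \<beta> where "\<alpha> = sqrt (\<integral>x. (f x)\<^sup>2 \<partial>M)" and "\<beta> = sqrt (\<integral>x. (g x)\<^sup>2 \<partial>M)"
  have a0: "a \<longlonglongrightarrow> 0" and b0: "b \<longlonglongrightarrow> 0"
    unfolding a_def b_def
    using tendsto_real_sqrt[OF to_real[OF fd f_lim]] tendsto_real_sqrt[OF to_real[OF gd g_lim]]
    by simp_all
  \<comment> \<open>\<open>f\<^sub>n g\<^sub>n - f g = (f - f\<^sub>n) (g - g\<^sub>n) - f (g - g\<^sub>n) - (f - f\<^sub>n) g\<close>, term by term\<close>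
  have bound: "\<bar>(\<integral>x. fn n x * gn n x \<partial>M) - (\<integral>x. f x * g x \<partial>M)\<bar> \<le> a n * b n + \<alpha> * b n + a n * \<beta>"
    for n
  proof -
    have "(\<integral>x. fn n x * gn n x \<partial>M) =
        (\<integral>x. f x * g x + (f x - fn n x) * (g x - gn n x) - f x * (g x - gn n x) - (f x - fn n x) * g x \<partial>M)"
      by (intro Bochner_Integration.integral_cong) (auto simp: algebra_simps)
    also have "\<dots> = (\<integral>x. f x * g x \<partial>M) + (\<integral>x. (f x - fn n x) * (g x - gn n x) \<partial>M)
        - (\<integral>x. f x * (g x - gn n x) \<partial>M) - (\<integral>x. (f x - fn n x) * g x \<partial>M)"
      using square_integrable_mult[OF f2 g2] square_integrable_mult[OF fd gd, of n n]
        square_integrable_mult[OF f2 gd, of n] square_integrable_mult[OF fd g2, of n]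
      by simp
    finally show ?thesis
      using integral_Cauchy_Schwarz[OF fd gd, of n n] integral_Cauchy_Schwarz[OF f2 gd, of n]
        integral_Cauchy_Schwarz[OF fd g2, of n]
      unfolding a_def b_def \<alpha>_def \<beta>_def by linarith
  qed
  have "(\<lambda>n. a n * b n + \<alpha> * b n + a n * \<beta>) \<longlonglongrightarrow> 0 * 0 + \<alpha> * 0 + 0 * \<beta>"
    by (intro tendsto_intros a0 b0)
  then have lim: "(\<lambda>n. a n * b n + \<alpha> * b n + a n * \<beta>) \<longlonglongrightarrow> 0" by simp
  have "(\<lambda>n. (\<integral>x. fn n x * gn n x \<partial>M) - (\<integral>x. f x * g x \<partial>M)) \<longlonglongrightarrow> 0"
    by (rule Lim_null_comparison[OF _ lim]) (simp add: bound)
  then show ?thesis by (simp add: LIM_zero_iff)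
qed

text \<open>Averaging over a parameter with a probability law keeps a bounded second moment (by
  Jensen's inequality) and commutes with the inner product (by Fubini's theorem). This is how
  the drift, which is an average of the centred volatility over past times, is handled.\<close>

lemma (in pair_prob_space) square_integrable_average:
  fixes W :: "'a \<Rightarrow> 'b \<Rightarrow> real"
  assumes W [measurable]: "(\<lambda>(x, z). W x z) \<in> borel_measurable (M1 \<Otimes>\<^sub>M M2)"
    and C: "\<And>z. z \<in> space M2 \<Longrightarrow> (\<integral>\<^sup>+ x. ennreal ((W x z)\<^sup>2) \<partial>M1) \<le> ennreal C"
  shows "square_integrable (M1 \<Otimes>\<^sub>M M2) (\<lambda>(x, z). W x z)"
    and "square_integrable M1 (\<lambda>x. \<integral>z. W x z \<partial>M2)"
    and "square_integrable M1 G \<Longrightarrow>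
      (\<integral>x. G x * (\<integral>z. W x z \<partial>M2) \<partial>M1) = (\<integral>z. (\<integral>x. G x * W x z \<partial>M1) \<partial>M2)"
proof -
  have "(\<integral>\<^sup>+ p. ennreal (((\<lambda>(x, z). W x z) p)\<^sup>2) \<partial>(M1 \<Otimes>\<^sub>M M2)) =
      (\<integral>\<^sup>+ z. (\<integral>\<^sup>+ x. ennreal ((W x z)\<^sup>2) \<partial>M1) \<partial>M2)"
    by (subst nn_integral_snd[symmetric]) (auto simp: case_prod_unfold)
  also have "\<dots> \<le> (\<integral>\<^sup>+ z. ennreal C \<partial>M2)"
    by (intro nn_integral_mono C)
  also have "\<dots> < \<infinity>" by (simp add: M2.emeasure_space_1)
  finally show W2: "square_integrable (M1 \<Otimes>\<^sub>M M2) (\<lambda>(x, z). W x z)"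
    by (intro square_integrable_nn_integral) auto
  have int2: "integrable (M1 \<Otimes>\<^sub>M M2) (\<lambda>(x, z). (W x z)\<^sup>2)"
    using W2 by (simp add: square_integrable_def case_prod_unfold)
  have "AE x in M1. (\<integral>z. W x z \<partial>M2)\<^sup>2 \<le> (\<integral>z. (W x z)\<^sup>2 \<partial>M2)"
    using AE_integrable_fst[OF int2] AE_space
  proof eventually_elim
    case (elim x)
    have x [measurable]: "(\<lambda>z. W x z) \<in> borel_measurable M2" using elim(2) W by simp
    have "square_integrable M2 (W x)" using elim(1) x by (simp add: square_integrable_def)
    from integral_Cauchy_Schwarz[OF this M2.square_integrable_const[of 1]]
    have "\<bar>\<integral>z. W x z \<partial>M2\<bar> \<le> sqrt (\<integral>z. (W x z)\<^sup>2 \<partial>M2)" by (simp add: M2.prob_space)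
    then have "\<bar>\<integral>z. W x z \<partial>M2\<bar>\<^sup>2 \<le> (sqrt (\<integral>z. (W x z)\<^sup>2 \<partial>M2))\<^sup>2" by (intro power_mono) auto
    then show ?case by simp
  qed
  moreover have avg_meas [measurable]: "(\<lambda>x. \<integral>z. W x z \<partial>M2) \<in> borel_measurable M1"
    by (intro M2.borel_measurable_lebesgue_integral) simp
  ultimately have "integrable M1 (\<lambda>x. (\<integral>z. W x z \<partial>M2)\<^sup>2)"
    by (intro Bochner_Integration.integrable_bound[OF integrable_fst[OF int2]]) auto
  then show "square_integrable M1 (\<lambda>x. \<integral>z. W x z \<partial>M2)"
    by (simp add: square_integrable_def)
  assume G: "square_integrable M1 G"
  then have [measurable]: "G \<in> borel_measurable M1" by (simp add: square_integrable_def)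
  have "square_integrable (M1 \<Otimes>\<^sub>M M2) (\<lambda>p. G (fst p))"
  proof (intro square_integrable_nn_integral)
    have "(\<integral>\<^sup>+ p. ennreal ((G (fst p))\<^sup>2) \<partial>(M1 \<Otimes>\<^sub>M M2)) =
        (\<integral>\<^sup>+ x. (\<integral>\<^sup>+ z. ennreal ((G x)\<^sup>2) \<partial>M2) \<partial>M1)"
      by (subst M2.nn_integral_fst[symmetric]) auto
    also have "\<dots> = ennreal (\<integral>x. (G x)\<^sup>2 \<partial>M1)"
      using G by (subst nn_integral_eq_integral[symmetric])
        (auto simp: square_integrable_def M2.emeasure_space_1)
    finally show "(\<integral>\<^sup>+ p. ennreal ((G (fst p))\<^sup>2) \<partial>(M1 \<Otimes>\<^sub>M M2)) < \<infinity>" by (simp only: ennreal_less_top infinity_ennreal_def)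
  qed simp
  from square_integrable_mult[OF this W2]
  have int: "integrable (M1 \<Otimes>\<^sub>M M2) (\<lambda>(x, z). G x * W x z)"
    by (simp add: case_prod_unfold)
  show "(\<integral>x. G x * (\<integral>z. W x z \<partial>M2) \<partial>M1) = (\<integral>z. (\<integral>x. G x * W x z \<partial>M1) \<partial>M2)"
    using Fubini_integral[OF int] by simp
qed

section \<open>First and second moments of a Poisson random measure\<close>

text \<open>Counts of a Poisson random measure have Poisson laws only on sets of finite intensity.
  With a \<open>\<sigma>\<close>-finite intensity, starting the usual induction over nonnegative functions from
  such sets is enough, because the other sets are increasing unions of them.\<close>

lemma (in sigma_finite_measure) borel_measurable_induct_finite_sets
    [consumes 1, case_names cong set mult add seq]:
  fixes f :: "'a \<Rightarrow> ennreal"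
  assumes f: "f \<in> borel_measurable M"
    and cong: "\<And>f g. f \<in> borel_measurable M \<Longrightarrow> g \<in> borel_measurable M \<Longrightarrow>
      (\<And>x. x \<in> space M \<Longrightarrow> f x = g x) \<Longrightarrow> P g \<Longrightarrow> P f"
    and set: "\<And>A. A \<in> sets M \<Longrightarrow> emeasure M A < \<infinity> \<Longrightarrow> P (indicator A)"
    and mult: "\<And>c u. u \<in> borel_measurable M \<Longrightarrow> P u \<Longrightarrow> P (\<lambda>x. c * u x)"
    and add: "\<And>u v. u \<in> borel_measurable M \<Longrightarrow> v \<in> borel_measurable M \<Longrightarrow> P u \<Longrightarrow> P v \<Longrightarrow>
      P (\<lambda>x. u x + v x)"
    and seq: "\<And>U. (\<And>i::nat. U i \<in> borel_measurable M) \<Longrightarrow> (\<And>i. P (U i)) \<Longrightarrow> incseq U \<Longrightarrow>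
      P (\<lambda>x. SUP i. U i x)"
  shows "P f"
  using f
proof (induction rule: borel_measurable_induct)
  case (cong f g)
  then show ?case using assms(2) by blast
next
  case (set A)
  obtain C where C: "range C \<subseteq> sets M" "(\<Union>i. C i) = space M"
      "\<And>i. emeasure M (C i) \<noteq> \<infinity>" "incseq C"
    using sigma_finite_incseq by blast
  let ?U = "\<lambda>i. indicator (A \<inter> C i) :: 'a \<Rightarrow> ennreal"
  have fin: "emeasure M (A \<inter> C i) < \<infinity>" for i
    using C(1) C(3)[of i] set emeasure_mono[of "A \<inter> C i" "C i" M]
    by (metis Int_lower2 infinity_ennreal_def less_top order_le_less_trans range_subsetD)
  have "P (\<lambda>x. SUP i. ?U i x)"
  proof (intro assms(6) assms(3))
    show "incseq ?U"
      using C(4) by (auto simp: incseq_def le_fun_def indicator_def)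
  qed (use C(1) set fin in auto)
  moreover have "indicator A x = (SUP i. ?U i x)" if "x \<in> space M" for x
  proof (rule antisym)
    obtain j where "x \<in> C j" using C(2) \<open>x \<in> space M\<close> by auto
    then have "indicator A x \<le> ?U j x" by (auto simp: indicator_def)
    also have "\<dots> \<le> (SUP i. ?U i x)" by (intro SUP_upper) simp
    finally show "indicator A x \<le> (SUP i. ?U i x)" .
    show "(SUP i. ?U i x) \<le> indicator A x"
      by (intro SUP_least) (auto simp: indicator_def)
  qed
  ultimately show ?case
    using C(1) set by (intro assms(2)[of "indicator A" "\<lambda>x. SUP i. ?U i x"]) auto
next
  case (mult u c)
  then show ?case using assms(4) by blast
next
  case (add u v)
  then show ?case using assms(5) by blast
next
  case (seq U)
  have "(SUP i. U i) = (\<lambda>x. SUP i. U i x)" by (auto simp: image_comp)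
  then show ?case using assms(6)[of U] seq by metis
qed

lemma poisson_moments:
  fixes l :: real
  defines "p \<equiv> \<lambda>k::nat. l ^ k / fact k * exp (- l)"
  shows poisson_sums_mass: "p sums 1"
    and poisson_sums_mean: "(\<lambda>k. real k * p k) sums l"
    and poisson_sums_square: "(\<lambda>k. (real k)\<^sup>2 * p k) sums (l\<^sup>2 + l)"
proof -
  have rec: "real (Suc k) * p (Suc k) = l * p k" for k
    unfolding p_def by (simp add: field_simps del: of_nat_Suc)
  have "(\<lambda>k. (l ^ k /\<^sub>R fact k) * exp (- l)) sums (exp l * exp (- l))"
    by (intro sums_mult2 exp_converges)
  then show mass: "p sums 1"
    by (simp add: p_def divide_inverse mult.commute flip: exp_add)
  have "(\<lambda>k. real (Suc k) * p (Suc k)) sums (l * 1)"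
    unfolding rec by (intro sums_mult mass)
  then show mean: "(\<lambda>k. real k * p k) sums l"
    by (subst (asm) sums_Suc_iff) simp
  have "(\<lambda>k. l * (real k * p k) + l * p k) sums (l * l + l * 1)"
    by (intro sums_add sums_mult mass mean)
  moreover have "(real (Suc k))\<^sup>2 * p (Suc k) = l * (real k * p k) + l * p k" for k
  proof -
    have "(real (Suc k))\<^sup>2 * p (Suc k) = real (Suc k) * (l * p k)"
      by (simp only: power2_eq_square mult.assoc rec)
    then show ?thesis by (simp add: algebra_simps)
  qed
  ultimately have "(\<lambda>k. (real (Suc k))\<^sup>2 * p (Suc k)) sums (l\<^sup>2 + l)"
    by (simp add: power2_eq_square)
  then show "(\<lambda>k. (real k)\<^sup>2 * p k) sums (l\<^sup>2 + l)"
    by (subst (asm) sums_Suc_iff) simp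
qed

locale poisson_random = prob_space M + L: sigma_finite_measure L
  for M :: "'w measure" and L :: "'a measure" +
  fixes N :: "'w \<Rightarrow> 'a measure"
  assumes poisson: "poisson_random_measure M L N"
begin

abbreviation NI :: "('a \<Rightarrow> ennreal) \<Rightarrow> 'w \<Rightarrow> ennreal" where
  "NI f \<omega> \<equiv> \<integral>\<^sup>+ x. f x \<partial>N \<omega>"

lemma sets_N: "\<omega> \<in> space M \<Longrightarrow> sets (N \<omega>) = sets L"
  using poisson by (simp add: poisson_random_measure_def)

lemma space_N: "\<omega> \<in> space M \<Longrightarrow> space (N \<omega>) = space L"
  using sets_N sets_eq_imp_space_eq by blast

lemma measurable_N: "\<omega> \<in> space M \<Longrightarrow> f \<in> borel_measurable L \<Longrightarrow> f \<in> borel_measurable (N \<omega>)"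
  using measurable_cong_sets[OF sets_N refl] by blast

lemma count_measurable [measurable (raw)]:
  "A \<in> sets L \<Longrightarrow> (\<lambda>\<omega>. emeasure (N \<omega>) A) \<in> borel_measurable M"
  using poisson by (simp add: poisson_random_measure_def)

text \<open>The sub-\<open>\<sigma>\<close>-algebra is a parameter because integrals over past and future points must
  be located in the past and future parts of the filtration.\<close>

lemma integral_N_measurable_sub:
  assumes G: "space G = space M" and C: "C \<in> sets L"
    and count: "\<And>A. A \<in> sets L \<Longrightarrow> A \<subseteq> C \<Longrightarrow> (\<lambda>\<omega>. emeasure (N \<omega>) A) \<in> borel_measurable G"
    and f: "f \<in> borel_measurable L"
  shows "(\<lambda>\<omega>. \<integral>\<^sup>+ x. f x * indicator C x \<partial>N \<omega>) \<in> borel_measurable G"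
  using f
proof (induction rule: L.borel_measurable_induct_finite_sets)
  case (cong f g)
  have "(\<integral>\<^sup>+ x. f x * indicator C x \<partial>N \<omega>) = (\<integral>\<^sup>+ x. g x * indicator C x \<partial>N \<omega>)"
    if "\<omega> \<in> space G" for \<omega>
    using that cong.hyps(3) G space_N by (intro nn_integral_cong) auto
  then show ?case using cong.IH by (simp cong: measurable_cong)
next
  case (set A)
  have "(\<integral>\<^sup>+ x. indicator A x * indicator C x \<partial>N \<omega>) = emeasure (N \<omega>) (A \<inter> C)"
    if "\<omega> \<in> space G" for \<omega>
    using that set C G by (simp add: sets_N flip: indicator_inter_arith)
  moreover have "(\<lambda>\<omega>. emeasure (N \<omega>) (A \<inter> C)) \<in> borel_measurable G"
    using set C by (intro count) auto
  ultimately show ?case by (simp cong: measurable_cong)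
next
  case (mult c u)
  have "(\<integral>\<^sup>+ x. c * u x * indicator C x \<partial>N \<omega>) = c * (\<integral>\<^sup>+ x. u x * indicator C x \<partial>N \<omega>)"
    if "\<omega> \<in> space G" for \<omega>
    using that mult.hyps C G by (subst nn_integral_cmult[symmetric])
      (auto simp: mult.assoc intro!: measurable_N)
  moreover have "(\<lambda>\<omega>. c * (\<integral>\<^sup>+ x. u x * indicator C x \<partial>N \<omega>)) \<in> borel_measurable G"
    by (intro borel_measurable_times_ennreal mult.IH) simp
  ultimately show ?case by (simp cong: measurable_cong)
next
  case (add u v)
  have "(\<integral>\<^sup>+ x. (u x + v x) * indicator C x \<partial>N \<omega>) =
      (\<integral>\<^sup>+ x. u x * indicator C x \<partial>N \<omega>) + (\<integral>\<^sup>+ x. v x * indicator C x \<partial>N \<omega>)"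
    if "\<omega> \<in> space G" for \<omega>
    using that add.hyps C G by (subst nn_integral_add[symmetric])
      (auto simp: distrib_right intro!: measurable_N)
  moreover have "(\<lambda>\<omega>. (\<integral>\<^sup>+ x. u x * indicator C x \<partial>N \<omega>) +
      (\<integral>\<^sup>+ x. v x * indicator C x \<partial>N \<omega>)) \<in> borel_measurable G"
    by (intro borel_measurable_add add.IH)
  ultimately show ?case by (simp cong: measurable_cong)
next
  case (seq U)
  have "(\<integral>\<^sup>+ x. (SUP i. U i x) * indicator C x \<partial>N \<omega>) = (SUP i. \<integral>\<^sup>+ x. U i x * indicator C x \<partial>N \<omega>)"
    if "\<omega> \<in> space G" for \<omega>
    using that seq.hyps C G
    by (subst nn_integral_monotone_convergence_SUP[symmetric])
      (auto simp: SUP_mult_right_ennreal incseq_def le_fun_def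
        intro!: measurable_N mult_right_mono)
  moreover have "(\<lambda>\<omega>. SUP i. \<integral>\<^sup>+ x. U i x * indicator C x \<partial>N \<omega>) \<in> borel_measurable G"
    by (intro borel_measurable_SUP seq.IH) simp
  ultimately show ?case by (simp cong: measurable_cong)
qed

lemma integral_N_measurable:
  assumes f: "f \<in> borel_measurable L"
  shows "(\<lambda>\<omega>. \<integral>\<^sup>+ x. f x \<partial>N \<omega>) \<in> borel_measurable M"
proof -
  have "(\<lambda>\<omega>. \<integral>\<^sup>+ x. f x * indicator (space L) x \<partial>N \<omega>) \<in> borel_measurable M"
    by (intro integral_N_measurable_sub f) auto
  moreover have "(\<integral>\<^sup>+ x. f x * indicator (space L) x \<partial>N \<omega>) = (\<integral>\<^sup>+ x. f x \<partial>N \<omega>)"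
    if "\<omega> \<in> space M" for \<omega>
    using space_N[OF that] by (intro nn_integral_cong) auto
  ultimately show ?thesis by (simp cong: measurable_cong)
qed

text \<open>The Poisson weights add up to one, so the count is almost surely a natural number and
  its law is determined by these weights.\<close>

lemma nn_integral_count:
  assumes A [measurable]: "A \<in> sets L" and fin: "emeasure L A < \<infinity>"
  shows "(\<integral>\<^sup>+ \<omega>. g (emeasure (N \<omega>) A) \<partial>M) =
    (\<Sum>k::nat. g (of_nat k) * ennreal (measure L A ^ k / fact k * exp (- measure L A)))"
proof -
  define E where "E k = {\<omega> \<in> space M. emeasure (N \<omega>) A = of_nat k}" for k :: nat
  have E [measurable]: "E k \<in> sets M" for k unfolding E_def by measurable
  have prob_E: "prob (E k) = measure L A ^ k / fact k * exp (- measure L A)" for k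
    using poisson fin A by (simp add: poisson_random_measure_def E_def)
  have disj: "disjoint_family E"
    by (auto simp: disjoint_family_on_def E_def)
  have "(\<lambda>k. prob (E k)) sums prob (\<Union>k. E k)"
    by (intro finite_measure_UNION disj) auto
  then have "prob (\<Union>k. E k) = 1"
    unfolding prob_E using poisson_sums_mass sums_unique2 by blast
  then have "AE \<omega> in M. \<omega> \<in> (\<Union>k. E k)"
    by (subst (asm) prob_eq_1) auto
  then have "(\<integral>\<^sup>+ \<omega>. g (emeasure (N \<omega>) A) \<partial>M) =
      (\<integral>\<^sup>+ \<omega>. (\<Sum>k. g (of_nat k) * indicator (E k) \<omega>) \<partial>M)"
  proof (intro nn_integral_cong_AE, eventually_elim)
    case (elim \<omega>)
    then obtain k where k: "\<omega> \<in> E k" by auto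
    from k have "emeasure (N \<omega>) A = of_nat k" by (simp add: E_def)
    then show ?case using suminf_cmult_indicator[OF disj k, of "\<lambda>k. g (of_nat k)"] by simp
  qed
  also have "\<dots> = (\<Sum>k. g (of_nat k) * emeasure M (E k))"
    by (subst nn_integral_suminf) (auto simp: nn_integral_cmult_indicator)
  finally show ?thesis by (simp add: emeasure_eq_measure prob_E)
qed

lemma count_mean:
  assumes A: "A \<in> sets L" "emeasure L A < \<infinity>"
  shows "(\<integral>\<^sup>+ \<omega>. emeasure (N \<omega>) A \<partial>M) = emeasure L A"
proof -
  let ?l = "measure L A"
  have "(\<integral>\<^sup>+ \<omega>. emeasure (N \<omega>) A \<partial>M) =
      (\<Sum>k::nat. of_nat k * ennreal (?l ^ k / fact k * exp (- ?l)))"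
    by (rule nn_integral_count[OF A, of "\<lambda>x. x"])
  also have "\<dots> = (\<Sum>k::nat. ennreal (real k * (?l ^ k / fact k * exp (- ?l))))"
    by (intro suminf_cong) (simp add: ennreal_of_nat_eq_real_of_nat flip: ennreal_mult'')
  also have "\<dots> = ennreal ?l"
    using poisson_sums_mean[of ?l] by (intro suminf_ennreal_eq) auto
  finally show ?thesis using A(2) by (simp add: emeasure_eq_ennreal_measure less_top)
qed

lemma count_square_mean:
  assumes A: "A \<in> sets L" "emeasure L A < \<infinity>"
  shows "(\<integral>\<^sup>+ \<omega>. emeasure (N \<omega>) A * emeasure (N \<omega>) A \<partial>M) =
    emeasure L A * emeasure L A + emeasure L A"
proof -
  let ?l = "measure L A"
  have "(\<integral>\<^sup>+ \<omega>. emeasure (N \<omega>) A * emeasure (N \<omega>) A \<partial>M) =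
      (\<Sum>k::nat. of_nat k * of_nat k * ennreal (?l ^ k / fact k * exp (- ?l)))"
    by (rule nn_integral_count[OF A, of "\<lambda>x. x * x"])
  also have "\<dots> = (\<Sum>k::nat. ennreal ((real k)\<^sup>2 * (?l ^ k / fact k * exp (- ?l))))"
    by (intro suminf_cong)
      (simp add: ennreal_of_nat_eq_real_of_nat power2_eq_square flip: ennreal_mult'')
  also have "\<dots> = ennreal (?l\<^sup>2 + ?l)"
    using poisson_sums_square[of ?l] by (intro suminf_ennreal_eq) auto
  also have "\<dots> = ennreal ?l * ennreal ?l + ennreal ?l"
    by (simp add: power2_eq_square ennreal_mult ennreal_plus)
  finally show ?thesis using A(2) by (simp add: emeasure_eq_ennreal_measure less_top)
qed

lemma count_product_mean_disjoint:
  assumes A: "A \<in> sets L" "emeasure L A < \<infinity>" and B: "B \<in> sets L" "emeasure L B < \<infinity>"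
    and disj: "A \<inter> B = {}"
  shows "(\<integral>\<^sup>+ \<omega>. emeasure (N \<omega>) A * emeasure (N \<omega>) B \<partial>M) = emeasure L A * emeasure L B"
proof -
  let ?A = "\<lambda>i::nat. if i = 0 then A else B"
  have "indep_vars (\<lambda>_. borel) (\<lambda>i \<omega>. emeasure (N \<omega>) (?A i)) {..<2}"
  proof -
    have "(\<forall>i<2. ?A i \<in> sets L) \<and> disjoint_family_on ?A {..<2}"
      using A B disj by (auto simp: disjoint_family_on_def)
    moreover have "\<forall>(n::nat) A. (\<forall>i<n. A i \<in> sets L) \<and> disjoint_family_on A {..<n} \<longrightarrow>
        indep_vars (\<lambda>_. borel) (\<lambda>i \<omega>. emeasure (N \<omega>) (A i)) {..<n}"
      using poisson unfolding poisson_random_measure_def by (elim conjE)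
    ultimately show ?thesis by (elim allE[of _ "2::nat"] allE[of _ ?A] impE)
  qed
  from indep_vars_nn_integral[OF _ this]
  have "(\<integral>\<^sup>+ \<omega>. (\<Prod>i<2. emeasure (N \<omega>) (?A i)) \<partial>M) = (\<Prod>i<2. \<integral>\<^sup>+ \<omega>. emeasure (N \<omega>) (?A i) \<partial>M)"
    by simp
  then show ?thesis
    by (simp add: numeral_2_eq_2 lessThan_Suc count_mean[OF A] count_mean[OF B] mult.commute)
qed

text \<open>Cutting both sets along their intersection reduces mixed moments of counts to
  independent counts and one square.\<close>

lemma count_product_mean:
  assumes A: "A \<in> sets L" "emeasure L A < \<infinity>" and B: "B \<in> sets L" "emeasure L B < \<infinity>"
  shows "(\<integral>\<^sup>+ \<omega>. emeasure (N \<omega>) A * emeasure (N \<omega>) B \<partial>M) =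
    emeasure L A * emeasure L B + emeasure L (A \<inter> B)"
proof -
  let ?C = "A \<inter> B" and ?D = "A - B" and ?E = "B - A"
  have fin: "emeasure L ?C < \<infinity>" "emeasure L ?D < \<infinity>" "emeasure L ?E < \<infinity>"
    using A B emeasure_mono[of ?C A L] emeasure_mono[of ?D A L] emeasure_mono[of ?E B L]
    by (auto intro: order_le_less_trans)
  have [measurable]: "A \<in> sets L" "B \<in> sets L" using A B by auto
  have CDE: "?C \<in> sets L" "?D \<in> sets L" "?E \<in> sets L" by auto
  have split: "emeasure K A = emeasure K ?C + emeasure K ?D"
      "emeasure K B = emeasure K ?C + emeasure K ?E" if "sets K = sets L" for K :: "'a measure"
  proof -
    have "?C \<inter> ?D = {}" "?C \<inter> ?E = {}" "?C \<union> ?D = A" "?C \<union> ?E = B" by auto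
    then show "emeasure K A = emeasure K ?C + emeasure K ?D"
        "emeasure K B = emeasure K ?C + emeasure K ?E"
      using that CDE plus_emeasure[of ?C K ?D] plus_emeasure[of ?C K ?E] by simp_all
  qed
  have "(\<integral>\<^sup>+ \<omega>. emeasure (N \<omega>) A * emeasure (N \<omega>) B \<partial>M) =
      (\<integral>\<^sup>+ \<omega>. emeasure (N \<omega>) ?C * emeasure (N \<omega>) ?C + emeasure (N \<omega>) ?C * emeasure (N \<omega>) ?E
        + emeasure (N \<omega>) ?D * emeasure (N \<omega>) ?C + emeasure (N \<omega>) ?D * emeasure (N \<omega>) ?E \<partial>M)"
    by (intro nn_integral_cong) (simp only: split[OF sets_N] distrib_left distrib_right ac_simps)
  also have "\<dots> = (emeasure L ?C * emeasure L ?C + emeasure L ?C)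
      + emeasure L ?C * emeasure L ?E + emeasure L ?D * emeasure L ?C + emeasure L ?D * emeasure L ?E"
  proof -
    have "?C \<inter> ?E = {}" "?D \<inter> ?C = {}" "?D \<inter> ?E = {}" by auto
    with CDE fin show ?thesis
      by (simp add: nn_integral_add count_square_mean count_product_mean_disjoint)
  qed
  also have "\<dots> = emeasure L A * emeasure L B + emeasure L (A \<inter> B)"
    by (simp add: split[OF refl] distrib_left distrib_right ac_simps)
  finally show ?thesis .
qed

text \<open>Moments that are linear in \<open>N\<close> pass from counts to integrals. A fixed factor \<open>Z\<close> and the
  two terms on the right make the lemma cover the mean as well as mixed second moments.\<close>

lemma integral_N_moment_from_counts:
  assumes Z: "Z \<in> borel_measurable M" and g: "g \<in> borel_measurable L"
    and base: "\<And>A. A \<in> sets L \<Longrightarrow> emeasure L A < \<infinity> \<Longrightarrow>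
      (\<integral>\<^sup>+ \<omega>. emeasure (N \<omega>) A * Z \<omega> \<partial>M) = emeasure L A * c + (\<integral>\<^sup>+ x. indicator A x * g x \<partial>L)"
    and f: "f \<in> borel_measurable L"
  shows "(\<integral>\<^sup>+ \<omega>. NI f \<omega> * Z \<omega> \<partial>M) = (\<integral>\<^sup>+ x. f x \<partial>L) * c + (\<integral>\<^sup>+ x. f x * g x \<partial>L)"
  using f
proof (induction rule: L.borel_measurable_induct_finite_sets)
  case (cong f f')
  have "(\<integral>\<^sup>+ \<omega>. NI f \<omega> * Z \<omega> \<partial>M) = (\<integral>\<^sup>+ \<omega>. NI f' \<omega> * Z \<omega> \<partial>M)"
    using cong.hyps(3) space_N by (intro nn_integral_cong arg_cong2[where f="(*)"]) auto
  also have "\<dots> = (\<integral>\<^sup>+ x. f x \<partial>L) * c + (\<integral>\<^sup>+ x. f x * g x \<partial>L)"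
    unfolding cong.IH using cong.hyps(3)
    by (intro arg_cong2[where f="(+)"] arg_cong2[where f="(*)"] nn_integral_cong) auto
  finally show ?case .
next
  case (set A)
  have "(\<integral>\<^sup>+ \<omega>. NI (indicator A) \<omega> * Z \<omega> \<partial>M) = (\<integral>\<^sup>+ \<omega>. emeasure (N \<omega>) A * Z \<omega> \<partial>M)"
    using set by (intro nn_integral_cong) (simp add: sets_N)
  then show ?case using set base[OF set] by simp
next
  case (mult a u)
  have "(\<integral>\<^sup>+ \<omega>. NI (\<lambda>x. a * u x) \<omega> * Z \<omega> \<partial>M) = (\<integral>\<^sup>+ \<omega>. a * (NI u \<omega> * Z \<omega>) \<partial>M)"
    using mult.hyps by (intro nn_integral_cong) (simp add: nn_integral_cmult measurable_N mult.assoc)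
  also have "\<dots> = a * (\<integral>\<^sup>+ \<omega>. NI u \<omega> * Z \<omega> \<partial>M)"
    using mult.hyps Z by (intro nn_integral_cmult borel_measurable_times_ennreal integral_N_measurable)
  finally show ?case unfolding mult.IH using mult.hyps g
    by (simp add: nn_integral_cmult mult.assoc distrib_left)
next
  case (add u v)
  have "(\<integral>\<^sup>+ \<omega>. NI (\<lambda>x. u x + v x) \<omega> * Z \<omega> \<partial>M) = (\<integral>\<^sup>+ \<omega>. NI u \<omega> * Z \<omega> + NI v \<omega> * Z \<omega> \<partial>M)"
    using add.hyps by (intro nn_integral_cong) (simp add: nn_integral_add measurable_N distrib_right)
  also have "\<dots> = (\<integral>\<^sup>+ \<omega>. NI u \<omega> * Z \<omega> \<partial>M) + (\<integral>\<^sup>+ \<omega>. NI v \<omega> * Z \<omega> \<partial>M)"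
    using add.hyps Z by (intro nn_integral_add borel_measurable_times_ennreal integral_N_measurable)
  finally show ?case unfolding add.IH using add.hyps g
    by (simp add: nn_integral_add distrib_right distrib_left ac_simps)
next
  case (seq U)
  have mono: "incseq (\<lambda>i. \<integral>\<^sup>+ x. U i x \<partial>K)" for K
    using seq.hyps(2) by (auto simp: incseq_def le_fun_def intro!: nn_integral_mono)
  have "(\<integral>\<^sup>+ \<omega>. NI (\<lambda>x. SUP i. U i x) \<omega> * Z \<omega> \<partial>M) = (\<integral>\<^sup>+ \<omega>. (SUP i. NI (U i) \<omega> * Z \<omega>) \<partial>M)"
    using seq.hyps by (intro nn_integral_cong)
      (simp add: nn_integral_monotone_convergence_SUP measurable_N SUP_mult_right_ennreal)
  also have "\<dots> = (SUP i. \<integral>\<^sup>+ \<omega>. NI (U i) \<omega> * Z \<omega> \<partial>M)"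
    using seq.hyps(1) mono Z
    by (intro nn_integral_monotone_convergence_SUP borel_measurable_times_ennreal integral_N_measurable)
      (auto simp: incseq_def le_fun_def intro!: mult_right_mono)
  also have "\<dots> = (SUP i. (\<integral>\<^sup>+ x. U i x \<partial>L) * c) + (SUP i. \<integral>\<^sup>+ x. U i x * g x \<partial>L)"
    unfolding seq.IH using seq.hyps(2) mono[of L]
    by (intro ennreal_SUP_add)
      (auto simp: incseq_def le_fun_def intro!: mult_right_mono nn_integral_mono)
  also have "(SUP i. (\<integral>\<^sup>+ x. U i x \<partial>L) * c) = (\<integral>\<^sup>+ x. (SUP i. U i x) \<partial>L) * c"
    using seq.hyps by (simp add: nn_integral_monotone_convergence_SUP SUP_mult_right_ennreal)
  also have "(SUP i. \<integral>\<^sup>+ x. U i x * g x \<partial>L) = (\<integral>\<^sup>+ x. (SUP i. U i x) * g x \<partial>L)"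
    using seq.hyps g by (subst nn_integral_monotone_convergence_SUP[symmetric])
      (auto simp: incseq_def le_fun_def SUP_mult_right_ennreal intro!: mult_right_mono)
  finally show ?case .
qed

text \<open>Campbell's formulas for the mean and for the mixed second moment; in the second, indicators
  are replaced by functions in one argument at a time.\<close>

lemma integral_N_mean:
  assumes f: "f \<in> borel_measurable L"
  shows "(\<integral>\<^sup>+ \<omega>. NI f \<omega> \<partial>M) = (\<integral>\<^sup>+ x. f x \<partial>L)"
  using integral_N_moment_from_counts[of "\<lambda>_. 1" "\<lambda>_. 0" 1, OF _ _ _ f] by (simp add: count_mean)

lemma integral_N_product_mean:
  assumes f: "f \<in> borel_measurable L" and g: "g \<in> borel_measurable L"
  shows "(\<integral>\<^sup>+ \<omega>. NI f \<omega> * NI g \<omega> \<partial>M) =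
    (\<integral>\<^sup>+ x. f x \<partial>L) * (\<integral>\<^sup>+ x. g x \<partial>L) + (\<integral>\<^sup>+ x. f x * g x \<partial>L)"
proof (rule integral_N_moment_from_counts[OF integral_N_measurable[OF g] g _ f])
  fix B assume B: "B \<in> sets L" "emeasure L B < \<infinity>"
  have "(\<integral>\<^sup>+ \<omega>. NI g \<omega> * emeasure (N \<omega>) B \<partial>M) =
      (\<integral>\<^sup>+ x. g x \<partial>L) * emeasure L B + (\<integral>\<^sup>+ x. g x * indicator B x \<partial>L)"
  proof (rule integral_N_moment_from_counts[OF count_measurable _ _ g])
    fix A assume A: "A \<in> sets L" "emeasure L A < \<infinity>"
    show "(\<integral>\<^sup>+ \<omega>. emeasure (N \<omega>) A * emeasure (N \<omega>) B \<partial>M) =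
        emeasure L A * emeasure L B + (\<integral>\<^sup>+ x. indicator A x * indicator B x \<partial>L)"
      using A B by (simp add: count_product_mean flip: indicator_inter_arith)
  qed (use B in simp_all)
  then show "(\<integral>\<^sup>+ \<omega>. emeasure (N \<omega>) B * NI g \<omega> \<partial>M) =
      emeasure L B * (\<integral>\<^sup>+ x. g x \<partial>L) + (\<integral>\<^sup>+ x. indicator B x * g x \<partial>L)"
    by (simp add: mult.commute)
qed

text \<open>Joint measurability of integrals of \<open>N\<close> with a parameter. After restriction to a set
  \<open>C\<close> and normalisation by its count, \<open>N\<close> is a sub-probability kernel, with total mass 0 when
  that count is 0 or infinite. Outside a null set the normalisation can be undone, and the sets
  \<open>C\<close> exhaust the space.\<close>

lemma integral_N_parametric_measurable:
  assumes ne: "space L \<noteq> {}"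
  obtains G where "G \<in> sets M" "AE \<omega> in M. \<omega> \<in> G"
    "\<And>(T :: 's measure) f. (\<lambda>(s, x). f s x) \<in> borel_measurable (T \<Otimes>\<^sub>M L) \<Longrightarrow>
      (\<lambda>(\<omega>, s). indicator G \<omega> * (\<integral>\<^sup>+ x. f s x \<partial>N \<omega>)) \<in> borel_measurable (M \<Otimes>\<^sub>M T)"
proof -
  obtain C where C: "range C \<subseteq> sets L" "(\<Union>i. C i) = space L"
      "\<And>i. emeasure L (C i) \<noteq> \<infinity>" "incseq C"
    using L.sigma_finite_incseq by blast
  have [measurable]: "C i \<in> sets L" for i using C(1) by auto
  define G where "G = {\<omega> \<in> space M. \<forall>i. emeasure (N \<omega>) (C i) < \<infinity>}"
  have G [measurable]: "G \<in> sets M" unfolding G_def by measurable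
  have "AE \<omega> in M. emeasure (N \<omega>) (C i) \<noteq> \<infinity>" for i
    by (rule nn_integral_PInf_AE) (use C(3) in \<open>simp_all add: count_mean less_top\<close>)
  then have "AE \<omega> in M. \<forall>i. emeasure (N \<omega>) (C i) < \<infinity>"
    by (simp add: AE_all_countable less_top)
  then have AE_G: "AE \<omega> in M. \<omega> \<in> G"
    using AE_space by eventually_elim (simp add: G_def)
  define K where "K i \<omega> = density (N \<omega>) (\<lambda>x. indicator (C i) x / emeasure (N \<omega>) (C i))" for i \<omega>
  have emeasure_K: "emeasure (K i \<omega>) A = emeasure (N \<omega>) (A \<inter> C i) / emeasure (N \<omega>) (C i)"
    if "\<omega> \<in> space M" "A \<in> sets L" for i \<omega> A
  proof -
    have [measurable]: "C i \<in> sets (N \<omega>)" "A \<in> sets (N \<omega>)" using that by (auto simp: sets_N)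
    have "emeasure (K i \<omega>) A =
        (\<integral>\<^sup>+ x. indicator (A \<inter> C i) x * inverse (emeasure (N \<omega>) (C i)) \<partial>N \<omega>)"
      unfolding K_def by (subst emeasure_density)
        (auto simp: divide_ennreal_def indicator_def intro!: nn_integral_cong)
    then show ?thesis by (simp add: nn_integral_multc divide_ennreal_def)
  qed
  have K: "K i \<in> measurable M (subprob_algebra L)" for i
  proof (rule measurable_subprob_algebra)
    fix \<omega> assume w: "\<omega> \<in> space M"
    show sets: "sets (K i \<omega>) = sets L" by (simp add: K_def sets_N w)
    show "subprob_space (K i \<omega>)"
    proof
      show "space (K i \<omega>) \<noteq> {}" using sets_eq_imp_space_eq[OF sets] ne by simp
      have "c / c \<le> 1" for c :: ennreal
        by (cases "c = 0 \<or> c = top") (auto simp: ennreal_divide_self less_top)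
      moreover have "space L \<inter> C i = C i" using sets.sets_into_space[of "C i" L] by auto
      ultimately have "emeasure (K i \<omega>) (space L) \<le> 1"
        using w by (simp add: emeasure_K)
      then show "emeasure (K i \<omega>) (space (K i \<omega>)) \<le> 1"
        using sets_eq_imp_space_eq[OF sets] by simp
    qed
  next
    fix A assume A [measurable]: "A \<in> sets L"
    have "(\<lambda>\<omega>. emeasure (N \<omega>) (A \<inter> C i) / emeasure (N \<omega>) (C i)) \<in> borel_measurable M"
      by measurable
    then show "(\<lambda>\<omega>. emeasure (K i \<omega>) A) \<in> borel_measurable M"
      using A by (subst measurable_cong[OF emeasure_K]) auto
  qed
  show ?thesis
  proof (rule that[OF G AE_G])
    fix T :: "'s measure" and f :: "'s \<Rightarrow> 'a \<Rightarrow> ennreal"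
    assume f [measurable]: "(\<lambda>(s, x). f s x) \<in> borel_measurable (T \<Otimes>\<^sub>M L)"
    have undo: "indicator G \<omega> * (\<integral>\<^sup>+ x. f s x \<partial>N \<omega>) =
        indicator G \<omega> * (SUP i. emeasure (N \<omega>) (C i) * (\<integral>\<^sup>+ x. f s x \<partial>K i \<omega>))"
      if w: "\<omega> \<in> space M" and s: "s \<in> space T" for \<omega> s
    proof (cases "\<omega> \<in> G")
      case True
      have fs [measurable]: "f s \<in> borel_measurable (N \<omega>)"
        using s f by (intro measurable_N[OF w]) simp
      have Cw [measurable]: "C i \<in> sets (N \<omega>)" for i using w by (simp add: sets_N)
      have "emeasure (N \<omega>) (C i) * (\<integral>\<^sup>+ x. f s x \<partial>K i \<omega>) = (\<integral>\<^sup>+ x. f s x * indicator (C i) x \<partial>N \<omega>)" for i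
      proof -
        let ?c = "emeasure (N \<omega>) (C i)"
        have c: "?c < \<infinity>" using True by (simp add: G_def)
        have "(\<integral>\<^sup>+ x. f s x \<partial>K i \<omega>) = (\<integral>\<^sup>+ x. (f s x * indicator (C i) x) * inverse ?c \<partial>N \<omega>)"
          unfolding K_def by (subst nn_integral_density)
            (auto simp: divide_ennreal_def ac_simps intro!: nn_integral_cong)
        also have "\<dots> = (\<integral>\<^sup>+ x. f s x * indicator (C i) x \<partial>N \<omega>) * inverse ?c"
          by (rule nn_integral_multc) simp
        finally have eq: "(\<integral>\<^sup>+ x. f s x \<partial>K i \<omega>) = (\<integral>\<^sup>+ x. f s x * indicator (C i) x \<partial>N \<omega>) * inverse ?c" .
        show ?thesis
        proof (cases "?c = 0")
          case True
          then have "AE x in N \<omega>. x \<notin> C i" using Cw by (intro AE_not_in null_setsI)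
          then have "(\<integral>\<^sup>+ x. f s x * indicator (C i) x \<partial>N \<omega>) = 0"
            by (subst nn_integral_0_iff_AE) (auto simp: indicator_def)
          then show ?thesis using True by simp
        next
          case False
          then have "?c * inverse ?c = 1"
            using c by (simp add: ennreal_divide_self flip: divide_ennreal_def)
          then show ?thesis unfolding eq by (metis mult.assoc mult.commute mult_1)
        qed
      qed
      then have "(SUP i. emeasure (N \<omega>) (C i) * (\<integral>\<^sup>+ x. f s x \<partial>K i \<omega>)) =
          (SUP i. \<integral>\<^sup>+ x. f s x * indicator (C i) x \<partial>N \<omega>)" by simp
      also have "\<dots> = (\<integral>\<^sup>+ x. (SUP i. f s x * indicator (C i) x) \<partial>N \<omega>)"
        using C(4) by (intro nn_integral_monotone_convergence_SUP[symmetric])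
          (auto simp: incseq_def le_fun_def indicator_def)
      also have "\<dots> = (\<integral>\<^sup>+ x. f s x \<partial>N \<omega>)"
      proof (intro nn_integral_cong antisym)
        fix x assume "x \<in> space (N \<omega>)"
        then obtain j where "x \<in> C j" using C(2) space_N[OF w] by auto
        then show "f s x \<le> (SUP i. f s x * indicator (C i) x)"
          by (intro SUP_upper2[of j]) auto
        show "(SUP i. f s x * indicator (C i) x) \<le> f s x"
          by (intro SUP_least) (auto simp: indicator_def)
      qed
      finally show ?thesis by simp
    qed simp
    have "(\<lambda>p. integral\<^sup>N (K i (fst p)) (\<lambda>x. f (snd p) x)) \<in> borel_measurable (M \<Otimes>\<^sub>M T)" for i
    proof (rule nn_integral_measurable_subprob_algebra2)
      show "(\<lambda>(p, x). f (snd p) x) \<in> borel_measurable ((M \<Otimes>\<^sub>M T) \<Otimes>\<^sub>M L)"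
        by (simp add: case_prod_unfold)
      show "(\<lambda>p. K i (fst p)) \<in> measurable (M \<Otimes>\<^sub>M T) (subprob_algebra L)"
        using K by measurable
    qed
    moreover have "(\<lambda>p. emeasure (N (fst p)) (C i)) \<in> borel_measurable (M \<Otimes>\<^sub>M T)" for i
      by (rule measurable_compose[OF measurable_fst count_measurable]) simp
    ultimately have "(\<lambda>p. indicator G (fst p) *
        (SUP i. emeasure (N (fst p)) (C i) * integral\<^sup>N (K i (fst p)) (\<lambda>x. f (snd p) x)))
        \<in> borel_measurable (M \<Otimes>\<^sub>M T)"
      by (intro borel_measurable_times_ennreal borel_measurable_SUP) auto
    then show "(\<lambda>(\<omega>, s). indicator G \<omega> * (\<integral>\<^sup>+ x. f s x \<partial>N \<omega>)) \<in> borel_measurable (M \<Otimes>\<^sub>M T)"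
      by (subst measurable_cong) (auto simp: space_pair_measure undo)
  qed
qed

end

section \<open>The Ito isometry\<close>

lemma (in prob_space) indep_subalgebras_product:
  fixes X Y :: "'a \<Rightarrow> real"
  assumes ind: "indep_set (sets G) (sets H)" and sp: "space G = space M" "space H = space M"
    and X: "X \<in> borel_measurable G" "integrable M X"
    and Y: "Y \<in> borel_measurable H" "integrable M Y"
  shows "integrable M (\<lambda>\<omega>. X \<omega> * Y \<omega>)"
    and "expectation (\<lambda>\<omega>. X \<omega> * Y \<omega>) = expectation X * expectation Y"
proof -
  have sub: "sigma_sets (space M) {Z -` A \<inter> space M |A. A \<in> sets borel} \<subseteq> sets K"
    if "Z \<in> borel_measurable K" "space K = space M" for Z :: "'a \<Rightarrow> real" and K
    unfolding that(2)[symmetric]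
    by (intro sets.sigma_sets_subset) (auto intro: measurable_sets[OF that(1)])
  have "indep_set (sigma_sets (space M) {X -` A \<inter> space M |A. A \<in> sets borel})
      (sigma_sets (space M) {Y -` A \<inter> space M |A. A \<in> sets borel})"
  proof (rule indep_setI)
    note X_sub = sub[OF X(1) sp(1)] and Y_sub = sub[OF Y(1) sp(2)]
    show "sigma_sets (space M) {X -` A \<inter> space M |A. A \<in> sets borel} \<subseteq> events"
      using X_sub indep_setD_ev1[OF ind] by (rule subset_trans)
    show "sigma_sets (space M) {Y -` A \<inter> space M |A. A \<in> sets borel} \<subseteq> events"
      using Y_sub indep_setD_ev2[OF ind] by (rule subset_trans)
  qed (rule indep_setD[OF ind subsetD[OF sub[OF X(1) sp(1)]] subsetD[OF sub[OF Y(1) sp(2)]]])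
  then have "indep_var borel X borel Y"
    unfolding indep_var_eq using X(2) Y(2) by (auto simp: borel_measurable_integrable)
  then show "integrable M (\<lambda>\<omega>. X \<omega> * Y \<omega>)"
    "expectation (\<lambda>\<omega>. X \<omega> * Y \<omega>) = expectation X * expectation Y"
    using X(2) Y(2) by (auto intro: indep_var_integrable indep_var_lebesgue_integral)
qed

text \<open>For the Ito integral, the jump noise \<open>N\<close> is a family of counts that is independent of \<open>B\<close>
  and adapted to the same filtration.\<close>

locale adapted_white_noise = prob_space M + \<rho>: prob_space \<rho>
  for M :: "'w measure" and \<rho> :: "real measure" +
  fixes F :: "real \<Rightarrow> 'w measure" and B :: "(real \<times> real) set \<Rightarrow> 'w \<Rightarrow> real"
    and L :: "(real \<times> real \<times> real) measure" and N :: "'w \<Rightarrow> (real \<times> real \<times> real) measure"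
  assumes filtration: "complete_filtration M F"
    and noise: "white_noise M (control_measure \<rho>) B"
    and indep: "independent_noises M L N (control_measure \<rho>) B"
    and adapted: "adapted_noises M F L N (control_measure \<rho>) B"
begin

sublocale RS: pair_sigma_finite \<rho> "lborel :: real measure" ..
sublocale MC: pair_sigma_finite M "control_measure \<rho>"
  by (intro pair_sigma_finite.intro sigma_finite_measure_axioms sigma_finite_pair_measure
      \<rho>.sigma_finite_measure_axioms lborel.sigma_finite_measure_axioms)

lemma subalgebra_F: "subalgebra M (F t)"
  using filtration by (simp add: complete_filtration_def)

lemma space_F: "space (F t) = space M"
  using subalgebra_F by (simp add: subalgebra_def)

lemma measurable_F_M: "\<xi> \<in> borel_measurable (F t) \<Longrightarrow> \<xi> \<in> borel_measurable M"
  using measurable_from_subalg[OF subalgebra_F] .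

lemma measurable_F_mono:
  assumes "s \<le> t" "\<xi> \<in> borel_measurable (F s)"
  shows "\<xi> \<in> borel_measurable (F t)"
proof -
  have "sets (F s) \<subseteq> sets (F t)"
    using filtration assms(1) unfolding complete_filtration_def filtration_def by blast
  then have "subalgebra (F t) (F s)" by (simp add: subalgebra_def space_F)
  then show ?thesis using assms(2) by (rule measurable_from_subalg)
qed

definition future :: "real \<Rightarrow> 'w measure" where
  "future t = sigma (space M)
     (gen_events M (\<lambda>A \<omega>. emeasure (N \<omega>) A) {A \<in> sets L. A \<subseteq> {t<..} \<times> UNIV} \<union>
      gen_events M B {A \<in> finite_sets (control_measure \<rho>). A \<subseteq> UNIV \<times> {t<..}})"

definition jump_events :: "'w measure" where
  "jump_events = sigma (space M) (gen_events M (\<lambda>A \<omega>. emeasure (N \<omega>) A) (sets L))"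

definition white_events :: "'w measure" where
  "white_events = sigma (space M) (gen_events M B (finite_sets (control_measure \<rho>)))"

lemma gen_events_Pow: "gen_events M Z I \<subseteq> Pow (space M)"
  unfolding gen_events_def by (rule subsetI, rule PowI, erule sigma_sets_into_sp[rotated]) auto

lemma space_future [simp]: "space (future t) = space M"
  and space_jump_events [simp]: "space jump_events = space M"
  and space_white_events [simp]: "space white_events = space M"
  unfolding future_def jump_events_def white_events_def
  by (intro space_measure_of Un_least gen_events_Pow)+

lemma sets_future: "sets (future t) = sigma_sets (space M)
     (gen_events M (\<lambda>A \<omega>. emeasure (N \<omega>) A) {A \<in> sets L. A \<subseteq> {t<..} \<times> UNIV} \<union>
      gen_events M B {A \<in> finite_sets (control_measure \<rho>). A \<subseteq> UNIV \<times> {t<..}})"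
  unfolding future_def by (intro sets_measure_of Un_least gen_events_Pow)

lemma sets_sigma_gen_events: "sets (sigma (space M) (gen_events M Z I)) = gen_events M Z I"
proof -
  have "sigma_sets (space M) (gen_events M Z I) = gen_events M Z I"
    unfolding gen_events_def by (intro sigma_sets_sigma_sets_eq) auto
  then show ?thesis by (simp add: sets_measure_of[OF gen_events_Pow])
qed

lemma sets_jump_events: "sets jump_events = gen_events M (\<lambda>A \<omega>. emeasure (N \<omega>) A) (sets L)"
  and sets_white_events: "sets white_events = gen_events M B (finite_sets (control_measure \<rho>))"
  unfolding jump_events_def white_events_def by (rule sets_sigma_gen_events)+

lemma measurable_gen_events:
  assumes "i \<in> I" "gen_events M Z I \<subseteq> sets G" "space G = space M"
  shows "Z i \<in> borel_measurable G"
proof (rule measurableI)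
  fix U :: "'b set" assume "U \<in> sets borel"
  with assms(1) have "Z i -` U \<inter> space M \<in> {Z i -` U \<inter> space M |i U. i \<in> I \<and> U \<in> sets borel}"
    by (intro CollectI exI[of _ i] exI[of _ U] conjI refl)
  then have "Z i -` U \<inter> space M \<in> gen_events M Z I"
    unfolding gen_events_def by (rule sigma_sets.Basic)
  then show "Z i -` U \<inter> space G \<in> sets G" using assms(2,3) by auto
qed simp

lemma indep_F_future: "indep_set (sets (F t)) (sets (future t))"
  using adapted unfolding adapted_noises_def sets_future by (elim allE[of _ t] conjE)

lemma indep_jump_white: "indep_set (sets jump_events) (sets white_events)"
  using indep unfolding independent_noises_def sets_jump_events sets_white_events .

lemma jump_measurable_future:
  assumes "A \<in> sets L" "A \<subseteq> {t<..} \<times> UNIV"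
  shows "(\<lambda>\<omega>. emeasure (N \<omega>) A) \<in> borel_measurable (future t)"
  using assms
  by (intro measurable_gen_events[where Z="\<lambda>A \<omega>. emeasure (N \<omega>) A"
        and I="{A \<in> sets L. A \<subseteq> {t<..} \<times> UNIV}"])
    (auto simp: sets_future intro: sigma_sets.Basic)

lemma jump_measurable_jump_events:
  "A \<in> sets L \<Longrightarrow> (\<lambda>\<omega>. emeasure (N \<omega>) A) \<in> borel_measurable jump_events"
  by (intro measurable_gen_events[where Z="\<lambda>A \<omega>. emeasure (N \<omega>) A" and I="sets L"])
    (auto simp: sets_jump_events)

lemma jump_measurable_F:
  assumes "A \<in> sets L" "A \<subseteq> {..t} \<times> UNIV"
  shows "(\<lambda>\<omega>. emeasure (N \<omega>) A) \<in> borel_measurable (F t)"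
proof -
  have "\<forall>A\<in>sets L. A \<subseteq> {..t} \<times> UNIV \<longrightarrow> (\<lambda>\<omega>. emeasure (N \<omega>) A) \<in> borel_measurable (F t)"
    using adapted unfolding adapted_noises_def by (elim allE[of _ t] conjE)
  with assms show ?thesis by simp
qed

lemma B_measurable_F:
  assumes "A \<in> finite_sets (control_measure \<rho>)" "A \<subseteq> UNIV \<times> {..t}"
  shows "B A \<in> borel_measurable (F t)"
proof -
  have "\<forall>A\<in>finite_sets (control_measure \<rho>). A \<subseteq> UNIV \<times> {..t} \<longrightarrow> B A \<in> borel_measurable (F t)"
    using adapted unfolding adapted_noises_def by (elim allE[of _ t] conjE)
  with assms show ?thesis by simp
qed

lemma B_measurable_future:
  assumes "A \<in> finite_sets (control_measure \<rho>)" "A \<subseteq> UNIV \<times> {t<..}"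
  shows "B A \<in> borel_measurable (future t)"
  using assms
  by (intro measurable_gen_events[where Z=B
        and I="{A \<in> finite_sets (control_measure \<rho>). A \<subseteq> UNIV \<times> {t<..}}"])
    (auto simp: sets_future intro: sigma_sets.Basic)

lemma B_measurable_white_events:
  "A \<in> finite_sets (control_measure \<rho>) \<Longrightarrow> B A \<in> borel_measurable white_events"
  by (intro measurable_gen_events[where Z=B and I="finite_sets (control_measure \<rho>)"])
    (auto simp: sets_white_events)

lemma B_square_integrable:
  assumes A: "A \<in> finite_sets (control_measure \<rho>)"
  shows "square_integrable M (B A)"
proof -
  have "gaussian_var M (\<lambda>\<omega>. \<Sum>j\<in>{A}. 1 * B j \<omega>)"
    using noise A unfolding white_noise_def gaussian_family_def
    by (elim conjE allE[of _ "{A}"] allE[of _ "\<lambda>_. 1"]) simp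
  then have "gaussian_var M (B A)" by simp
  then obtain m where B [measurable]: "B A \<in> borel_measurable M"
    and m: "(AE \<omega> in M. B A \<omega> = m) \<or> (\<exists>s>0. distributed M lborel (B A) (normal_density m s))"
    unfolding gaussian_var_def by blast
  from m show ?thesis
  proof
    assume "AE \<omega> in M. B A \<omega> = m"
    then show ?thesis
      by (intro square_integrable_cong_AE[OF square_integrable_const[of m]]) auto
  next
    assume "\<exists>s>0. distributed M lborel (B A) (normal_density m s)"
    then obtain s where s: "s > 0" "distributed M lborel (B A) (normal_density m s)" by blast
    have "integrable lborel (\<lambda>x. normal_density m s x * (x - m)\<^sup>2)"
      using s(1) by (rule integrable_normal_moment)
    then have "integrable M (\<lambda>\<omega>. (B A \<omega> - m)\<^sup>2)"
      using distributed_integrable[OF s(2), of "\<lambda>x. (x - m)\<^sup>2"] by simp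
    then have "square_integrable M (\<lambda>\<omega>. B A \<omega> - m)"
      by (simp add: square_integrable_def)
    from square_integrable_add[OF this square_integrable_const[of m]]
    show ?thesis by simp
  qed
qed

lemma B_mean: "A \<in> finite_sets (control_measure \<rho>) \<Longrightarrow> expectation (B A) = 0"
  using noise by (simp add: white_noise_def)

lemma B_cov: "A \<in> finite_sets (control_measure \<rho>) \<Longrightarrow> A' \<in> finite_sets (control_measure \<rho>) \<Longrightarrow>
    expectation (\<lambda>\<omega>. B A \<omega> * B A' \<omega>) = measure (control_measure \<rho>) (A \<inter> A')"
  using noise by (simp add: white_noise_def)

text \<open>Additivity of the noise is a consequence of its covariance: the second moment of
  \<open>B (C \<union> D) - B C - B D\<close> expands to zero.\<close>

lemma B_additive:
  assumes C: "C \<in> finite_sets (control_measure \<rho>)" and D: "D \<in> finite_sets (control_measure \<rho>)"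
    and disj: "C \<inter> D = {}"
  shows "AE \<omega> in M. B (C \<union> D) \<omega> = B C \<omega> + B D \<omega>"
proof -
  let ?m = "measure (control_measure \<rho>)"
  have CD: "C \<union> D \<in> finite_sets (control_measure \<rho>)"
    using C D emeasure_subadditive[of C "control_measure \<rho>" D] unfolding finite_sets_def
    by (auto simp: less_top[symmetric] top_unique)
  have m: "?m (C \<union> D) = ?m C + ?m D"
    using C D disj unfolding finite_sets_def by (intro measure_Union) auto
  define Z where "Z \<omega> = B (C \<union> D) \<omega> - (B C \<omega> + B D \<omega>)" for \<omega>
  note L2 = B_square_integrable[OF C] B_square_integrable[OF D] B_square_integrable[OF CD]
  have Z: "square_integrable M Z"
    unfolding Z_def by (intro square_integrable_diff square_integrable_add L2)
  have int: "integrable M (\<lambda>\<omega>. B X \<omega> * B Y \<omega>)"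
    if "X \<in> {C, D, C \<union> D}" "Y \<in> {C, D, C \<union> D}" for X Y
    using that L2 by (intro square_integrable_mult) auto
  have "expectation (\<lambda>\<omega>. (Z \<omega>)\<^sup>2) = expectation (\<lambda>\<omega>.
      B (C \<union> D) \<omega> * B (C \<union> D) \<omega> + B C \<omega> * B C \<omega> + B D \<omega> * B D \<omega>
      - 2 * (B (C \<union> D) \<omega> * B C \<omega>) - 2 * (B (C \<union> D) \<omega> * B D \<omega>) + 2 * (B C \<omega> * B D \<omega>))"
    unfolding Z_def by (intro Bochner_Integration.integral_cong) (auto simp: power2_eq_square algebra_simps)
  also have "\<dots> = ?m (C \<union> D) + ?m C + ?m D - 2 * ?m C - 2 * ?m D"
    using C D CD by (simp add: int B_cov disj Int_absorb1)
  finally have "expectation (\<lambda>\<omega>. (Z \<omega>)\<^sup>2) = 0" by (simp add: m)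
  then have "AE \<omega> in M. (Z \<omega>)\<^sup>2 = 0"
    using Z by (subst (asm) integral_nonneg_eq_0_iff_AE) (auto simp: square_integrable_def)
  then show ?thesis by eventually_elim (simp add: Z_def)
qed

lemma strip_finite: "A \<in> sets \<rho> \<Longrightarrow> A \<times> {a<..b} \<in> finite_sets (control_measure \<rho>)"
  unfolding finite_sets_def
  by (cases "a \<le> b")
    (auto simp: lborel.emeasure_pair_measure_Times \<rho>.emeasure_eq_measure ennreal_mult_less_top)

lemma past_future_product:
  fixes \<xi> \<eta> :: "'w \<Rightarrow> real"
  assumes "\<xi> \<in> borel_measurable (F t)" "integrable M \<xi>"
    and "\<eta> \<in> borel_measurable (future t)" "integrable M \<eta>"
  shows "integrable M (\<lambda>\<omega>. \<xi> \<omega> * \<eta> \<omega>)"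
    and "expectation (\<lambda>\<omega>. \<xi> \<omega> * \<eta> \<omega>) = expectation \<xi> * expectation \<eta>"
  using indep_subalgebras_product[OF indep_F_future space_F space_future assms] by auto

lemma elem_term_square_integrable:
  assumes \<xi>: "\<xi> \<in> borel_measurable (F a)" "bounded (\<xi> ` space (F a))" and A: "A \<in> sets \<rho>"
  shows "square_integrable M (\<lambda>\<omega>. \<xi> \<omega> * B (A \<times> {a<..b}) \<omega>)"
proof -
  obtain c where "\<And>\<omega>. \<omega> \<in> space M \<Longrightarrow> \<bar>\<xi> \<omega>\<bar> \<le> c"
    using \<xi>(2) unfolding bounded_real space_F by auto
  then show ?thesis
    using measurable_F_M[OF \<xi>(1)]
    by (intro square_integrable_bounded_mult[where b=c] B_square_integrable strip_finite A) auto
qed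

lemma bounded_square_integrable:
  assumes \<xi>: "\<xi> \<in> borel_measurable (F a)" "bounded (\<xi> ` space (F a))"
  shows "square_integrable M \<xi>"
proof -
  obtain c where "\<And>\<omega>. \<omega> \<in> space M \<Longrightarrow> \<bar>\<xi> \<omega>\<bar> \<le> c"
    using \<xi>(2) unfolding bounded_real space_F by auto
  then show ?thesis
    using square_integrable_bounded_mult[OF square_integrable_const[of 1] measurable_F_M[OF \<xi>(1)], of c]
    by simp
qed

text \<open>The strip of the earlier term is cut at the time \<open>a'\<close> at which the later one starts.
  Its part before \<open>a'\<close> is known at \<open>a'\<close> and drops out because the later increment is centred
  and independent of the past; in the other part both increments are independent of both
  coefficients.\<close>

lemma elem_term_inner_ordered:
  assumes \<xi>: "\<xi> \<in> borel_measurable (F a)" "bounded (\<xi> ` space (F a))" and A: "A \<in> sets \<rho>"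
    and \<xi>': "\<xi>' \<in> borel_measurable (F a')" "bounded (\<xi>' ` space (F a'))" and A': "A' \<in> sets \<rho>"
    and le: "a \<le> a'"
  shows "expectation (\<lambda>\<omega>. (\<xi> \<omega> * B (A \<times> {a<..b}) \<omega>) * (\<xi>' \<omega> * B (A' \<times> {a'<..b'}) \<omega>)) =
    expectation (\<lambda>\<omega>. \<xi> \<omega> * \<xi>' \<omega>) *
      measure (control_measure \<rho>) ((A \<inter> A') \<times> ({a<..b} \<inter> {a'<..b'}))"
proof -
  let ?P = "A \<times> {a<..min b a'}" and ?Q = "A \<times> {a'<..b}" and ?S = "A' \<times> {a'<..b'}"
  have fin: "?P \<in> finite_sets (control_measure \<rho>)" "?Q \<in> finite_sets (control_measure \<rho>)"
      "?S \<in> finite_sets (control_measure \<rho>)"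
    using A A' by (auto intro: strip_finite)
  have union: "A \<times> {a<..b} = ?P \<union> ?Q" using le by auto
  have "?P \<inter> ?Q = {}" by auto
  then have split: "AE \<omega> in M. B (A \<times> {a<..b}) \<omega> = B ?P \<omega> + B ?Q \<omega>"
    unfolding union by (intro B_additive fin)
  have F': "\<xi> \<in> borel_measurable (F a')" by (rule measurable_F_mono[OF le \<xi>(1)])
  have P_F: "B ?P \<in> borel_measurable (F a')" by (intro B_measurable_F fin) auto
  have Q_fut: "B ?Q \<in> borel_measurable (future a')" by (intro B_measurable_future fin) auto
  have S_fut: "B ?S \<in> borel_measurable (future a')" by (intro B_measurable_future fin) auto
  have [measurable]: "\<xi> \<in> borel_measurable M" "\<xi>' \<in> borel_measurable M"
      "B ?P \<in> borel_measurable M" "B ?Q \<in> borel_measurable M" "B ?S \<in> borel_measurable M"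
      "B (A \<times> {a<..b}) \<in> borel_measurable M"
    using \<xi>(1) \<xi>'(1) measurable_F_M fin B_square_integrable strip_finite[OF A]
      square_integrable_measurable by blast+
  have P2: "square_integrable M (\<lambda>\<omega>. \<xi> \<omega> * B ?P \<omega>)"
    by (rule elem_term_square_integrable[OF \<xi> A])
  have \<xi>'2: "square_integrable M \<xi>'" by (rule bounded_square_integrable[OF \<xi>'])
  have \<xi>2: "square_integrable M \<xi>" by (rule bounded_square_integrable[OF \<xi>])
  have past: "integrable M (\<lambda>\<omega>. ((\<xi> \<omega> * B ?P \<omega>) * \<xi>' \<omega>) * B ?S \<omega>)"
      "expectation (\<lambda>\<omega>. ((\<xi> \<omega> * B ?P \<omega>) * \<xi>' \<omega>) * B ?S \<omega>) = 0"
  proof -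
    have "(\<lambda>\<omega>. (\<xi> \<omega> * B ?P \<omega>) * \<xi>' \<omega>) \<in> borel_measurable (F a')"
      using F' P_F \<xi>'(1) by simp
    from past_future_product[OF this square_integrable_mult[OF P2 \<xi>'2] S_fut
        square_integrable_integrable[OF B_square_integrable[OF fin(3)]]]
    show "integrable M (\<lambda>\<omega>. ((\<xi> \<omega> * B ?P \<omega>) * \<xi>' \<omega>) * B ?S \<omega>)"
      "expectation (\<lambda>\<omega>. ((\<xi> \<omega> * B ?P \<omega>) * \<xi>' \<omega>) * B ?S \<omega>) = 0"
      using B_mean[OF fin(3)] by auto
  qed
  have future: "integrable M (\<lambda>\<omega>. (\<xi> \<omega> * \<xi>' \<omega>) * (B ?Q \<omega> * B ?S \<omega>))"
      "expectation (\<lambda>\<omega>. (\<xi> \<omega> * \<xi>' \<omega>) * (B ?Q \<omega> * B ?S \<omega>)) =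
        expectation (\<lambda>\<omega>. \<xi> \<omega> * \<xi>' \<omega>) * measure (control_measure \<rho>) (?Q \<inter> ?S)"
  proof -
    have 1: "(\<lambda>\<omega>. \<xi> \<omega> * \<xi>' \<omega>) \<in> borel_measurable (F a')" using F' \<xi>'(1) by simp
    have 2: "(\<lambda>\<omega>. B ?Q \<omega> * B ?S \<omega>) \<in> borel_measurable (future a')" using Q_fut S_fut by simp
    from past_future_product[OF 1 square_integrable_mult[OF \<xi>2 \<xi>'2] 2
        square_integrable_mult[OF B_square_integrable[OF fin(2)] B_square_integrable[OF fin(3)]]]
    show "integrable M (\<lambda>\<omega>. (\<xi> \<omega> * \<xi>' \<omega>) * (B ?Q \<omega> * B ?S \<omega>))"
      "expectation (\<lambda>\<omega>. (\<xi> \<omega> * \<xi>' \<omega>) * (B ?Q \<omega> * B ?S \<omega>)) =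
        expectation (\<lambda>\<omega>. \<xi> \<omega> * \<xi>' \<omega>) * measure (control_measure \<rho>) (?Q \<inter> ?S)"
      by (auto simp: B_cov[OF fin(2,3)])
  qed
  have "expectation (\<lambda>\<omega>. (\<xi> \<omega> * B (A \<times> {a<..b}) \<omega>) * (\<xi>' \<omega> * B ?S \<omega>)) =
      expectation (\<lambda>\<omega>. ((\<xi> \<omega> * B ?P \<omega>) * \<xi>' \<omega>) * B ?S \<omega> + (\<xi> \<omega> * \<xi>' \<omega>) * (B ?Q \<omega> * B ?S \<omega>))"
    using split by (intro integral_cong_AE) (auto simp: algebra_simps)
  also have "\<dots> = expectation (\<lambda>\<omega>. \<xi> \<omega> * \<xi>' \<omega>) * measure (control_measure \<rho>) (?Q \<inter> ?S)"
    by (simp only: Bochner_Integration.integral_add[OF past(1) future(1)] past(2) future(2) add_0)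
  also have "?Q \<inter> ?S = (A \<inter> A') \<times> ({a<..b} \<inter> {a'<..b'})" using le by auto
  finally show ?thesis .
qed

lemma elem_term_inner:
  assumes \<xi>: "\<xi> \<in> borel_measurable (F a)" "bounded (\<xi> ` space (F a))" and A: "A \<in> sets \<rho>"
    and \<xi>': "\<xi>' \<in> borel_measurable (F a')" "bounded (\<xi>' ` space (F a'))" and A': "A' \<in> sets \<rho>"
  shows "expectation (\<lambda>\<omega>. (\<xi> \<omega> * B (A \<times> {a<..b}) \<omega>) * (\<xi>' \<omega> * B (A' \<times> {a'<..b'}) \<omega>)) =
    expectation (\<lambda>\<omega>. \<xi> \<omega> * \<xi>' \<omega>) *
      measure (control_measure \<rho>) ((A \<inter> A') \<times> ({a<..b} \<inter> {a'<..b'}))"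
proof (cases "a \<le> a'")
  case True
  then show ?thesis by (rule elem_term_inner_ordered[OF assms])
next
  case False
  then have "a' \<le> a" by simp
  from elem_term_inner_ordered[OF \<xi>' A' \<xi> A this, of b' b] show ?thesis
    by (simp add: mult.commute inf_commute)
qed

lemma elem_integral_Nil: "elem_integral B [] \<omega> = 0"
  and elem_integral_Cons: "elem_integral B ((\<xi>, A, a, b) # S) \<omega> =
    \<xi> \<omega> * B (A \<times> {a<..b}) \<omega> + elem_integral B S \<omega>"
  and elem_fun_Nil: "elem_fun [] \<omega> R s = 0"
  and elem_fun_Cons: "elem_fun ((\<xi>, A, a, b) # S) \<omega> R s =
    \<xi> \<omega> * indicator A R * indicator {a<..b} s + elem_fun S \<omega> R s"
  by (simp_all add: elem_integral_def elem_fun_def)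

lemma elem_integrand_Cons: "elem_integrand F \<rho> ((\<xi>, A, a, b) # S) \<longleftrightarrow>
    \<xi> \<in> borel_measurable (F a) \<and> bounded (\<xi> ` space (F a)) \<and> A \<in> sets \<rho> \<and> a \<le> b \<and>
    elem_integrand F \<rho> S"
  by (auto simp: elem_integrand_def)

lemma elem_integral_square_integrable:
  "elem_integrand F \<rho> S \<Longrightarrow> square_integrable M (elem_integral B S)"
proof (induction S)
  case Nil
  then show ?case using square_integrable_const[of 0] by (simp add: elem_integral_Nil[abs_def])
next
  case (Cons q S)
  obtain \<xi> A a b where q: "q = (\<xi>, A, a, b)" by (cases q)
  have "square_integrable M (\<lambda>\<omega>. \<xi> \<omega> * B (A \<times> {a<..b}) \<omega> + elem_integral B S \<omega>)"
    using Cons unfolding q elem_integrand_Cons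
    by (intro square_integrable_add elem_term_square_integrable) auto
  then show ?case unfolding q by (simp add: elem_integral_Cons[abs_def])
qed

lemma elem_fun_term_square_integrable:
  assumes \<xi>: "\<xi> \<in> borel_measurable (F a)" "bounded (\<xi> ` space (F a))" and A [measurable]: "A \<in> sets \<rho>"
  shows "square_integrable (M \<Otimes>\<^sub>M control_measure \<rho>)
    (\<lambda>(\<omega>, R, s). \<xi> \<omega> * indicator A R * indicator {a<..b} s)"
proof (rule square_integrable_nn_integral)
  have [measurable]: "\<xi> \<in> borel_measurable M" by (rule measurable_F_M[OF \<xi>(1)])
  show meas: "(\<lambda>(\<omega>, R, s). \<xi> \<omega> * indicator A R * indicator {a<..b} s)
      \<in> borel_measurable (M \<Otimes>\<^sub>M control_measure \<rho>)"
    by measurable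
  have strip: "A \<times> {a<..b} \<in> sets (control_measure \<rho>)"
      "emeasure (control_measure \<rho>) (A \<times> {a<..b}) < \<infinity>"
    using strip_finite[OF A, of a b] by (auto simp: finite_sets_def)
  have "(\<integral>\<^sup>+ p. ennreal (((\<lambda>(\<omega>, R, s). \<xi> \<omega> * indicator A R * indicator {a<..b} s) p)\<^sup>2)
        \<partial>(M \<Otimes>\<^sub>M control_measure \<rho>)) =
      (\<integral>\<^sup>+ p. ennreal ((\<xi> (fst p))\<^sup>2) * indicator (A \<times> {a<..b}) (snd p) \<partial>(M \<Otimes>\<^sub>M control_measure \<rho>))"
    by (intro nn_integral_cong) (auto simp: indicator_def)
  also have "\<dots> = (\<integral>\<^sup>+ \<omega>. (\<integral>\<^sup>+ q. ennreal ((\<xi> \<omega>)\<^sup>2) * indicator (A \<times> {a<..b}) q \<partial>control_measure \<rho>) \<partial>M)"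
    using strip(1) by (subst RS.P.nn_integral_fst[symmetric]) auto
  also have "\<dots> = (\<integral>\<^sup>+ \<omega>. ennreal ((\<xi> \<omega>)\<^sup>2) * emeasure (control_measure \<rho>) (A \<times> {a<..b}) \<partial>M)"
    using strip(1) by (intro nn_integral_cong nn_integral_cmult_indicator)
  also have "\<dots> = (\<integral>\<^sup>+ \<omega>. ennreal ((\<xi> \<omega>)\<^sup>2) \<partial>M) * emeasure (control_measure \<rho>) (A \<times> {a<..b})"
    by (intro nn_integral_multc) simp
  also have "(\<integral>\<^sup>+ \<omega>. ennreal ((\<xi> \<omega>)\<^sup>2) \<partial>M) = ennreal (expectation (\<lambda>\<omega>. (\<xi> \<omega>)\<^sup>2))"
    using bounded_square_integrable[OF \<xi>]
    by (intro nn_integral_eq_integral) (auto simp: square_integrable_def)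
  also have "\<dots> * emeasure (control_measure \<rho>) (A \<times> {a<..b}) < \<infinity>"
    using strip(2) by (simp add: ennreal_mult_less_top)
  finally show "(\<integral>\<^sup>+ p. ennreal (((\<lambda>(\<omega>, R, s). \<xi> \<omega> * indicator A R * indicator {a<..b} s) p)\<^sup>2)
        \<partial>(M \<Otimes>\<^sub>M control_measure \<rho>)) < \<infinity>" .
qed

lemma elem_fun_square_integrable:
  "elem_integrand F \<rho> S \<Longrightarrow>
    square_integrable (M \<Otimes>\<^sub>M control_measure \<rho>) (\<lambda>(\<omega>, R, s). elem_fun S \<omega> R s)"
proof (induction S)
  case Nil
  then show ?case by (simp add: elem_fun_Nil square_integrable_def)
next
  case (Cons q S)
  obtain \<xi> A a b where q: "q = (\<xi>, A, a, b)" by (cases q)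
  have "square_integrable (M \<Otimes>\<^sub>M control_measure \<rho>)
      (\<lambda>p. (\<lambda>(\<omega>, R, s). \<xi> \<omega> * indicator A R * indicator {a<..b} s) p + (\<lambda>(\<omega>, R, s). elem_fun S \<omega> R s) p)"
    using Cons unfolding q elem_integrand_Cons
    by (intro square_integrable_add elem_fun_term_square_integrable) auto
  then show ?case unfolding q by (simp add: elem_fun_Cons case_prod_unfold)
qed

lemma elem_fun_term_inner:
  assumes \<xi>: "\<xi> \<in> borel_measurable (F a)" "bounded (\<xi> ` space (F a))" and A: "A \<in> sets \<rho>"
    and \<xi>': "\<xi>' \<in> borel_measurable (F a')" "bounded (\<xi>' ` space (F a'))" and A': "A' \<in> sets \<rho>"
  shows "(\<integral>(\<omega>, R, s). (\<xi> \<omega> * indicator A R * indicator {a<..b} s) *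
      (\<xi>' \<omega> * indicator A' R * indicator {a'<..b'} s) \<partial>(M \<Otimes>\<^sub>M control_measure \<rho>)) =
    expectation (\<lambda>\<omega>. \<xi> \<omega> * \<xi>' \<omega>) *
      measure (control_measure \<rho>) ((A \<inter> A') \<times> ({a<..b} \<inter> {a'<..b'}))"
    (is "?lhs = _ * measure _ ?D")
proof -
  have "integrable (M \<Otimes>\<^sub>M control_measure \<rho>) (\<lambda>(\<omega>, q). (\<xi> \<omega> * \<xi>' \<omega>) * indicator ?D q)"
  proof -
    have "(\<lambda>(\<omega>, q). (\<xi> \<omega> * \<xi>' \<omega>) * indicator ?D q) = (\<lambda>p. (\<lambda>(\<omega>, R, s). \<xi> \<omega> * indicator A R * indicator {a<..b} s) p *
        (\<lambda>(\<omega>, R, s). \<xi>' \<omega> * indicator A' R * indicator {a'<..b'} s) p)"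
      by (auto simp: indicator_def fun_eq_iff)
    then show ?thesis
      using square_integrable_mult[OF elem_fun_term_square_integrable[OF \<xi> A, of b]
          elem_fun_term_square_integrable[OF \<xi>' A', of b']] by simp
  qed
  from MC.integral_fst[OF this]
  have "expectation (\<lambda>\<omega>. (\<xi> \<omega> * \<xi>' \<omega>) * measure (control_measure \<rho>) (?D \<inter> space (control_measure \<rho>))) =
      (\<integral>(\<omega>, q). (\<xi> \<omega> * \<xi>' \<omega>) * indicator ?D q \<partial>(M \<Otimes>\<^sub>M control_measure \<rho>))"
    by simp
  moreover have "?lhs = (\<integral>(\<omega>, q). (\<xi> \<omega> * \<xi>' \<omega>) * indicator ?D q \<partial>(M \<Otimes>\<^sub>M control_measure \<rho>))"
    by (intro Bochner_Integration.integral_cong) (auto simp: indicator_def)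
  moreover have "?D \<inter> space (control_measure \<rho>) = ?D"
    using sets.sets_into_space[OF A] by (auto simp: space_pair_measure)
  ultimately show ?thesis by simp
qed

text \<open>Both sides are bilinear in the two lists of terms, so that the isometry for single terms
  is all that is needed; no common refinement of the intervals has to be formed.\<close>

lemma elem_isometry:
  assumes "elem_integrand F \<rho> S" "elem_integrand F \<rho> S'"
  shows "expectation (\<lambda>\<omega>. elem_integral B S \<omega> * elem_integral B S' \<omega>) =
    (\<integral>(\<omega>, R, s). elem_fun S \<omega> R s * elem_fun S' \<omega> R s \<partial>(M \<Otimes>\<^sub>M control_measure \<rho>))"
  using assms(1)
proof (induction S)
  case Nil
  then show ?case by (simp add: elem_integral_Nil elem_fun_Nil)
next
  case (Cons q S)
  obtain \<xi> A a b where q: "q = (\<xi>, A, a, b)" by (cases q)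
  have \<xi>: "\<xi> \<in> borel_measurable (F a)" "bounded (\<xi> ` space (F a))" "A \<in> sets \<rho>" "a \<le> b"
    and S: "elem_integrand F \<rho> S"
    using Cons.prems unfolding q elem_integrand_Cons by auto
  let ?C = "M \<Otimes>\<^sub>M control_measure \<rho>"
  let ?T = "\<lambda>\<omega>. \<xi> \<omega> * B (A \<times> {a<..b}) \<omega>"
  let ?f = "\<lambda>(\<omega>, R, s). \<xi> \<omega> * indicator A R * indicator {a<..b} s"
  have T2: "square_integrable M ?T" by (rule elem_term_square_integrable[OF \<xi>(1-3)])
  have f2: "square_integrable ?C ?f" by (rule elem_fun_term_square_integrable[OF \<xi>(1-3)])
  have head: "expectation (\<lambda>\<omega>. ?T \<omega> * elem_integral B S' \<omega>) =
      (\<integral>p. ?f p * (\<lambda>(\<omega>, R, s). elem_fun S' \<omega> R s) p \<partial>?C)"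
    using assms(2)
  proof (induction S')
    case Nil
    then show ?case by (simp add: elem_integral_Nil elem_fun_Nil case_prod_unfold)
  next
    case (Cons q' S')
    obtain \<xi>' A' a' b' where q': "q' = (\<xi>', A', a', b')" by (cases q')
    have \<xi>': "\<xi>' \<in> borel_measurable (F a')" "bounded (\<xi>' ` space (F a'))" "A' \<in> sets \<rho>" "a' \<le> b'"
      and S': "elem_integrand F \<rho> S'"
      using Cons.prems unfolding q' elem_integrand_Cons by auto
    let ?T' = "\<lambda>\<omega>. \<xi>' \<omega> * B (A' \<times> {a'<..b'}) \<omega>"
    let ?f' = "\<lambda>(\<omega>, R, s). \<xi>' \<omega> * indicator A' R * indicator {a'<..b'} s"
    have T2': "square_integrable M ?T'" by (rule elem_term_square_integrable[OF \<xi>'(1-3)])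
    have f2': "square_integrable ?C ?f'" by (rule elem_fun_term_square_integrable[OF \<xi>'(1-3)])
    have "expectation (\<lambda>\<omega>. ?T \<omega> * elem_integral B (q' # S') \<omega>) =
        expectation (\<lambda>\<omega>. ?T \<omega> * ?T' \<omega> + ?T \<omega> * elem_integral B S' \<omega>)"
      unfolding q' by (simp add: elem_integral_Cons distrib_left)
    also have "\<dots> = expectation (\<lambda>\<omega>. ?T \<omega> * ?T' \<omega>) + expectation (\<lambda>\<omega>. ?T \<omega> * elem_integral B S' \<omega>)"
      by (intro Bochner_Integration.integral_add square_integrable_mult T2 T2'
          elem_integral_square_integrable S')
    also have "\<dots> = (\<integral>p. ?f p * ?f' p \<partial>?C) + (\<integral>p. ?f p * (\<lambda>(\<omega>, R, s). elem_fun S' \<omega> R s) p \<partial>?C)"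
      unfolding Cons.IH[OF S'] elem_term_inner[OF \<xi>(1-3) \<xi>'(1-3)]
        elem_fun_term_inner[OF \<xi>(1-3) \<xi>'(1-3), symmetric]
      by (simp add: case_prod_unfold)
    also have "\<dots> = (\<integral>p. ?f p * ?f' p + ?f p * (\<lambda>(\<omega>, R, s). elem_fun S' \<omega> R s) p \<partial>?C)"
      by (intro Bochner_Integration.integral_add[symmetric] square_integrable_mult f2 f2'
          elem_fun_square_integrable S')
    also have "\<dots> = (\<integral>p. ?f p * (\<lambda>(\<omega>, R, s). elem_fun (q' # S') \<omega> R s) p \<partial>?C)"
      unfolding q' by (simp add: elem_fun_Cons case_prod_unfold distrib_left)
    finally show ?case .
  qed
  have "expectation (\<lambda>\<omega>. elem_integral B (q # S) \<omega> * elem_integral B S' \<omega>) =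
      expectation (\<lambda>\<omega>. ?T \<omega> * elem_integral B S' \<omega> + elem_integral B S \<omega> * elem_integral B S' \<omega>)"
    unfolding q by (simp add: elem_integral_Cons distrib_right)
  also have "\<dots> = expectation (\<lambda>\<omega>. ?T \<omega> * elem_integral B S' \<omega>) +
      expectation (\<lambda>\<omega>. elem_integral B S \<omega> * elem_integral B S' \<omega>)"
    by (intro Bochner_Integration.integral_add square_integrable_mult T2
        elem_integral_square_integrable S assms(2))
  also have "\<dots> = (\<integral>p. ?f p * (\<lambda>(\<omega>, R, s). elem_fun S' \<omega> R s) p \<partial>?C) +
      (\<integral>p. (\<lambda>(\<omega>, R, s). elem_fun S \<omega> R s) p * (\<lambda>(\<omega>, R, s). elem_fun S' \<omega> R s) p \<partial>?C)"
    unfolding head Cons.IH[OF S] by (simp add: case_prod_unfold)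
  also have "\<dots> = (\<integral>p. ?f p * (\<lambda>(\<omega>, R, s). elem_fun S' \<omega> R s) p +
      (\<lambda>(\<omega>, R, s). elem_fun S \<omega> R s) p * (\<lambda>(\<omega>, R, s). elem_fun S' \<omega> R s) p \<partial>?C)"
    by (intro Bochner_Integration.integral_add[symmetric] square_integrable_mult f2
        elem_fun_square_integrable S assms(2))
  also have "\<dots> = (\<integral>(\<omega>, R, s). elem_fun (q # S) \<omega> R s * elem_fun S' \<omega> R s \<partial>?C)"
    unfolding q by (simp add: elem_fun_Cons case_prod_unfold distrib_right)
  finally show ?case .
qed

text \<open>A random variable that splits, at every time \<open>a\<close>, into a part known at \<open>a\<close> and a part
  built from later points of \<open>N\<close> is orthogonal to elementary integrals: the increment after
  \<open>a\<close> is independent of the past, and of \<open>N\<close>. Integrals of \<open>N\<close> are of this form. The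
  integrand of the elementary integral may depend on \<open>N\<close>, so that the independence of \<open>B\<close>
  and \<open>N\<close> alone does not suffice.\<close>

definition splits_at :: "real \<Rightarrow> ('w \<Rightarrow> real) \<Rightarrow> bool" where
  "splits_at a Y \<longleftrightarrow> (\<exists>U V. U \<in> borel_measurable (F a) \<and> square_integrable M U \<and>
     V \<in> borel_measurable (future a) \<and> V \<in> borel_measurable jump_events \<and> square_integrable M V \<and>
     (AE \<omega> in M. Y \<omega> = U \<omega> + V \<omega>))"

lemma elem_term_orthogonal:
  assumes \<xi>: "\<xi> \<in> borel_measurable (F a)" "bounded (\<xi> ` space (F a))" and A: "A \<in> sets \<rho>"
    and Y: "splits_at a Y" "Y \<in> borel_measurable M"
  shows "expectation (\<lambda>\<omega>. (\<xi> \<omega> * B (A \<times> {a<..b}) \<omega>) * Y \<omega>) = 0"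
proof -
  let ?A = "A \<times> {a<..b}"
  obtain U V where U: "U \<in> borel_measurable (F a)" "square_integrable M U"
    and V: "V \<in> borel_measurable (future a)" "V \<in> borel_measurable jump_events" "square_integrable M V"
    and eq: "AE \<omega> in M. Y \<omega> = U \<omega> + V \<omega>"
    using Y unfolding splits_at_def by blast
  have A': "?A \<in> finite_sets (control_measure \<rho>)" by (rule strip_finite[OF A])
  note B2 = B_square_integrable[OF A']
  have \<xi>2: "square_integrable M \<xi>" by (rule bounded_square_integrable[OF \<xi>])
  have [measurable]: "\<xi> \<in> borel_measurable M" "B ?A \<in> borel_measurable M" "Y \<in> borel_measurable M"
      "U \<in> borel_measurable M" "V \<in> borel_measurable M"
    using \<xi>2 B2 U(2) V(3) Y(2) square_integrable_measurable by blast+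
  have B_fut: "B ?A \<in> borel_measurable (future a)" by (intro B_measurable_future A') auto
  have 1: "integrable M (\<lambda>\<omega>. (\<xi> \<omega> * U \<omega>) * B ?A \<omega>)" "expectation (\<lambda>\<omega>. (\<xi> \<omega> * U \<omega>) * B ?A \<omega>) = 0"
    using past_future_product[OF _ square_integrable_mult[OF \<xi>2 U(2)] B_fut
        square_integrable_integrable[OF B2]] \<xi>(1) U(1) B_mean[OF A'] by auto
  have VB: "expectation (\<lambda>\<omega>. V \<omega> * B ?A \<omega>) = 0"
    using indep_subalgebras_product(2)[OF indep_jump_white space_jump_events space_white_events
        V(2) square_integrable_integrable[OF V(3)] B_measurable_white_events[OF A']
        square_integrable_integrable[OF B2]] B_mean[OF A'] by simp
  have "(\<lambda>\<omega>. V \<omega> * B ?A \<omega>) \<in> borel_measurable (future a)" using V(1) B_fut by simp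
  from past_future_product[OF \<xi>(1) square_integrable_integrable[OF \<xi>2] this
      square_integrable_mult[OF V(3) B2]]
  have 2: "integrable M (\<lambda>\<omega>. \<xi> \<omega> * (V \<omega> * B ?A \<omega>))" "expectation (\<lambda>\<omega>. \<xi> \<omega> * (V \<omega> * B ?A \<omega>)) = 0"
    by (auto simp: VB)
  have "expectation (\<lambda>\<omega>. (\<xi> \<omega> * B ?A \<omega>) * Y \<omega>) =
      expectation (\<lambda>\<omega>. (\<xi> \<omega> * U \<omega>) * B ?A \<omega> + \<xi> \<omega> * (V \<omega> * B ?A \<omega>))"
    using eq by (intro integral_cong_AE) (auto simp: algebra_simps)
  also have "\<dots> = 0"
    by (simp only: Bochner_Integration.integral_add[OF 1(1) 2(1)] 1(2) 2(2))
  finally show ?thesis .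
qed

lemma elem_integral_orthogonal:
  assumes Y: "\<And>a. splits_at a Y" "square_integrable M Y" and S: "elem_integrand F \<rho> S"
  shows "expectation (\<lambda>\<omega>. elem_integral B S \<omega> * Y \<omega>) = 0"
  using S
proof (induction S)
  case Nil
  then show ?case by (simp add: elem_integral_Nil)
next
  case (Cons q S)
  obtain \<xi> A a b where q: "q = (\<xi>, A, a, b)" by (cases q)
  have \<xi>: "\<xi> \<in> borel_measurable (F a)" "bounded (\<xi> ` space (F a))" "A \<in> sets \<rho>"
    and S: "elem_integrand F \<rho> S"
    using Cons.prems unfolding q elem_integrand_Cons by auto
  have "expectation (\<lambda>\<omega>. elem_integral B (q # S) \<omega> * Y \<omega>) =
      expectation (\<lambda>\<omega>. (\<xi> \<omega> * B (A \<times> {a<..b}) \<omega>) * Y \<omega> + elem_integral B S \<omega> * Y \<omega>)"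
    unfolding q by (simp add: elem_integral_Cons distrib_right)
  also have "\<dots> = expectation (\<lambda>\<omega>. (\<xi> \<omega> * B (A \<times> {a<..b}) \<omega>) * Y \<omega>) +
      expectation (\<lambda>\<omega>. elem_integral B S \<omega> * Y \<omega>)"
    by (intro Bochner_Integration.integral_add square_integrable_mult elem_term_square_integrable
        elem_integral_square_integrable \<xi> S Y(2))
  also have "\<dots> = 0"
    using Cons.IH[OF S] elem_term_orthogonal[OF \<xi> Y(1) square_integrable_measurable[OF Y(2)]] by simp
  finally show ?case .
qed

lemma splits_at_const: "splits_at a (\<lambda>_. c)"
  unfolding splits_at_def
  by (intro exI[of _ "\<lambda>_. c"] exI[of _ "\<lambda>_. 0"]) (auto intro: square_integrable_const)

lemma ito_integral_square_integrable:
  assumes "has_ito_integral M F \<rho> B \<Phi> J"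
  shows "square_integrable M J"
proof -
  obtain S where S: "\<And>n. elem_integrand F \<rho> (S n)" and Jm: "J \<in> borel_measurable M"
    and lim: "(\<lambda>n. \<integral>\<^sup>+ \<omega>. ennreal ((J \<omega> - elem_integral B (S n) \<omega>)\<^sup>2) \<partial>M) \<longlonglongrightarrow> 0"
    using assms unfolding has_ito_integral_def by blast
  show ?thesis
    by (rule L2_limit_square_integrable[OF Jm elem_integral_square_integrable[OF S] lim])
qed

lemma ito_integral_orthogonal:
  assumes J: "has_ito_integral M F \<rho> B \<Phi> J" and Y: "\<And>a. splits_at a Y" "square_integrable M Y"
  shows "expectation (\<lambda>\<omega>. J \<omega> * Y \<omega>) = 0"
proof -
  obtain S where S: "\<And>n. elem_integrand F \<rho> (S n)" and Jm: "J \<in> borel_measurable M"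
    and lim: "(\<lambda>n. \<integral>\<^sup>+ \<omega>. ennreal ((J \<omega> - elem_integral B (S n) \<omega>)\<^sup>2) \<partial>M) \<longlonglongrightarrow> 0"
    using J unfolding has_ito_integral_def by blast
  have "(\<lambda>n. expectation (\<lambda>\<omega>. elem_integral B (S n) \<omega> * Y \<omega>)) \<longlonglongrightarrow> expectation (\<lambda>\<omega>. J \<omega> * Y \<omega>)"
    by (rule L2_limit_inner[OF Jm _ lim square_integrable_measurable[OF Y(2)] Y(2)])
      (auto intro: elem_integral_square_integrable S)
  then have "(\<lambda>n. 0) \<longlonglongrightarrow> expectation (\<lambda>\<omega>. J \<omega> * Y \<omega>)"
    by (simp add: elem_integral_orthogonal[OF Y S])
  then show ?thesis by (simp add: LIMSEQ_const_iff)
qed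

lemma ito_integral_mean:
  assumes "has_ito_integral M F \<rho> B \<Phi> J"
  shows "expectation J = 0"
  using ito_integral_orthogonal[OF assms splits_at_const square_integrable_const, of 1] by simp

text \<open>The isometry is needed in polarised form because the two integrals of an autocovariance
  belong to different times.\<close>

lemma ito_isometry:
  assumes J: "has_ito_integral M F \<rho> B \<Phi> J" and J': "has_ito_integral M F \<rho> B \<Phi>' J'"
  shows "expectation (\<lambda>\<omega>. J \<omega> * J' \<omega>) =
    (\<integral>(\<omega>, R, s). \<Phi> \<omega> R s * \<Phi>' \<omega> R s \<partial>completion (M \<Otimes>\<^sub>M control_measure \<rho>))"
proof -
  let ?C = "completion (M \<Otimes>\<^sub>M control_measure \<rho>)"
  define u where "u \<Psi> = (\<lambda>(\<omega>, R, s). \<Psi> \<omega> R s)" for \<Psi> :: "'w \<Rightarrow> real \<Rightarrow> real \<Rightarrow> real"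
  obtain S where S: "\<And>n. elem_integrand F \<rho> (S n)" and Jm: "J \<in> borel_measurable M"
    and \<Phi>m: "u \<Phi> \<in> borel_measurable ?C"
    and \<Phi>_lim: "(\<lambda>n. \<integral>\<^sup>+ p. ennreal ((u \<Phi> p - u (elem_fun (S n)) p)\<^sup>2) \<partial>?C) \<longlonglongrightarrow> 0"
    and lim: "(\<lambda>n. \<integral>\<^sup>+ \<omega>. ennreal ((J \<omega> - elem_integral B (S n) \<omega>)\<^sup>2) \<partial>M) \<longlonglongrightarrow> 0"
    using J unfolding has_ito_integral_def u_def by (auto simp: case_prod_unfold)
  obtain S' where S': "\<And>n. elem_integrand F \<rho> (S' n)" and Jm': "J' \<in> borel_measurable M"
    and \<Phi>m': "u \<Phi>' \<in> borel_measurable ?C"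
    and \<Phi>_lim': "(\<lambda>n. \<integral>\<^sup>+ p. ennreal ((u \<Phi>' p - u (elem_fun (S' n)) p)\<^sup>2) \<partial>?C) \<longlonglongrightarrow> 0"
    and lim': "(\<lambda>n. \<integral>\<^sup>+ \<omega>. ennreal ((J' \<omega> - elem_integral B (S' n) \<omega>)\<^sup>2) \<partial>M) \<longlonglongrightarrow> 0"
    using J' unfolding has_ito_integral_def u_def by (auto simp: case_prod_unfold)
  have base: "square_integrable (M \<Otimes>\<^sub>M control_measure \<rho>) (u (elem_fun T))" if "elem_integrand F \<rho> T" for T
    using elem_fun_square_integrable[OF that] by (simp add: u_def)
  have compl: "square_integrable ?C (u (elem_fun T))" if "elem_integrand F \<rho> T" for T
    using base[OF that] unfolding square_integrable_def
    by (auto simp: integrable_completion intro: measurable_completion)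
  have 1: "(\<lambda>n. expectation (\<lambda>\<omega>. elem_integral B (S n) \<omega> * elem_integral B (S' n) \<omega>))
      \<longlonglongrightarrow> expectation (\<lambda>\<omega>. J \<omega> * J' \<omega>)"
    by (rule L2_limit_inner[OF Jm _ lim Jm' _ lim']) (auto intro: elem_integral_square_integrable S S')
  have 2: "(\<lambda>n. \<integral>p. u (elem_fun (S n)) p * u (elem_fun (S' n)) p \<partial>?C) \<longlonglongrightarrow> (\<integral>p. u \<Phi> p * u \<Phi>' p \<partial>?C)"
    by (rule L2_limit_inner[OF \<Phi>m _ \<Phi>_lim \<Phi>m' _ \<Phi>_lim']) (auto intro: compl S S')
  have "expectation (\<lambda>\<omega>. elem_integral B (S n) \<omega> * elem_integral B (S' n) \<omega>) =
      (\<integral>p. u (elem_fun (S n)) p * u (elem_fun (S' n)) p \<partial>?C)" for n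
  proof -
    have "(\<lambda>p. u (elem_fun (S n)) p * u (elem_fun (S' n)) p) \<in> borel_measurable (M \<Otimes>\<^sub>M control_measure \<rho>)"
      by (intro borel_measurable_times square_integrable_measurable base S S')
    from integral_completion[OF this] show ?thesis
      using elem_isometry[OF S S', of n n] by (simp add: u_def case_prod_unfold)
  qed
  with 2 have "(\<lambda>n. expectation (\<lambda>\<omega>. elem_integral B (S n) \<omega> * elem_integral B (S' n) \<omega>))
      \<longlonglongrightarrow> (\<integral>p. u \<Phi> p * u \<Phi>' p \<partial>?C)" by simp
  from LIMSEQ_unique[OF 1 this]
  have "expectation (\<lambda>\<omega>. J \<omega> * J' \<omega>) = (\<integral>p. u \<Phi> p * u \<Phi>' p \<partial>?C)" .
  then show ?thesis by (simp add: u_def case_prod_unfold)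
qed

end

section \<open>Exponential memory\<close>

lemma nn_integral_exp_past:
  assumes c: "c > 0"
  shows "(\<integral>\<^sup>+ s. ennreal (if s \<le> b then exp (- c * (b - s)) else 0) \<partial>lborel) = ennreal (1 / c)"
proof -
  have "(\<integral>\<^sup>+ s. ennreal (if s \<le> b then exp (- c * (b - s)) else 0) \<partial>lborel) =
      (\<integral>\<^sup>+ x. ennreal (if 0 \<le> x then exp (- c * x) else 0) \<partial>lborel)"
    by (subst nn_integral_real_affine[where c="-1" and t=b]) (auto intro!: nn_integral_cong)
  also have "\<dots> = (\<integral>\<^sup>+ x. ennreal (exp (- c * x)) * indicator {0..} x \<partial>lborel)"
    by (intro nn_integral_cong) (auto simp: indicator_def)
  also have "\<dots> = ennreal (0 - (- exp (- c * 0) / c))"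
  proof (rule nn_integral_FTC_atLeast)
    show "DERIV (\<lambda>x. - exp (- c * x) / c) x :> exp (- c * x)" for x
      using c by (auto intro!: derivative_eq_intros)
    have "filterlim (\<lambda>x. - c * x) at_bot at_top"
      using c by (intro filterlim_tendsto_neg_mult_at_bot[OF tendsto_const _ filterlim_ident]) auto
    from tendsto_divide[OF tendsto_minus[OF filterlim_compose[OF exp_at_bot this]] tendsto_const[of c]] c
    show "((\<lambda>x. - exp (- c * x) / c) \<longlongrightarrow> 0) at_top"
      by simp
  qed auto
  finally show ?thesis by simp
qed

lemma nn_integral_exp_past_strict:
  assumes c: "c > 0"
  shows "(\<integral>\<^sup>+ s. ennreal (if s < b then exp (- c * (b - s)) else 0) \<partial>lborel) = ennreal (1 / c)"
proof -
  have "(\<integral>\<^sup>+ s. ennreal (if s < b then exp (- c * (b - s)) else 0) \<partial>lborel) =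
      (\<integral>\<^sup>+ s. ennreal (if s \<le> b then exp (- c * (b - s)) else 0) \<partial>lborel)"
    using AE_lborel_singleton[of b] by (intro nn_integral_cong_AE) (auto elim!: eventually_mono)
  then show ?thesis using nn_integral_exp_past[OF c] by simp
qed

text \<open>The quotient in the third integral of the formula is a convolution of two exponentials
  over an interval of length \<open>h\<close>; the exceptional value at \<open>P = r\<close> is what the convolution gives
  there.\<close>

lemma nn_integral_exp_convolution:
  assumes h: "h \<ge> 0"
  shows "(\<integral>\<^sup>+ u. ennreal (if t < u \<and> u \<le> t + h then exp (- P * (t + h - u)) * exp (- r * (u - t)) else 0)
    \<partial>lborel) = ennreal (exp_quot h P r)"
proof -
  have "(\<integral>\<^sup>+ u. ennreal (if t < u \<and> u \<le> t + h then exp (- P * (t + h - u)) * exp (- r * (u - t)) else 0)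
      \<partial>lborel) =
      (\<integral>\<^sup>+ u. ennreal (exp (- P * (t + h - u) - r * (u - t))) * indicator {t..t + h} u \<partial>lborel)"
    using AE_lborel_singleton[of t]
    by (intro nn_integral_cong_AE)
      (auto elim!: eventually_mono simp: indicator_def mult_exp_exp)
  also have "\<dots> = ennreal (exp_quot h P r)"
  proof (cases "P = r")
    case True
    have "(\<integral>\<^sup>+ u. ennreal (exp (- P * (t + h - u) - r * (u - t))) * indicator {t..t + h} u \<partial>lborel) =
        (\<integral>\<^sup>+ u. ennreal (exp (- r * h)) * indicator {t..t + h} u \<partial>lborel)"
      unfolding True by (intro nn_integral_cong) (simp add: algebra_simps)
    then show ?thesis
      using h True by (simp add: nn_integral_cmult_indicator exp_quot_def ennreal_mult' mult.commute)
  next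
    case False
    let ?F = "\<lambda>u. exp (- P * (t + h - u) - r * (u - t)) / (P - r)"
    have "(\<integral>\<^sup>+ u. ennreal (exp (- P * (t + h - u) - r * (u - t))) * indicator {t..t + h} u \<partial>lborel) =
        ennreal (?F (t + h) - ?F t)"
    proof (rule nn_integral_FTC_Icc)
      show "DERIV ?F u :> exp (- P * (t + h - u) - r * (u - t))" for u
        using False by (auto intro!: derivative_eq_intros)
    qed (use h in auto)
    also have "?F (t + h) - ?F t = exp_quot h P r"
      using False by (simp add: exp_quot_def diff_divide_distrib)
    finally show ?thesis .
  qed
  finally show ?thesis .
qed

lemma exp_quot_nonneg:
  assumes h: "h \<ge> 0"
  shows "0 \<le> exp_quot h P r"
proof -
  consider "P = r" | "P < r" | "P > r" by linarith
  then show ?thesis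
  proof cases
    case 2
    then have "exp (- r * h) \<le> exp (- P * h)" using h by (simp add: mult_right_mono)
    with 2 show ?thesis by (simp add: exp_quot_def divide_nonpos_neg)
  next
    case 3
    then have "exp (- P * h) \<le> exp (- r * h)" using h by (simp add: mult_right_mono)
    with 3 show ?thesis by (simp add: exp_quot_def)
  qed (use h in \<open>simp add: exp_quot_def\<close>)
qed

lemma exp_quot_le:
  assumes h: "h \<ge> 0" and P: "P > 0" and r: "r > 0"
  shows "P * exp_quot h P r \<le> 1"
proof -
  have "ennreal (exp_quot h P r) \<le> (\<integral>\<^sup>+ u. ennreal (if u \<le> 0 + h then exp (- P * (0 + h - u)) else 0) \<partial>lborel)"
    unfolding nn_integral_exp_convolution[OF h, of 0, symmetric]
    using r by (intro nn_integral_mono) (auto simp: mult_left_le intro!: ennreal_leI)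
  also have "\<dots> = ennreal (1 / P)" using nn_integral_exp_past[OF P, of "0 + h"] by simp
  finally have "exp_quot h P r \<le> 1 / P" using P by (subst (asm) ennreal_le_iff) auto
  then show ?thesis using P by (simp add: field_simps)
qed

lemma nn_integral_separated:
  fixes a :: "real \<Rightarrow> real" and b :: "real \<Rightarrow> real \<Rightarrow> real"
  assumes a: "(\<integral>\<^sup>+ x. ennreal (a x) \<partial>lborel) = ennreal \<alpha>" and b: "\<And>x. (\<integral>\<^sup>+ y. ennreal (b x y) \<partial>lborel) = ennreal \<beta>"
    and [measurable]: "a \<in> borel_measurable lborel" "\<And>x. b x \<in> borel_measurable lborel"
    and nonneg: "c \<ge> 0" "\<And>x. a x \<ge> 0" "\<And>x y. b x y \<ge> 0" "\<alpha> \<ge> 0" "\<beta> \<ge> 0"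
  shows "(\<integral>\<^sup>+ x. (\<integral>\<^sup>+ y. ennreal (c * (a x * b x y)) \<partial>lborel) \<partial>lborel) = ennreal (c * (\<alpha> * \<beta>))"
proof -
  have "(\<integral>\<^sup>+ y. ennreal (c * (a x * b x y)) \<partial>lborel) = ennreal (c * \<beta>) * ennreal (a x)" for x
  proof -
    have "(\<integral>\<^sup>+ y. ennreal (c * (a x * b x y)) \<partial>lborel) = (\<integral>\<^sup>+ y. ennreal (c * a x) * ennreal (b x y) \<partial>lborel)"
      using nonneg by (intro nn_integral_cong) (simp add: mult.assoc flip: ennreal_mult)
    also have "\<dots> = ennreal (c * a x) * (\<integral>\<^sup>+ y. ennreal (b x y) \<partial>lborel)"
      by (rule nn_integral_cmult) measurable
    also have "\<dots> = ennreal (c * a x) * ennreal \<beta>" by (simp only: b)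
    also have "\<dots> = ennreal (c * \<beta>) * ennreal (a x)"
      using nonneg by (simp add: ac_simps flip: ennreal_mult)
    finally show ?thesis .
  qed
  then have "(\<integral>\<^sup>+ x. (\<integral>\<^sup>+ y. ennreal (c * (a x * b x y)) \<partial>lborel) \<partial>lborel) =
      (\<integral>\<^sup>+ x. ennreal (c * \<beta>) * ennreal (a x) \<partial>lborel)"
    by (intro nn_integral_cong)
  also have "\<dots> = ennreal (c * \<beta>) * (\<integral>\<^sup>+ x. ennreal (a x) \<partial>lborel)"
    by (rule nn_integral_cmult) measurable
  also have "\<dots> = ennreal (c * \<beta>) * ennreal \<alpha>" by (simp only: a)
  also have "\<dots> = ennreal (c * (\<alpha> * \<beta>))"
    using nonneg by (simp add: ac_simps flip: ennreal_mult)
  finally show ?thesis .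
qed

definition memory_weight :: "real \<Rightarrow> real \<Rightarrow> real \<Rightarrow> real" where
  "memory_weight t R s = (if s \<le> t then R * exp (- R * (t - s)) else 0)"

text \<open>The value of the double time integral below; divided by \<open>r\<close>, its two summands are the
  integrands of the second and the third integral of the formula.\<close>

definition past_pair_integral :: "real \<Rightarrow> real \<Rightarrow> real \<Rightarrow> real \<Rightarrow> real" where
  "past_pair_integral h R P r =
    R * P / (P + R) * (1 / (P + r) + 1 / (R + r)) * exp (- P * h) + R * P / (R + r) * exp_quot h P r"

text \<open>The plane of the two past times \<open>s \<le> t\<close> and \<open>u \<le> t + h\<close> is cut into \<open>u \<le> s\<close>,
  \<open>s < u \<le> t\<close> and \<open>t < u\<close>. On each part the absolute value disappears, the two variables
  separate, and the parts contribute the two summands of the second integral of the formula and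
  the third integral, in this order.\<close>

lemma memory_double_integral:
  assumes R: "R > 0" and P: "P > 0" and r: "r > 0" and h: "h \<ge> 0"
  shows "(\<integral>\<^sup>+ s. (\<integral>\<^sup>+ u. ennreal (memory_weight t R s * (memory_weight (t + h) P u * exp (- r * \<bar>u - s\<bar>)))
      \<partial>lborel) \<partial>lborel) =
    ennreal (past_pair_integral h R P r)"
proof -
  define c where "c = R * P * exp (- P * h)"
  have c: "c \<ge> 0" using R P by (simp add: c_def)
  define f1 f2 f3 where
    "f1 s u = c * ((if s \<le> t then exp (- (R + P) * (t - s)) else 0) *
      (if u \<le> s then exp (- (P + r) * (s - u)) else 0))" and
    "f2 s u = c * ((if u \<le> t then exp (- (R + P) * (t - u)) else 0) *
      (if s < u then exp (- (R + r) * (u - s)) else 0))" and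
    "f3 s u = R * P * ((if s \<le> t then exp (- (R + r) * (t - s)) else 0) *
      (if t < u \<and> u \<le> t + h then exp (- P * (t + h - u)) * exp (- r * (u - t)) else 0))" for s u
  have pos: "0 \<le> f1 s u" "0 \<le> f2 s u" "0 \<le> f3 s u" for s u
    using c R P by (auto simp: f1_def f2_def f3_def)
  have exps: "exp x * exp y * exp z = exp x' * exp y' * exp z'" if "x + y + z = x' + y' + z'"
    for x y z x' y' z' :: real
    using that by (simp flip: exp_add)
  have split: "memory_weight t R s * (memory_weight (t + h) P u * exp (- r * \<bar>u - s\<bar>)) =
      f1 s u + (f2 s u + f3 s u)" for s u
  proof (cases "s \<le> t \<and> u \<le> t + h")
    case False
    then show ?thesis
      using h by (auto simp: memory_weight_def f1_def f2_def f3_def)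
  next
    case True
    let ?E = "exp (- R * (t - s)) * exp (- P * (t + h - u)) * exp (- r * \<bar>u - s\<bar>)"
    have lhs: "memory_weight t R s * (memory_weight (t + h) P u * exp (- r * \<bar>u - s\<bar>)) = R * P * ?E"
      using True by (simp add: memory_weight_def)
    consider "u \<le> s" | "s < u" "u \<le> t" | "s < u" "t < u" by linarith
    then show ?thesis
    proof cases
      case 1
      then have E: "?E = exp (- P * h) * exp (- (R + P) * (t - s)) * exp (- (P + r) * (s - u))"
        by (intro exps) (simp add: algebra_simps)
      show ?thesis
        unfolding lhs E using 1 True by (simp add: f1_def f2_def f3_def c_def mult.assoc)
    next
      case 2
      then have E: "?E = exp (- P * h) * exp (- (R + P) * (t - u)) * exp (- (R + r) * (u - s))"
        by (intro exps) (simp add: algebra_simps)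
      show ?thesis
        unfolding lhs E using 2 True by (simp add: f1_def f2_def f3_def c_def mult.assoc)
    next
      case 3
      then have E: "?E = exp (- (R + r) * (t - s)) * exp (- P * (t + h - u)) * exp (- r * (u - t))"
        by (intro exps) (simp add: algebra_simps)
      show ?thesis
        unfolding lhs E using 3 True by (simp add: f1_def f2_def f3_def c_def mult.assoc)
    qed
  qed
  have [measurable]: "(\<lambda>(s, u). f1 s u) \<in> borel_measurable (lborel \<Otimes>\<^sub>M lborel)"
      "(\<lambda>(s, u). f2 s u) \<in> borel_measurable (lborel \<Otimes>\<^sub>M lborel)"
      "(\<lambda>(s, u). f3 s u) \<in> borel_measurable (lborel \<Otimes>\<^sub>M lborel)"
    unfolding f1_def f2_def f3_def by measurable
  have rates: "R + P > 0" "P + r > 0" "R + r > 0" using R P r by auto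
  have I1: "(\<integral>\<^sup>+ s. (\<integral>\<^sup>+ u. ennreal (f1 s u) \<partial>lborel) \<partial>lborel) = ennreal (c * ((1 / (R + P)) * (1 / (P + r))))"
    unfolding f1_def using rates c
    by (intro nn_integral_separated nn_integral_exp_past) auto
  have "(\<integral>\<^sup>+ u. (\<integral>\<^sup>+ s. ennreal (f2 s u) \<partial>lborel) \<partial>lborel) = ennreal (c * ((1 / (R + P)) * (1 / (R + r))))"
    unfolding f2_def using rates c
    by (intro nn_integral_separated nn_integral_exp_past nn_integral_exp_past_strict) auto
  moreover have "(\<integral>\<^sup>+ u. (\<integral>\<^sup>+ s. ennreal (f2 s u) \<partial>lborel) \<partial>lborel) =
      (\<integral>\<^sup>+ s. (\<integral>\<^sup>+ u. ennreal (f2 s u) \<partial>lborel) \<partial>lborel)"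
    by (rule lborel_pair.Fubini') measurable
  ultimately have I2: "(\<integral>\<^sup>+ s. (\<integral>\<^sup>+ u. ennreal (f2 s u) \<partial>lborel) \<partial>lborel) =
      ennreal (c * ((1 / (R + P)) * (1 / (R + r))))" by simp
  have I3: "(\<integral>\<^sup>+ s. (\<integral>\<^sup>+ u. ennreal (f3 s u) \<partial>lborel) \<partial>lborel) = ennreal (R * P * ((1 / (R + r)) * exp_quot h P r))"
    unfolding f3_def using rates R P exp_quot_nonneg[OF h]
    by (intro nn_integral_separated nn_integral_exp_past nn_integral_exp_convolution[OF h]) auto
  have "(\<integral>\<^sup>+ s. (\<integral>\<^sup>+ u. ennreal (memory_weight t R s * (memory_weight (t + h) P u * exp (- r * \<bar>u - s\<bar>)))
      \<partial>lborel) \<partial>lborel) =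
      (\<integral>\<^sup>+ s. (\<integral>\<^sup>+ u. ennreal (f1 s u) + (ennreal (f2 s u) + ennreal (f3 s u)) \<partial>lborel) \<partial>lborel)"
    unfolding split using pos by simp
  also have "\<dots> = (\<integral>\<^sup>+ s. (\<integral>\<^sup>+ u. ennreal (f1 s u) \<partial>lborel) \<partial>lborel) +
      ((\<integral>\<^sup>+ s. (\<integral>\<^sup>+ u. ennreal (f2 s u) \<partial>lborel) \<partial>lborel) + (\<integral>\<^sup>+ s. (\<integral>\<^sup>+ u. ennreal (f3 s u) \<partial>lborel) \<partial>lborel))"
    by (simp add: nn_integral_add)
  also have "\<dots> = ennreal (c * ((1 / (R + P)) * (1 / (P + r))) + (c * ((1 / (R + P)) * (1 / (R + r))) +
      R * P * ((1 / (R + r)) * exp_quot h P r)))"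
    unfolding I1 I2 I3 using R P r c exp_quot_nonneg[OF h, of P r] by (simp add: ennreal_plus)
  also have "c * ((1 / (R + P)) * (1 / (P + r))) + (c * ((1 / (R + P)) * (1 / (R + r))) +
      R * P * ((1 / (R + r)) * exp_quot h P r)) =
      past_pair_integral h R P r"
    by (simp add: c_def past_pair_integral_def distrib_left distrib_right ac_simps)
  finally show ?thesis .
qed

text \<open>Measurability of concrete functions is checked on Borel spaces and transported to the
  measures on \<open>(0,\<infinity>)\<close> and their products along the identity map.\<close>

lemma ident_measurable_pos_borel:
  assumes "sets \<rho> = sets pos_borel"
  shows "(\<lambda>x. x) \<in> measurable \<rho> (borel :: real measure)"
  unfolding measurable_cong_sets[OF assms refl]
  by (rule measurable_restrict_space1) (rule measurable_ident_sets[OF refl])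

lemma ident_measurable_pair:
  assumes "(\<lambda>x. x) \<in> measurable A A'" "(\<lambda>x. x) \<in> measurable B B'"
  shows "(\<lambda>x. x) \<in> measurable (A \<Otimes>\<^sub>M B) (A' \<Otimes>\<^sub>M B')"
  using measurable_Pair[OF measurable_compose[OF measurable_fst assms(1)]
      measurable_compose[OF measurable_snd assms(2)]] unfolding prod.collapse .

lemma measurable_ident_trans:
  assumes "(\<lambda>x. x) \<in> measurable A A'" "f \<in> measurable A' C"
  shows "f \<in> measurable A C"
  by (rule measurable_compose[OF assms])

locale memory_laws = \<rho>: prob_space \<rho> + \<pi>: prob_space \<pi> for \<rho> \<pi> :: "real measure" +
  assumes sets_\<rho>: "sets \<rho> = sets pos_borel" and sets_\<pi>: "sets \<pi> = sets pos_borel"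
    and integrable_inverse: "integrable \<pi> (\<lambda>r. 1 / r)"
begin

sublocale RS: pair_sigma_finite \<rho> "lborel :: real measure" ..
sublocale SP: pair_sigma_finite "lborel :: real measure" \<pi> ..

lemma space_\<rho>: "space \<rho> = {0<..}" and space_\<pi>: "space \<pi> = {0<..}"
  using sets_eq_imp_space_eq[OF sets_\<rho>] sets_eq_imp_space_eq[OF sets_\<pi>]
  unfolding space_restrict_space by (simp_all only: space_borel Int_UNIV_right)

lemma ident_\<rho>: "(\<lambda>x. x) \<in> measurable \<rho> (borel :: real measure)"
  and ident_\<pi>: "(\<lambda>x. x) \<in> measurable \<pi> (borel :: real measure)"
  and ident_borel: "(\<lambda>x. x) \<in> measurable borel (borel :: real measure)"
  by (rule ident_measurable_pos_borel[OF sets_\<rho>], rule ident_measurable_pos_borel[OF sets_\<pi>], simp)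

lemma memory_weight_measurable [measurable]:
  "(\<lambda>p. memory_weight t (fst p) (snd p)) \<in> borel_measurable (control_measure \<rho>)"
  by (rule measurable_ident_trans[OF ident_measurable_pair[OF ident_\<rho> measurable_ident_sets[OF sets_lborel]]])
    (unfold memory_weight_def, measurable)

text \<open>The law of a random past time seen from \<open>t\<close>: a rate \<open>R\<close> is drawn from \<open>\<rho>\<close>, and then
  an exponential delay of that rate.\<close>

definition memory_law :: "real \<Rightarrow> (real \<times> real) measure" where
  "memory_law t = density (control_measure \<rho>) (\<lambda>p. ennreal (memory_weight t (fst p) (snd p)))"

lemma nn_integral_memory_law:
  "f \<in> borel_measurable (control_measure \<rho>) \<Longrightarrow>
    (\<integral>\<^sup>+ p. f p \<partial>memory_law t) = (\<integral>\<^sup>+ p. ennreal (memory_weight t (fst p) (snd p)) * f p \<partial>control_measure \<rho>)"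
  unfolding memory_law_def
  by (rule nn_integral_density[OF measurable_compose[OF memory_weight_measurable measurable_ennreal]])

lemma prob_space_memory_law: "prob_space (memory_law t)"
proof
  have "emeasure (memory_law t) (space (memory_law t)) = (\<integral>\<^sup>+ p. 1 \<partial>memory_law t)"
    by simp
  also have "\<dots> = (\<integral>\<^sup>+ p. ennreal (memory_weight t (fst p) (snd p)) \<partial>control_measure \<rho>)"
    by (subst nn_integral_memory_law) auto
  also have "\<dots> = (\<integral>\<^sup>+ R. (\<integral>\<^sup>+ s. ennreal (memory_weight t R s) \<partial>lborel) \<partial>\<rho>)"
    by (subst lborel.nn_integral_fst[symmetric]) auto
  also have "\<dots> = (\<integral>\<^sup>+ R. 1 \<partial>\<rho>)"
  proof (intro nn_integral_cong)
    fix R assume "R \<in> space \<rho>"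
    then have R: "R > 0" by (simp add: space_\<rho>)
    have "(\<integral>\<^sup>+ s. ennreal (memory_weight t R s) \<partial>lborel) =
        (\<integral>\<^sup>+ s. ennreal R * ennreal (if s \<le> t then exp (- R * (t - s)) else 0) \<partial>lborel)"
      using R by (intro nn_integral_cong) (auto simp: memory_weight_def ennreal_mult')
    also have "\<dots> = ennreal R * ennreal (1 / R)"
      by (subst nn_integral_cmult) (auto simp only: nn_integral_exp_past[OF R], auto)
    also have "\<dots> = 1" using R by (simp flip: ennreal_mult')
    finally show "(\<integral>\<^sup>+ s. ennreal (memory_weight t R s) \<partial>lborel) = 1" .
  qed
  finally show "emeasure (memory_law t) (space (memory_law t)) = 1" by (simp add: \<rho>.emeasure_space_1)
qed

text \<open>The bound \<open>c / r\<close> is integrable with respect to \<open>\<pi>\<close>, so that every level of the iterated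
  integral is finite.\<close>

lemma iterated_integral_eq_nn_integral:
  fixes f :: "real \<times> real \<times> real \<Rightarrow> real"
  assumes f: "f \<in> borel_measurable (borel \<Otimes>\<^sub>M (borel \<Otimes>\<^sub>M borel))"
    and bounds: "\<And>R P r. R > 0 \<Longrightarrow> P > 0 \<Longrightarrow> r > 0 \<Longrightarrow> 0 \<le> f (R, P, r) \<and> f (R, P, r) \<le> c / r"
  shows "(\<integral>\<^sup>+ R. (\<integral>\<^sup>+ P. (\<integral>\<^sup>+ r. ennreal (f (R, P, r)) \<partial>\<pi>) \<partial>\<rho>) \<partial>\<rho>) =
    ennreal (\<integral>R. (\<integral>P. (\<integral>r. f (R, P, r) \<partial>\<pi>) \<partial>\<rho>) \<partial>\<rho>)"
    and "0 \<le> (\<integral>R. (\<integral>P. (\<integral>r. f (R, P, r) \<partial>\<pi>) \<partial>\<rho>) \<partial>\<rho>)"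
proof -
  have fm [measurable]: "f \<in> borel_measurable (\<rho> \<Otimes>\<^sub>M (\<rho> \<Otimes>\<^sub>M \<pi>))"
    by (rule measurable_ident_trans[OF _ f]) (intro ident_measurable_pair ident_\<rho> ident_\<pi>)
  define \<kappa> where "\<kappa> = (\<integral>r. c / r \<partial>\<pi>)"
  have int_c: "integrable \<pi> (\<lambda>r. c / r)" using integrable_mult_right[OF integrable_inverse, of c] by simp
  have inner_int: "integrable \<pi> (\<lambda>r. f (R, P, r))" if "R \<in> space \<rho>" "P \<in> space \<rho>" for R P
  proof (rule Bochner_Integration.integrable_bound[OF int_c])
    show "(\<lambda>r. f (R, P, r)) \<in> borel_measurable \<pi>" using that by measurable
    show "AE r in \<pi>. norm (f (R, P, r)) \<le> norm (c / r)"
    proof (rule AE_I2)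
      fix r assume "r \<in> space \<pi>"
      then have "0 \<le> f (R, P, r) \<and> f (R, P, r) \<le> c / r"
        using that bounds[of R P r] by (auto simp: space_\<rho> space_\<pi>)
      then show "norm (f (R, P, r)) \<le> norm (c / r)" by (metis abs_of_nonneg order_trans real_norm_def)
    qed
  qed
  have inner_nn: "(\<integral>\<^sup>+ r. ennreal (f (R, P, r)) \<partial>\<pi>) = ennreal (\<integral>r. f (R, P, r) \<partial>\<pi>)"
    if "R \<in> space \<rho>" "P \<in> space \<rho>" for R P
    using that bounds[of R P]
    by (intro nn_integral_eq_integral inner_int AE_I2) (auto simp: space_\<rho> space_\<pi>)
  have inner_bound: "0 \<le> (\<integral>r. f (R, P, r) \<partial>\<pi>)" "(\<integral>r. f (R, P, r) \<partial>\<pi>) \<le> \<kappa>"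
    if "R \<in> space \<rho>" "P \<in> space \<rho>" for R P
    unfolding \<kappa>_def using that bounds[of R P]
    by (auto intro!: Bochner_Integration.integral_nonneg integral_mono inner_int int_c simp: space_\<rho> space_\<pi>)
  have mid_int: "integrable \<rho> (\<lambda>P. \<integral>r. f (R, P, r) \<partial>\<pi>)" if "R \<in> space \<rho>" for R
  proof (rule \<rho>.integrable_const_bound[where B=\<kappa>])
    show "AE P in \<rho>. norm (\<integral>r. f (R, P, r) \<partial>\<pi>) \<le> \<kappa>"
      using inner_bound[OF that] by (intro AE_I2) auto
    show "(\<lambda>P. \<integral>r. f (R, P, r) \<partial>\<pi>) \<in> borel_measurable \<rho>" using that by measurable
  qed
  have mid_nn: "(\<integral>\<^sup>+ P. (\<integral>\<^sup>+ r. ennreal (f (R, P, r)) \<partial>\<pi>) \<partial>\<rho>) = ennreal (\<integral>P. (\<integral>r. f (R, P, r) \<partial>\<pi>) \<partial>\<rho>)"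
    if "R \<in> space \<rho>" for R
  proof -
    have "(\<integral>\<^sup>+ P. (\<integral>\<^sup>+ r. ennreal (f (R, P, r)) \<partial>\<pi>) \<partial>\<rho>) = (\<integral>\<^sup>+ P. ennreal (\<integral>r. f (R, P, r) \<partial>\<pi>) \<partial>\<rho>)"
      using inner_nn[OF that] by (intro nn_integral_cong)
    also have "\<dots> = ennreal (\<integral>P. (\<integral>r. f (R, P, r) \<partial>\<pi>) \<partial>\<rho>)"
      using inner_bound[OF that] by (intro nn_integral_eq_integral mid_int[OF that] AE_I2)
    finally show ?thesis .
  qed
  have mid_bound: "0 \<le> (\<integral>P. (\<integral>r. f (R, P, r) \<partial>\<pi>) \<partial>\<rho>)" "(\<integral>P. (\<integral>r. f (R, P, r) \<partial>\<pi>) \<partial>\<rho>) \<le> \<kappa>"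
    if "R \<in> space \<rho>" for R
  proof -
    show "0 \<le> (\<integral>P. (\<integral>r. f (R, P, r) \<partial>\<pi>) \<partial>\<rho>)"
      by (rule Bochner_Integration.integral_nonneg[OF inner_bound(1)[OF that]])
    have "(\<integral>P. (\<integral>r. f (R, P, r) \<partial>\<pi>) \<partial>\<rho>) \<le> (\<integral>P. \<kappa> \<partial>\<rho>)"
      using inner_bound[OF that] by (intro integral_mono mid_int[OF that]) auto
    then show "(\<integral>P. (\<integral>r. f (R, P, r) \<partial>\<pi>) \<partial>\<rho>) \<le> \<kappa>" by (simp add: \<rho>.prob_space)
  qed
  have outer_int: "integrable \<rho> (\<lambda>R. \<integral>P. (\<integral>r. f (R, P, r) \<partial>\<pi>) \<partial>\<rho>)"
  proof (rule \<rho>.integrable_const_bound[where B=\<kappa>])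
    show "AE R in \<rho>. norm (\<integral>P. (\<integral>r. f (R, P, r) \<partial>\<pi>) \<partial>\<rho>) \<le> \<kappa>"
      using mid_bound by (intro AE_I2) auto
    show "(\<lambda>R. \<integral>P. (\<integral>r. f (R, P, r) \<partial>\<pi>) \<partial>\<rho>) \<in> borel_measurable \<rho>" by measurable
  qed
  have "(\<integral>\<^sup>+ R. (\<integral>\<^sup>+ P. (\<integral>\<^sup>+ r. ennreal (f (R, P, r)) \<partial>\<pi>) \<partial>\<rho>) \<partial>\<rho>) =
      (\<integral>\<^sup>+ R. ennreal (\<integral>P. (\<integral>r. f (R, P, r) \<partial>\<pi>) \<partial>\<rho>) \<partial>\<rho>)"
    using mid_nn by (intro nn_integral_cong)
  also have "\<dots> = ennreal (\<integral>R. (\<integral>P. (\<integral>r. f (R, P, r) \<partial>\<pi>) \<partial>\<rho>) \<partial>\<rho>)"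
    using mid_bound by (intro nn_integral_eq_integral outer_int AE_I2)
  finally show "(\<integral>\<^sup>+ R. (\<integral>\<^sup>+ P. (\<integral>\<^sup>+ r. ennreal (f (R, P, r)) \<partial>\<pi>) \<partial>\<rho>) \<partial>\<rho>) =
    ennreal (\<integral>R. (\<integral>P. (\<integral>r. f (R, P, r) \<partial>\<pi>) \<partial>\<rho>) \<partial>\<rho>)" .
  show "0 \<le> (\<integral>R. (\<integral>P. (\<integral>r. f (R, P, r) \<partial>\<pi>) \<partial>\<rho>) \<partial>\<rho>)"
    by (rule Bochner_Integration.integral_nonneg[OF mid_bound(1)])
qed

lemma I2_I3_nn_integral:
  assumes h: "h \<ge> 0"
  shows "(\<integral>\<^sup>+ R. (\<integral>\<^sup>+ P. (\<integral>\<^sup>+ r. ennreal (1 / r * past_pair_integral h R P r) \<partial>\<pi>) \<partial>\<rho>) \<partial>\<rho>) = ennreal (I2 \<rho> \<pi> h + I3 \<rho> \<pi> h)"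
    and "0 \<le> I2 \<rho> \<pi> h + I3 \<rho> \<pi> h"
proof -
  define f2 f3 :: "real \<times> real \<times> real \<Rightarrow> real" where
    "f2 = (\<lambda>(R, P, r). R * P / (r * (P + R)) * (1 / (P + r) + 1 / (R + r)) * exp (- P * h))" and
    "f3 = (\<lambda>(R, P, r). R * P / (r * (R + r)) * exp_quot h P r)"
  have m2: "f2 \<in> borel_measurable (borel \<Otimes>\<^sub>M (borel \<Otimes>\<^sub>M borel))"
    unfolding f2_def by measurable
  have m3: "f3 \<in> borel_measurable (borel \<Otimes>\<^sub>M (borel \<Otimes>\<^sub>M borel))"
    unfolding f3_def exp_quot_def by measurable
  have f2_eq: "R * P / (r * a) * (1 / b + 1 / d) * E = 1 / r * ((R / a * (P / b) + P / a * (R / d)) * E)"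
    for R P r a b d E :: real by (simp add: divide_inverse algebra_simps)
  have sum_eq: "1 / r * (R * P / a * X * E + R * P / b * q) = R * P / (r * a) * X * E + R * P / (r * b) * q"
    for R P r a b X E q :: real by (simp add: divide_inverse algebra_simps)
  have b2: "0 \<le> f2 (R, P, r) \<and> f2 (R, P, r) \<le> 2 / r" if pos: "R > 0" "P > 0" "r > 0" for R P r
  proof
    show "0 \<le> f2 (R, P, r)" using pos by (simp add: f2_def)
    have frac: "P / (P + r) \<le> 1" "R / (R + r) \<le> 1" "R / (P + R) \<le> 1" "P / (P + R) \<le> 1"
      using pos by (auto simp: divide_simps)
    have "f2 (R, P, r) = (1 / r) * (((R / (P + R)) * (P / (P + r)) + (P / (P + R)) * (R / (R + r))) * exp (- P * h))"
      unfolding f2_def prod.case by (rule f2_eq)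
    also have "\<dots> \<le> (1 / r) * ((1 * 1 + 1 * 1) * 1)"
      using pos frac h by (intro mult_left_mono mult_mono add_mono) auto
    finally show "f2 (R, P, r) \<le> 2 / r" by simp
  qed
  have b3: "0 \<le> f3 (R, P, r) \<and> f3 (R, P, r) \<le> 1 / r" if pos: "R > 0" "P > 0" "r > 0" for R P r
  proof
    show "0 \<le> f3 (R, P, r)" using pos exp_quot_nonneg[OF h] by (simp add: f3_def)
    have "f3 (R, P, r) = (1 / r) * ((R / (R + r)) * (P * exp_quot h P r))"
      by (simp add: f3_def)
    also have "\<dots> \<le> (1 / r) * (1 * 1)"
      using pos exp_quot_le[OF h pos(2,3)] exp_quot_nonneg[OF h, of P r]
      by (intro mult_left_mono mult_mono) auto
    finally show "f3 (R, P, r) \<le> 1 / r" by simp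
  qed
  have int2: "(\<integral>\<^sup>+ R. (\<integral>\<^sup>+ P. (\<integral>\<^sup>+ r. ennreal (f2 (R, P, r)) \<partial>\<pi>) \<partial>\<rho>) \<partial>\<rho>) = ennreal (I2 \<rho> \<pi> h)"
      "0 \<le> I2 \<rho> \<pi> h"
    using iterated_integral_eq_nn_integral[of f2 2, OF m2] b2 by (simp_all add: I2_def f2_def)
  have int3: "(\<integral>\<^sup>+ R. (\<integral>\<^sup>+ P. (\<integral>\<^sup>+ r. ennreal (f3 (R, P, r)) \<partial>\<pi>) \<partial>\<rho>) \<partial>\<rho>) = ennreal (I3 \<rho> \<pi> h)"
      "0 \<le> I3 \<rho> \<pi> h"
    using iterated_integral_eq_nn_integral[of f3 1, OF m3] b3 by (simp_all add: I3_def f3_def)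
  have [measurable]: "f2 \<in> borel_measurable (\<rho> \<Otimes>\<^sub>M (\<rho> \<Otimes>\<^sub>M \<pi>))"
      "f3 \<in> borel_measurable (\<rho> \<Otimes>\<^sub>M (\<rho> \<Otimes>\<^sub>M \<pi>))"
    by (rule measurable_ident_trans[OF _ m2] measurable_ident_trans[OF _ m3],
        intro ident_measurable_pair ident_\<rho> ident_\<pi>)+
  have "(\<integral>\<^sup>+ R. (\<integral>\<^sup>+ P. (\<integral>\<^sup>+ r. ennreal (1 / r * past_pair_integral h R P r) \<partial>\<pi>) \<partial>\<rho>) \<partial>\<rho>) =
      (\<integral>\<^sup>+ R. (\<integral>\<^sup>+ P. (\<integral>\<^sup>+ r. ennreal (f2 (R, P, r)) + ennreal (f3 (R, P, r)) \<partial>\<pi>) \<partial>\<rho>) \<partial>\<rho>)"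
  proof (intro nn_integral_cong)
    fix R P r assume "R \<in> space \<rho>" "P \<in> space \<rho>" "r \<in> space \<pi>"
    then have pos: "R > 0" "P > 0" "r > 0" by (auto simp: space_\<rho> space_\<pi>)
    have "1 / r * past_pair_integral h R P r = f2 (R, P, r) + f3 (R, P, r)"
      unfolding past_pair_integral_def f2_def f3_def prod.case by (rule sum_eq)
    then show "ennreal (1 / r * past_pair_integral h R P r) = ennreal (f2 (R, P, r)) + ennreal (f3 (R, P, r))"
      using b2[OF pos] b3[OF pos] by (simp add: ennreal_plus)
  qed
  also have "\<dots> = (\<integral>\<^sup>+ R. (\<integral>\<^sup>+ P. (\<integral>\<^sup>+ r. ennreal (f2 (R, P, r)) \<partial>\<pi>) + (\<integral>\<^sup>+ r. ennreal (f3 (R, P, r)) \<partial>\<pi>) \<partial>\<rho>) \<partial>\<rho>)"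
    by (intro nn_integral_cong nn_integral_add) measurable
  also have "\<dots> = (\<integral>\<^sup>+ R. (\<integral>\<^sup>+ P. (\<integral>\<^sup>+ r. ennreal (f2 (R, P, r)) \<partial>\<pi>) \<partial>\<rho>) + (\<integral>\<^sup>+ P. (\<integral>\<^sup>+ r. ennreal (f3 (R, P, r)) \<partial>\<pi>) \<partial>\<rho>) \<partial>\<rho>)"
    by (intro nn_integral_cong nn_integral_add) measurable
  also have "\<dots> = (\<integral>\<^sup>+ R. (\<integral>\<^sup>+ P. (\<integral>\<^sup>+ r. ennreal (f2 (R, P, r)) \<partial>\<pi>) \<partial>\<rho>) \<partial>\<rho>) +
      (\<integral>\<^sup>+ R. (\<integral>\<^sup>+ P. (\<integral>\<^sup>+ r. ennreal (f3 (R, P, r)) \<partial>\<pi>) \<partial>\<rho>) \<partial>\<rho>)"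
    by (intro nn_integral_add) measurable
  also have "\<dots> = ennreal (I2 \<rho> \<pi> h + I3 \<rho> \<pi> h)"
    unfolding int2(1) int3(1) using int2(2) int3(2)
    by (simp add: ennreal_plus)
  finally show "(\<integral>\<^sup>+ R. (\<integral>\<^sup>+ P. (\<integral>\<^sup>+ r. ennreal (1 / r * past_pair_integral h R P r) \<partial>\<pi>) \<partial>\<rho>) \<partial>\<rho>) = ennreal (I2 \<rho> \<pi> h + I3 \<rho> \<pi> h)" .
  show "0 \<le> I2 \<rho> \<pi> h + I3 \<rho> \<pi> h"
    using int2(2) int3(2) by simp
qed

lemma memory_law_double_integral:
  assumes h: "h \<ge> 0"
  shows "(\<integral>\<^sup>+ p. (\<integral>\<^sup>+ q. (\<integral>\<^sup>+ r. ennreal (exp (- r * \<bar>snd q - snd p\<bar>) / r) \<partial>\<pi>) \<partial>memory_law (t + h)) \<partial>memory_law t) =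
    ennreal (I2 \<rho> \<pi> h + I3 \<rho> \<pi> h)"
proof -
  define e :: "real \<times> real \<times> real \<Rightarrow> ennreal"
    where "e = (\<lambda>(s, u, r). ennreal (exp (- r * \<bar>u - s\<bar>) / r))"
  define G :: "real \<times> real \<times> real \<times> real \<times> real \<Rightarrow> ennreal" where
    "G = (\<lambda>(R, s, P, u, r). ennreal (memory_weight t R s) * (ennreal (memory_weight (t + h) P u) * e (s, u, r)))"
  have "e \<in> borel_measurable (borel \<Otimes>\<^sub>M (borel \<Otimes>\<^sub>M borel))"
    unfolding e_def by measurable
  then have e [measurable]: "e \<in> borel_measurable (borel \<Otimes>\<^sub>M (borel \<Otimes>\<^sub>M \<pi>))"
    by (rule measurable_ident_trans[rotated]) (intro ident_measurable_pair ident_\<pi> ident_borel)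
  have "G \<in> borel_measurable
      (borel \<Otimes>\<^sub>M (borel \<Otimes>\<^sub>M (borel \<Otimes>\<^sub>M (borel \<Otimes>\<^sub>M borel))))"
    unfolding G_def e_def memory_weight_def by measurable
  then have G [measurable]: "G \<in> borel_measurable
      (\<rho> \<Otimes>\<^sub>M (borel \<Otimes>\<^sub>M (\<rho> \<Otimes>\<^sub>M (borel \<Otimes>\<^sub>M \<pi>))))"
    by (rule measurable_ident_trans[rotated]) (intro ident_measurable_pair ident_\<rho> ident_\<pi> ident_borel)
  have "(\<integral>\<^sup>+ p. (\<integral>\<^sup>+ q. (\<integral>\<^sup>+ r. e (snd p, snd q, r) \<partial>\<pi>) \<partial>memory_law (t + h)) \<partial>memory_law t) =
      (\<integral>\<^sup>+ p. ennreal (memory_weight t (fst p) (snd p)) * (\<integral>\<^sup>+ q. ennreal (memory_weight (t + h) (fst q) (snd q)) *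
        (\<integral>\<^sup>+ r. e (snd p, snd q, r) \<partial>\<pi>) \<partial>control_measure \<rho>) \<partial>control_measure \<rho>)"
  proof -
    have inner: "(\<lambda>q. \<integral>\<^sup>+ r. e (snd p, snd q, r) \<partial>\<pi>) \<in> borel_measurable (control_measure \<rho>)" for p :: "real \<times> real"
      by measurable
    have outer: "(\<lambda>p. \<integral>\<^sup>+ q. ennreal (memory_weight (t + h) (fst q) (snd q)) *
        (\<integral>\<^sup>+ r. e (snd p, snd q, r) \<partial>\<pi>) \<partial>control_measure \<rho>) \<in> borel_measurable (control_measure \<rho>)"
      by measurable
    show ?thesis
      unfolding nn_integral_memory_law[OF inner] by (rule nn_integral_memory_law[OF outer])
  qed
  also have "\<dots> = (\<integral>\<^sup>+ p. (\<integral>\<^sup>+ q. (\<integral>\<^sup>+ r. G (fst p, snd p, fst q, snd q, r) \<partial>\<pi>) \<partial>control_measure \<rho>)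
      \<partial>control_measure \<rho>)"
    unfolding G_def by (intro nn_integral_cong) (simp add: nn_integral_cmult space_pair_measure)
  also have "\<dots> = (\<integral>\<^sup>+ R. (\<integral>\<^sup>+ s. (\<integral>\<^sup>+ P. (\<integral>\<^sup>+ u. (\<integral>\<^sup>+ r. G (R, s, P, u, r) \<partial>\<pi>) \<partial>lborel) \<partial>\<rho>) \<partial>lborel) \<partial>\<rho>)"
  proof -
    have "(\<integral>\<^sup>+ p. (\<integral>\<^sup>+ q. (\<integral>\<^sup>+ r. G (fst p, snd p, fst q, snd q, r) \<partial>\<pi>) \<partial>control_measure \<rho>) \<partial>control_measure \<rho>) =
        (\<integral>\<^sup>+ R. (\<integral>\<^sup>+ s. (\<integral>\<^sup>+ q. (\<integral>\<^sup>+ r. G (R, s, fst q, snd q, r) \<partial>\<pi>) \<partial>control_measure \<rho>) \<partial>lborel) \<partial>\<rho>)"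
    proof -
      have "(\<lambda>p. \<integral>\<^sup>+ q. (\<integral>\<^sup>+ r. G (fst p, snd p, fst q, snd q, r) \<partial>\<pi>) \<partial>control_measure \<rho>)
          \<in> borel_measurable (control_measure \<rho>)" by measurable
      from lborel.nn_integral_fst[OF this] show ?thesis by simp
    qed
    also have "\<dots> = (\<integral>\<^sup>+ R. (\<integral>\<^sup>+ s. (\<integral>\<^sup>+ P. (\<integral>\<^sup>+ u. (\<integral>\<^sup>+ r. G (R, s, P, u, r) \<partial>\<pi>) \<partial>lborel) \<partial>\<rho>) \<partial>lborel) \<partial>\<rho>)"
    proof (intro nn_integral_cong)
      fix R s :: real assume R: "R \<in> space \<rho>"
      show "(\<integral>\<^sup>+ q. (\<integral>\<^sup>+ r. G (R, s, fst q, snd q, r) \<partial>\<pi>) \<partial>control_measure \<rho>) =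
          (\<integral>\<^sup>+ P. (\<integral>\<^sup>+ u. (\<integral>\<^sup>+ r. G (R, s, P, u, r) \<partial>\<pi>) \<partial>lborel) \<partial>\<rho>)"
      proof -
        have "(\<lambda>q. \<integral>\<^sup>+ r. G (R, s, fst q, snd q, r) \<partial>\<pi>) \<in> borel_measurable (control_measure \<rho>)"
          using R by measurable
        from lborel.nn_integral_fst[OF this] show ?thesis by simp
      qed
    qed
    finally show ?thesis .
  qed
  \<comment> \<open>the two times are moved innermost\<close>
  also have "\<dots> = (\<integral>\<^sup>+ R. (\<integral>\<^sup>+ P. (\<integral>\<^sup>+ s. (\<integral>\<^sup>+ u. (\<integral>\<^sup>+ r. G (R, s, P, u, r) \<partial>\<pi>) \<partial>lborel) \<partial>lborel) \<partial>\<rho>) \<partial>\<rho>)"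
    by (intro nn_integral_cong RS.Fubini') measurable
  also have "\<dots> = (\<integral>\<^sup>+ R. (\<integral>\<^sup>+ P. (\<integral>\<^sup>+ s. (\<integral>\<^sup>+ r. (\<integral>\<^sup>+ u. G (R, s, P, u, r) \<partial>lborel) \<partial>\<pi>) \<partial>lborel) \<partial>\<rho>) \<partial>\<rho>)"
    by (intro nn_integral_cong SP.Fubini'[symmetric]) measurable
  also have "\<dots> = (\<integral>\<^sup>+ R. (\<integral>\<^sup>+ P. (\<integral>\<^sup>+ r. (\<integral>\<^sup>+ s. (\<integral>\<^sup>+ u. G (R, s, P, u, r) \<partial>lborel) \<partial>lborel) \<partial>\<pi>) \<partial>\<rho>) \<partial>\<rho>)"
    by (intro nn_integral_cong SP.Fubini'[symmetric]) measurable
  also have "\<dots> = (\<integral>\<^sup>+ R. (\<integral>\<^sup>+ P. (\<integral>\<^sup>+ r. ennreal (1 / r * past_pair_integral h R P r) \<partial>\<pi>) \<partial>\<rho>) \<partial>\<rho>)"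
  proof (intro nn_integral_cong)
    fix R P r assume "R \<in> space \<rho>" "P \<in> space \<rho>" "r \<in> space \<pi>"
    then have pos: "R > 0" "P > 0" "r > 0" by (auto simp: space_\<rho> space_\<pi>)
    have G_eq: "G (R, s, P, u, r) = ennreal (1 / r) *
        ennreal (memory_weight t R s * (memory_weight (t + h) P u * exp (- r * \<bar>u - s\<bar>)))" for s u
      using pos by (simp add: G_def e_def memory_weight_def ac_simps flip: ennreal_mult')
    have "(\<integral>\<^sup>+ s. (\<integral>\<^sup>+ u. G (R, s, P, u, r) \<partial>lborel) \<partial>lborel) = ennreal (1 / r) * (\<integral>\<^sup>+ s. (\<integral>\<^sup>+ u.
        ennreal (memory_weight t R s * (memory_weight (t + h) P u * exp (- r * \<bar>u - s\<bar>))) \<partial>lborel) \<partial>lborel)"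
      unfolding G_eq memory_weight_def by (simp add: nn_integral_cmult)
    also have "\<dots> = ennreal (1 / r * past_pair_integral h R P r)"
      unfolding memory_double_integral[OF pos h]
      by (rule ennreal_mult'[symmetric]) (use pos in simp)
    finally show "(\<integral>\<^sup>+ s. (\<integral>\<^sup>+ u. G (R, s, P, u, r) \<partial>lborel) \<partial>lborel) =
        ennreal (1 / r * past_pair_integral h R P r)" .
  qed
  also have "\<dots> = ennreal (I2 \<rho> \<pi> h + I3 \<rho> \<pi> h)" by (rule I2_I3_nn_integral(1)[OF h])
  finally show ?thesis by (simp add: e_def)
qed

text \<open>Averaging the correlation kernel at the distance of two independent random past times, seen
  from \<open>t\<close> and from \<open>t + h\<close>, gives what the drift contributes to the formula, up to a constant
  factor.\<close>

lemma memory_law_covariance: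
  fixes t h :: real
  assumes h: "h \<ge> 0"
  shows "(\<integral>p. (\<integral>q. (\<integral>r. exp (- r * \<bar>snd q - snd p\<bar>) / r \<partial>\<pi>) \<partial>memory_law (t + h)) \<partial>memory_law t) =
    I2 \<rho> \<pi> h + I3 \<rho> \<pi> h"
proof -
  interpret Q: prob_space "memory_law t'" for t' by (rule prob_space_memory_law)
  have sets_Q [measurable_cong]: "sets (memory_law t') = sets (control_measure \<rho>)" for t'
    by (simp add: memory_law_def)
  define e :: "real \<times> real \<Rightarrow> real" where "e = (\<lambda>(d, r). exp (- r * \<bar>d\<bar>) / r)"
  define c where "c d = (\<integral>r. e (d, r) \<partial>\<pi>)" for d
  have "e \<in> borel_measurable (borel \<Otimes>\<^sub>M borel)" unfolding e_def by measurable
  then have [measurable]: "e \<in> borel_measurable (borel \<Otimes>\<^sub>M \<pi>)"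
    by (rule measurable_ident_trans[rotated]) (intro ident_measurable_pair ident_\<pi> ident_borel)
  have [measurable]: "c \<in> borel_measurable borel" unfolding c_def by measurable
  have e_bounds: "0 \<le> e (d, r)" "e (d, r) \<le> 1 / r" if "r \<in> space \<pi>" for d r
    using that by (auto simp: e_def space_\<pi> divide_right_mono)
  have e_int: "integrable \<pi> (\<lambda>r. e (d, r))" for d
    using e_bounds by (intro Bochner_Integration.integrable_bound[OF integrable_inverse] AE_I2) (auto simp: space_\<pi>)
  have c_nn: "ennreal (c d) = (\<integral>\<^sup>+ r. ennreal (e (d, r)) \<partial>\<pi>)" for d
    unfolding c_def using e_bounds by (intro nn_integral_eq_integral[symmetric] e_int AE_I2)
  have c_nonneg: "0 \<le> c d" for d
    unfolding c_def using e_bounds(1) by (rule Bochner_Integration.integral_nonneg)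
  have c_le: "c d \<le> (\<integral>r. 1 / r \<partial>\<pi>)" for d
    unfolding c_def using e_bounds(2) by (intro integral_mono e_int integrable_inverse)
  have inner_int: "integrable (memory_law t') (\<lambda>q. c (snd q - s))" for s t'
    using c_nonneg c_le by (intro Q.integrable_const_bound[where B="\<integral>r. 1 / r \<partial>\<pi>"] AE_I2) auto
  define C where "C s = (\<integral>q. c (snd q - s) \<partial>memory_law (t + h))" for s
  have C_nonneg: "0 \<le> C s" for s
    unfolding C_def using c_nonneg by (intro Bochner_Integration.integral_nonneg)
  have C_le: "C s \<le> (\<integral>r. 1 / r \<partial>\<pi>)" for s
  proof -
    have "C s \<le> (\<integral>q. (\<integral>r. 1 / r \<partial>\<pi>) \<partial>memory_law (t + h))"
      unfolding C_def using c_le by (intro integral_mono inner_int) auto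
    then show ?thesis by (simp add: Q.prob_space)
  qed
  have C_nn: "ennreal (C s) = (\<integral>\<^sup>+ q. ennreal (c (snd q - s)) \<partial>memory_law (t + h))" for s
    unfolding C_def using c_nonneg by (intro nn_integral_eq_integral[symmetric] inner_int AE_I2)
  have [measurable]: "C \<in> borel_measurable borel" unfolding C_def by measurable
  have outer_int: "integrable (memory_law t) (\<lambda>p. C (snd p))"
    using C_nonneg C_le by (intro Q.integrable_const_bound[where B="\<integral>r. 1 / r \<partial>\<pi>"] AE_I2) auto
  have "ennreal (\<integral>p. C (snd p) \<partial>memory_law t) = (\<integral>\<^sup>+ p. ennreal (C (snd p)) \<partial>memory_law t)"
    using C_nonneg by (intro nn_integral_eq_integral[symmetric] outer_int AE_I2)
  also have "\<dots> = ennreal (I2 \<rho> \<pi> h + I3 \<rho> \<pi> h)"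
    unfolding C_nn c_nn using memory_law_double_integral[OF h, of t] by (simp add: e_def)
  finally have "(\<integral>p. C (snd p) \<partial>memory_law t) = I2 \<rho> \<pi> h + I3 \<rho> \<pi> h"
    using C_nonneg I2_I3_nn_integral(2)[OF h]
    by (subst (asm) ennreal_inj) (auto intro!: Bochner_Integration.integral_nonneg)
  then show ?thesis unfolding C_def c_def e_def prod.case .
qed

end

section \<open>The volatility process\<close>

text \<open>Products with the Levy measure, which may be infinite near 0, require \<open>\<sigma>\<close>-finiteness;
  it follows from the first moment by Markov's inequality.\<close>

lemma sigma_finite_positive_integrable:
  fixes f :: "'a \<Rightarrow> real"
  assumes f: "integrable K f" and pos: "\<And>x. x \<in> space K \<Longrightarrow> 0 < f x"
  shows "sigma_finite_measure K"
proof
  have [measurable]: "f \<in> borel_measurable K" using f by simp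
  define A where "A n = {x \<in> space K. 1 \<le> of_nat (Suc n) * ennreal (f x)}" for n
  have A: "A n \<in> sets K" for n unfolding A_def by measurable
  have "emeasure K (A n) \<le> of_nat (Suc n) * (\<integral>\<^sup>+ x. ennreal (f x) * indicator (space K) x \<partial>K)" for n
    unfolding A_def by (rule nn_integral_Markov_inequality) auto
  moreover have "(\<integral>\<^sup>+ x. ennreal (f x) * indicator (space K) x \<partial>K) = ennreal (\<integral>x. f x \<partial>K)"
    using pos by (subst nn_integral_eq_integral[OF f, symmetric])
      (auto intro!: nn_integral_cong AE_I2 less_imp_le)
  ultimately have fin: "emeasure K (A n) \<le> of_nat (Suc n) * ennreal (\<integral>x. f x \<partial>K)" for n by simp
  have fin: "emeasure K (A n) \<noteq> \<infinity>" for n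
  proof -
    have "of_nat (Suc n) * ennreal (\<integral>x. f x \<partial>K) < \<infinity>"
      by (simp add: ennreal_mult_less_top of_nat_less_top)
    with fin[of n] show ?thesis by (auto simp: top_unique)
  qed
  have cover: "(\<Union>n. A n) = space K"
  proof
    show "(\<Union>n. A n) \<subseteq> space K" by (auto simp: A_def)
    show "space K \<subseteq> (\<Union>n. A n)"
    proof
      fix x assume x: "x \<in> space K"
      obtain n where "1 / f x \<le> real n" using real_arch_simple by blast
      then have "1 \<le> real (Suc n) * f x" using pos[OF x] by (simp add: field_simps)
      then have "ennreal 1 \<le> ennreal (real (Suc n) * f x)" by (rule ennreal_leI)
      then have "1 \<le> of_nat (Suc n) * ennreal (f x)"
        by (simp add: ennreal_mult' ennreal_of_nat_eq_real_of_nat)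
      with x show "x \<in> (\<Union>n. A n)" by (auto simp: A_def)
    qed
  qed
  show "\<exists>A. countable A \<and> A \<subseteq> sets K \<and> \<Union> A = space K \<and> (\<forall>a\<in>A. emeasure K a \<noteq> \<infinity>)"
    using A fin cover by (intro exI[of _ "range A"]) auto
qed

locale supOUSV_noises = prob_space M
  for M :: "'w measure" +
  fixes F :: "real \<Rightarrow> 'w measure" and \<nu> \<pi> \<rho> :: "real measure"
    and N :: "'w \<Rightarrow> (real \<times> real \<times> real) measure"
    and B :: "(real \<times> real) set \<Rightarrow> 'w \<Rightarrow> real"
  assumes filtration: "complete_filtration M F"
    and levy: "subordinator_levy_measure \<nu>"
    and moments: "\<And>k::nat. k \<ge> 1 \<Longrightarrow> integrable \<nu> (\<lambda>z. z ^ k)"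
    and laws: "memory_laws \<rho> \<pi>"
    and jump_noise: "poisson_random_measure M (jump_intensity \<nu> \<pi>) N"
    and white: "white_noise M (control_measure \<rho>) B"
    and indep: "independent_noises M (jump_intensity \<nu> \<pi>) N (control_measure \<rho>) B"
    and adapted: "adapted_noises M F (jump_intensity \<nu> \<pi>) N (control_measure \<rho>) B"
begin

sublocale memory_laws \<rho> \<pi> by (rule laws)

sublocale noise: adapted_white_noise M \<rho> F B "jump_intensity \<nu> \<pi>" N
  by unfold_locales (rule filtration white indep adapted)+

lemma sets_\<nu>: "sets \<nu> = sets pos_borel"
  using levy by (simp add: subordinator_levy_measure_def)

lemma space_\<nu>: "space \<nu> = {0<..}"
  using sets_eq_imp_space_eq[OF sets_\<nu>] unfolding space_restrict_space
  by (simp only: space_borel Int_UNIV_right)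

lemma ident_\<nu>: "(\<lambda>x. x) \<in> measurable \<nu> (borel :: real measure)"
  by (rule ident_measurable_pos_borel[OF sets_\<nu>])

lemma sigma_finite_\<nu>: "sigma_finite_measure \<nu>"
  using sigma_finite_positive_integrable[OF moments[of 1]] by (auto simp: space_\<nu>)

sublocale \<nu>: sigma_finite_measure \<nu> by (rule sigma_finite_\<nu>)
sublocale NP: pair_sigma_finite \<nu> \<pi> ..
sublocale LNP: pair_sigma_finite "lborel :: real measure" "\<nu> \<Otimes>\<^sub>M \<pi>" ..

sublocale jumps: poisson_random M "jump_intensity \<nu> \<pi>" N
  by unfold_locales (rule jump_noise)

lemma space_jump_intensity: "space (jump_intensity \<nu> \<pi>) = UNIV \<times> ({0<..} \<times> {0<..})"
  by (simp add: space_pair_measure space_\<nu> space_\<pi>)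

lemma measurable_jump_intensity:
  "f \<in> borel_measurable (borel \<Otimes>\<^sub>M (borel \<Otimes>\<^sub>M borel)) \<Longrightarrow> f \<in> borel_measurable (jump_intensity \<nu> \<pi>)"
  by (erule measurable_ident_trans[rotated])
    (intro ident_measurable_pair ident_\<nu> ident_\<pi> measurable_ident_sets[OF sets_lborel])

text \<open>The intensity integrates to a product: the time variable, which is eliminated first,
  leaves \<open>1 / (c r)\<close>.\<close>

lemma jump_intensity_integral:
  assumes a: "a \<in> borel_measurable borel" "\<And>z. z > 0 \<Longrightarrow> a z \<ge> 0" "integrable \<nu> a"
    and b: "b \<in> borel_measurable borel" "\<And>r. r > 0 \<Longrightarrow> b r \<ge> 0"
    and int: "integrable \<pi> (\<lambda>r. b r / (c * r))" and c: "c > 0"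
  shows "(\<integral>\<^sup>+ (u, z, r). ennreal (a z * (b r * (if u \<le> s then exp (- (c * r) * (s - u)) else 0)))
      \<partial>jump_intensity \<nu> \<pi>) = ennreal ((\<integral>z. a z \<partial>\<nu>) * (\<integral>r. b r / (c * r) \<partial>\<pi>))"
proof -
  define f where "f = (\<lambda>(u, z, r). ennreal (a z * (b r * (if u \<le> s then exp (- (c * r) * (s - u)) else 0))))"
  have f: "f \<in> borel_measurable (jump_intensity \<nu> \<pi>)"
  proof -
    note a(1)[measurable] b(1)[measurable]
    show ?thesis unfolding f_def by (intro measurable_jump_intensity) measurable
  qed
  have [measurable]: "a \<in> borel_measurable \<nu>" "b \<in> borel_measurable \<pi>"
      "(\<lambda>r. b r / (c * r)) \<in> borel_measurable \<pi>"
    using a(3) int measurable_ident_trans[OF ident_\<pi> b(1)] by auto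
  have "(\<integral>\<^sup>+ x. f x \<partial>jump_intensity \<nu> \<pi>) = (\<integral>\<^sup>+ y. (\<integral>\<^sup>+ u. f (u, y) \<partial>lborel) \<partial>(\<nu> \<Otimes>\<^sub>M \<pi>))"
    by (rule LNP.nn_integral_snd[OF f, symmetric])
  also have "\<dots> = (\<integral>\<^sup>+ y. ennreal (a (fst y)) * ennreal (b (snd y) / (c * snd y)) \<partial>(\<nu> \<Otimes>\<^sub>M \<pi>))"
  proof (intro nn_integral_cong)
    fix y assume "y \<in> space (\<nu> \<Otimes>\<^sub>M \<pi>)"
    then obtain z r where y: "y = (z, r)" and pos: "z > 0" "r > 0"
      by (auto simp: space_pair_measure space_\<nu> space_\<pi>)
    have "(\<integral>\<^sup>+ u. f (u, y) \<partial>lborel) =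
        (\<integral>\<^sup>+ u. ennreal (a z * b r) * ennreal (if u \<le> s then exp (- (c * r) * (s - u)) else 0) \<partial>lborel)"
      unfolding f_def y prod.case using a(2)[OF pos(1)] b(2)[OF pos(2)]
      by (intro nn_integral_cong) (simp add: mult.assoc flip: ennreal_mult')
    also have "\<dots> = ennreal (a z * b r) * (\<integral>\<^sup>+ u. ennreal (if u \<le> s then exp (- (c * r) * (s - u)) else 0) \<partial>lborel)"
      by (rule nn_integral_cmult) measurable
    also have "(\<integral>\<^sup>+ u. ennreal (if u \<le> s then exp (- (c * r) * (s - u)) else 0) \<partial>lborel) = ennreal (1 / (c * r))"
      using c pos by (intro nn_integral_exp_past) simp
    also have "ennreal (a z * b r) * ennreal (1 / (c * r)) = ennreal (a z) * ennreal (b r / (c * r))"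
      using a(2)[OF pos(1)] b(2)[OF pos(2)] by (simp flip: ennreal_mult')
    finally show "(\<integral>\<^sup>+ u. f (u, y) \<partial>lborel) = ennreal (a (fst y)) * ennreal (b (snd y) / (c * snd y))"
      by (simp add: y)
  qed
  also have "\<dots> = (\<integral>\<^sup>+ z. (\<integral>\<^sup>+ r. ennreal (a z) * ennreal (b r / (c * r)) \<partial>\<pi>) \<partial>\<nu>)"
    by (subst \<pi>.nn_integral_fst[symmetric]) auto
  also have "\<dots> = (\<integral>\<^sup>+ z. ennreal (a z) * (\<integral>\<^sup>+ r. ennreal (b r / (c * r)) \<partial>\<pi>) \<partial>\<nu>)"
    by (intro nn_integral_cong nn_integral_cmult) measurable
  also have "\<dots> = (\<integral>\<^sup>+ z. ennreal (a z) \<partial>\<nu>) * (\<integral>\<^sup>+ r. ennreal (b r / (c * r)) \<partial>\<pi>)"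
    by (rule nn_integral_multc) measurable
  also have "(\<integral>\<^sup>+ z. ennreal (a z) \<partial>\<nu>) = ennreal (\<integral>z. a z \<partial>\<nu>)"
    using a by (intro nn_integral_eq_integral AE_I2) (auto simp: space_\<nu>)
  also have "(\<integral>\<^sup>+ r. ennreal (b r / (c * r)) \<partial>\<pi>) = ennreal (\<integral>r. b r / (c * r) \<partial>\<pi>)"
    using b c by (intro nn_integral_eq_integral int AE_I2) (auto simp: space_\<pi>)
  also have "ennreal (\<integral>z. a z \<partial>\<nu>) * ennreal (\<integral>r. b r / (c * r) \<partial>\<pi>) =
      ennreal ((\<integral>z. a z \<partial>\<nu>) * (\<integral>r. b r / (c * r) \<partial>\<pi>))"
    using a(2) by (intro ennreal_mult'[symmetric] Bochner_Integration.integral_nonneg) (auto simp: space_\<nu>)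
  finally show ?thesis by (simp add: f_def case_prod_unfold)
qed

text \<open>Values in \<open>ennreal\<close> keep the integral of the response well behaved on the null set where
  it is infinite; there the real-valued process takes the default value 0.\<close>

definition response :: "real \<Rightarrow> real \<times> real \<times> real \<Rightarrow> ennreal" where
  "response s = (\<lambda>(u, z, r). ennreal (indicator {..s} u * (z * exp (- r * (s - u)))))"

lemma response_measurable [measurable]: "response s \<in> borel_measurable (jump_intensity \<nu> \<pi>)"
  unfolding response_def by (intro measurable_jump_intensity) measurable

definition vol :: "real \<Rightarrow> 'w \<Rightarrow> ennreal" where
  "vol s \<omega> = (\<integral>\<^sup>+ x. response s x \<partial>N \<omega>)"

lemma vol_measurable [measurable]: "vol s \<in> borel_measurable M"
  unfolding vol_def[abs_def] by (rule jumps.integral_N_measurable[OF response_measurable])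

lemma supOU_eq_vol:
  assumes w: "\<omega> \<in> space M"
  shows "supOU N s \<omega> = enn2real (vol s \<omega>)"
proof -
  define f where "f = (\<lambda>(u, z, r). indicator {..s} u * (z * exp (- r * (s - u))))"
  have "f \<in> borel_measurable (jump_intensity \<nu> \<pi>)"
    unfolding f_def by (intro measurable_jump_intensity) measurable
  then have f: "f \<in> borel_measurable (N \<omega>)" by (rule jumps.measurable_N[OF w])
  have "AE x in N \<omega>. 0 \<le> f x"
  proof (rule AE_I2)
    fix x assume "x \<in> space (N \<omega>)"
    then have "x \<in> UNIV \<times> ({0<..} \<times> {0<..})"
      unfolding jumps.space_N[OF w] space_jump_intensity .
    then show "0 \<le> f x" by (auto simp: f_def)
  qed
  from integral_eq_nn_integral[OF f this] show ?thesis
    by (simp add: supOU_def vol_def response_def f_def case_prod_unfold)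
qed

definition jump_mean :: real where "jump_mean = (\<integral>z. z \<partial>\<nu>)"
definition jump_square_mean :: real where "jump_square_mean = (\<integral>z. z\<^sup>2 \<partial>\<nu>)"
definition mean_lifetime :: real where "mean_lifetime = (\<integral>r. 1 / r \<partial>\<pi>)"

text \<open>The autocovariance of the volatility at lag \<open>d\<close>. Both signs of \<open>d\<close> occur, because the two
  past times at which the drift samples the volatility are not ordered.\<close>

definition acov :: "real \<Rightarrow> real" where "acov d = jump_square_mean / 2 * (\<integral>r. exp (- r * \<bar>d\<bar>) / r \<partial>\<pi>)"

lemma moments_nonneg: "jump_mean \<ge> 0" "jump_square_mean \<ge> 0" "mean_lifetime \<ge> 0"
  unfolding jump_mean_def jump_square_mean_def mean_lifetime_def
  by (rule Bochner_Integration.integral_nonneg, simp add: space_\<nu> space_\<pi>)+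

lemma mean_lifetime_pos: "mean_lifetime > 0"
proof -
  have "mean_lifetime \<noteq> 0"
  proof
    assume "mean_lifetime = 0"
    then have "AE r in \<pi>. 1 / r = 0"
      unfolding mean_lifetime_def by (subst (asm) integral_nonneg_eq_0_iff_AE[OF integrable_inverse])
        (auto intro!: AE_I2 simp: space_\<pi>)
    then have "AE r in \<pi>. False"
      using AE_space by eventually_elim (auto simp: space_\<pi>)
    then show False by (simp add: \<pi>.AE_False)
  qed
  with moments_nonneg show ?thesis by simp
qed

lemma exp_weight_integrable: "integrable \<pi> (\<lambda>r. exp (- r * \<bar>d\<bar>) / r)"
proof (rule Bochner_Integration.integrable_bound[OF integrable_inverse])
  show "(\<lambda>r. exp (- r * \<bar>d\<bar>) / r) \<in> borel_measurable \<pi>"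
    by (rule measurable_ident_trans[OF ident_\<pi>]) measurable
  show "AE r in \<pi>. norm (exp (- r * \<bar>d\<bar>) / r) \<le> norm (1 / r)"
    by (intro AE_I2) (auto simp: space_\<pi> divide_right_mono)
qed

lemma acov_nonneg: "acov d \<ge> 0"
  unfolding acov_def using moments_nonneg
  by (intro mult_nonneg_nonneg Bochner_Integration.integral_nonneg) (simp_all add: space_\<pi>)

lemma vol_mean: "(\<integral>\<^sup>+ \<omega>. vol s \<omega> \<partial>M) = ennreal (jump_mean * mean_lifetime)"
proof -
  have "(\<integral>\<^sup>+ \<omega>. vol s \<omega> \<partial>M) = (\<integral>\<^sup>+ x. response s x \<partial>jump_intensity \<nu> \<pi>)"
    unfolding vol_def by (rule jumps.integral_N_mean[OF response_measurable])
  also have "\<dots> = (\<integral>\<^sup>+ (u, z, r). ennreal (z * (1 * (if u \<le> s then exp (- (1 * r) * (s - u)) else 0)))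
      \<partial>jump_intensity \<nu> \<pi>)"
    by (intro nn_integral_cong) (auto simp: response_def indicator_def)
  also have "\<dots> = ennreal ((\<integral>z. z \<partial>\<nu>) * (\<integral>r. 1 / (1 * r) \<partial>\<pi>))"
  proof (rule jump_intensity_integral[of "\<lambda>z. z" "\<lambda>_. 1" 1 s])
    show "integrable \<nu> (\<lambda>z. z)" using moments[of 1] by simp
    show "integrable \<pi> (\<lambda>r. 1 / (1 * r))" using integrable_inverse by simp
  qed simp_all
  finally show ?thesis by (simp add: jump_mean_def mean_lifetime_def)
qed

lemma response_product_integral:
  assumes le: "s \<le> s'"
  shows "(\<integral>\<^sup>+ x. response s x * response s' x \<partial>jump_intensity \<nu> \<pi>) = ennreal (acov (s' - s))"
proof -
  have "(\<integral>\<^sup>+ x. response s x * response s' x \<partial>jump_intensity \<nu> \<pi>) =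
      (\<integral>\<^sup>+ (u, z, r). ennreal (z\<^sup>2 * (exp (- r * \<bar>s' - s\<bar>) * (if u \<le> s then exp (- (2 * r) * (s - u)) else 0)))
        \<partial>jump_intensity \<nu> \<pi>)"
  proof (intro nn_integral_cong)
    fix x :: "real \<times> real \<times> real" assume "x \<in> space (jump_intensity \<nu> \<pi>)"
    then obtain u z r where x: "x = (u, z, r)" and pos: "z > 0" "r > 0"
      unfolding space_jump_intensity by auto
    have "exp (- r * (s - u)) * exp (- r * (s' - u)) = exp (- r * \<bar>s' - s\<bar>) * exp (- (2 * r) * (s - u))"
      using le by (simp add: algebra_simps flip: exp_add)
    then have "(z * exp (- r * (s - u))) * (z * exp (- r * (s' - u))) =
        z\<^sup>2 * (exp (- r * \<bar>s' - s\<bar>) * exp (- (2 * r) * (s - u)))"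
      by (simp add: power2_eq_square)
    then show "response s x * response s' x = (case x of (u, z, r) \<Rightarrow>
        ennreal (z\<^sup>2 * (exp (- r * \<bar>s' - s\<bar>) * (if u \<le> s then exp (- (2 * r) * (s - u)) else 0))))"
      using le pos by (auto simp: x response_def indicator_def simp flip: ennreal_mult')
  qed
  also have "\<dots> = ennreal ((\<integral>z. z\<^sup>2 \<partial>\<nu>) * (\<integral>r. exp (- r * \<bar>s' - s\<bar>) / (2 * r) \<partial>\<pi>))"
  proof (rule jump_intensity_integral[of "\<lambda>z. z\<^sup>2" "\<lambda>r. exp (- r * \<bar>s' - s\<bar>)" 2 s])
    show "integrable \<pi> (\<lambda>r. exp (- r * \<bar>s' - s\<bar>) / (2 * r))"
      using integrable_divide[OF exp_weight_integrable[of "s' - s"], of 2] by (simp add: mult.commute)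
    show "integrable \<nu> (\<lambda>z. z\<^sup>2)" by (rule moments) simp
  qed simp_all
  also have "(\<integral>r. exp (- r * \<bar>s' - s\<bar>) / (2 * r) \<partial>\<pi>) = (\<integral>r. exp (- r * \<bar>s' - s\<bar>) / r \<partial>\<pi>) / 2"
    by (subst integral_divide_zero[symmetric]) (simp add: mult.commute)
  finally show ?thesis by (simp add: acov_def jump_square_mean_def)
qed

lemma vol_product_mean: "(\<integral>\<^sup>+ \<omega>. vol s \<omega> * vol s' \<omega> \<partial>M) = ennreal ((jump_mean * mean_lifetime)\<^sup>2 + acov (s' - s))"
proof -
  have "(\<integral>\<^sup>+ \<omega>. vol s \<omega> * vol s' \<omega> \<partial>M) = (\<integral>\<^sup>+ \<omega>. vol s \<omega> \<partial>M) * (\<integral>\<^sup>+ \<omega>. vol s' \<omega> \<partial>M) +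
      (\<integral>\<^sup>+ x. response s x * response s' x \<partial>jump_intensity \<nu> \<pi>)"
    unfolding vol_def jumps.integral_N_mean[OF response_measurable]
    by (rule jumps.integral_N_product_mean[OF response_measurable response_measurable])
  also have "(\<integral>\<^sup>+ x. response s x * response s' x \<partial>jump_intensity \<nu> \<pi>) = ennreal (acov (s' - s))"
  proof (cases "s \<le> s'")
    case True
    then show ?thesis by (rule response_product_integral)
  next
    case False
    then have "s' \<le> s" by simp
    from response_product_integral[OF this] show ?thesis
      by (simp add: mult.commute acov_def abs_minus_commute)
  qed
  finally show ?thesis
    using moments_nonneg acov_nonneg by (simp add: vol_mean power2_eq_square ennreal_mult ennreal_plus)
qed

lemma vol_finite: "AE \<omega> in M. vol s \<omega> < \<infinity>"
proof -
  have "AE \<omega> in M. vol s \<omega> \<noteq> \<infinity>"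
    by (rule nn_integral_PInf_AE[OF vol_measurable]) (simp add: vol_mean)
  then show ?thesis by eventually_elim (simp add: top.not_eq_extremum)
qed

lemma square_integrable_dominated_vol:
  assumes "g \<in> borel_measurable M" "AE \<omega> in M. g \<omega> \<le> vol s \<omega>"
  shows "square_integrable M (\<lambda>\<omega>. enn2real (g \<omega>))"
proof (rule square_integrable_nn_integral)
  show "(\<lambda>\<omega>. enn2real (g \<omega>)) \<in> borel_measurable M" using assms(1) by simp
  have "(\<integral>\<^sup>+ \<omega>. ennreal ((enn2real (g \<omega>))\<^sup>2) \<partial>M) \<le> (\<integral>\<^sup>+ \<omega>. vol s \<omega> * vol s \<omega> \<partial>M)"
    using assms(2) vol_finite[of s]
  proof (intro nn_integral_mono_AE, eventually_elim)
    case (elim \<omega>)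
    then have "ennreal (enn2real (g \<omega>)) = g \<omega>" by (simp add: order_le_less_trans)
    then show ?case using elim
      by (simp add: power2_eq_square ennreal_mult mult_mono)
  qed
  also have "\<dots> < \<infinity>" by (simp add: vol_product_mean)
  finally show "(\<integral>\<^sup>+ \<omega>. ennreal ((enn2real (g \<omega>))\<^sup>2) \<partial>M) < \<infinity>" .
qed

lemma supOU_measurable [measurable]: "supOU N s \<in> borel_measurable M"
proof -
  have "(\<lambda>\<omega>. enn2real (vol s \<omega>)) \<in> borel_measurable M" by measurable
  then show ?thesis by (simp add: supOU_eq_vol cong: measurable_cong)
qed

lemma supOU_square_integrable: "square_integrable M (supOU N s)"
proof (rule square_integrable_cong_AE[OF _ supOU_measurable])
  show "square_integrable M (\<lambda>\<omega>. enn2real (vol s \<omega>))"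
    by (rule square_integrable_dominated_vol) auto
  show "AE \<omega> in M. enn2real (vol s \<omega>) = supOU N s \<omega>"
    by (intro AE_I2) (simp add: supOU_eq_vol)
qed

lemma supOU_nonneg: "\<omega> \<in> space M \<Longrightarrow> 0 \<le> supOU N s \<omega>"
  by (simp add: supOU_eq_vol)

lemma ennreal_supOU: "AE \<omega> in M. ennreal (supOU N s \<omega>) = vol s \<omega>"
  using vol_finite[of s] AE_space by eventually_elim (simp add: supOU_eq_vol)

lemma supOU_mean: "expectation (supOU N s) = jump_mean * mean_lifetime"
proof -
  have "ennreal (expectation (supOU N s)) = (\<integral>\<^sup>+ \<omega>. ennreal (supOU N s \<omega>) \<partial>M)"
    using supOU_nonneg square_integrable_integrable[OF supOU_square_integrable]
    by (intro nn_integral_eq_integral[symmetric] AE_I2)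
  also have "\<dots> = ennreal (jump_mean * mean_lifetime)"
    unfolding vol_mean[of s, symmetric] using ennreal_supOU[of s] by (intro nn_integral_cong_AE)
  finally show ?thesis
    using moments_nonneg supOU_nonneg by (subst (asm) ennreal_inj) (auto intro: Bochner_Integration.integral_nonneg)
qed

lemma supOU_covariance:
  "expectation (\<lambda>\<omega>. (supOU N s \<omega> - jump_mean * mean_lifetime) * (supOU N s' \<omega> - jump_mean * mean_lifetime)) = acov (s' - s)"
proof -
  note int = square_integrable_mult[OF supOU_square_integrable[of s] supOU_square_integrable[of s']]
  have "ennreal (expectation (\<lambda>\<omega>. supOU N s \<omega> * supOU N s' \<omega>)) =
      (\<integral>\<^sup>+ \<omega>. ennreal (supOU N s \<omega> * supOU N s' \<omega>) \<partial>M)"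
    using supOU_nonneg by (intro nn_integral_eq_integral[symmetric] int AE_I2) auto
  also have "\<dots> = (\<integral>\<^sup>+ \<omega>. vol s \<omega> * vol s' \<omega> \<partial>M)"
    using ennreal_supOU[of s] ennreal_supOU[of s'] AE_space
    by (intro nn_integral_cong_AE, eventually_elim) (auto simp: supOU_nonneg ennreal_mult)
  finally have "expectation (\<lambda>\<omega>. supOU N s \<omega> * supOU N s' \<omega>) = (jump_mean * mean_lifetime)\<^sup>2 + acov (s' - s)"
    unfolding vol_product_mean using acov_nonneg supOU_nonneg
    by (subst (asm) ennreal_inj) (auto intro!: Bochner_Integration.integral_nonneg)
  moreover have "expectation (\<lambda>\<omega>. (supOU N s \<omega> - jump_mean * mean_lifetime) * (supOU N s' \<omega> - jump_mean * mean_lifetime)) =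
      expectation (\<lambda>\<omega>. supOU N s \<omega> * supOU N s' \<omega> - jump_mean * mean_lifetime * supOU N s \<omega> - jump_mean * mean_lifetime * supOU N s' \<omega> + (jump_mean * mean_lifetime)\<^sup>2)"
    by (intro Bochner_Integration.integral_cong) (auto simp: algebra_simps power2_eq_square)
  moreover have "\<dots> = expectation (\<lambda>\<omega>. supOU N s \<omega> * supOU N s' \<omega>) - jump_mean * mean_lifetime * (jump_mean * mean_lifetime)
      - jump_mean * mean_lifetime * (jump_mean * mean_lifetime) + (jump_mean * mean_lifetime)\<^sup>2"
    using int square_integrable_integrable[OF supOU_square_integrable[of s]]
      square_integrable_integrable[OF supOU_square_integrable[of s']]
    by (simp add: supOU_mean prob_space)
  ultimately show ?thesis by (simp add: power2_eq_square)
qed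

lemma supOU_variance: "variance (supOU N s) = jump_square_mean / 2 * mean_lifetime"
  using supOU_covariance[of s s] by (simp add: supOU_mean power2_eq_square acov_def mean_lifetime_def)

text \<open>The points up to time \<open>a\<close> and the later points contribute additively to the volatility
  at any time.\<close>

lemma supOU_splits: "noise.splits_at a (\<lambda>\<omega>. supOU N s \<omega> - c)"
proof -
  let ?L = "jump_intensity \<nu> \<pi>"
  define P where "P = ({..a} \<times> UNIV) \<inter> space ?L"
  define Q where "Q = ({a<..} \<times> UNIV) \<inter> space ?L"
  have "{..a} \<times> space (\<nu> \<Otimes>\<^sub>M \<pi>) \<in> sets ?L" "{a<..} \<times> space (\<nu> \<Otimes>\<^sub>M \<pi>) \<in> sets ?L"
    by auto
  moreover have "P = {..a} \<times> space (\<nu> \<Otimes>\<^sub>M \<pi>)" "Q = {a<..} \<times> space (\<nu> \<Otimes>\<^sub>M \<pi>)"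
    unfolding P_def Q_def space_pair_measure[of lborel "\<nu> \<Otimes>\<^sub>M \<pi>"] by auto
  ultimately have PQ: "P \<in> sets ?L" "Q \<in> sets ?L" by simp_all
  define p where "p \<omega> = (\<integral>\<^sup>+ x. response s x * indicator P x \<partial>N \<omega>)" for \<omega>
  define q where "q \<omega> = (\<integral>\<^sup>+ x. response s x * indicator Q x \<partial>N \<omega>)" for \<omega>
  have p_F: "p \<in> borel_measurable (F a)"
    unfolding p_def[abs_def]
    by (rule jumps.integral_N_measurable_sub[OF noise.space_F PQ(1) _ response_measurable])
      (auto simp: P_def intro!: noise.jump_measurable_F)
  have q_future: "q \<in> borel_measurable (noise.future a)"
    unfolding q_def[abs_def]
    by (rule jumps.integral_N_measurable_sub[OF noise.space_future PQ(2) _ response_measurable])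
      (auto simp: Q_def intro!: noise.jump_measurable_future)
  have q_jump: "q \<in> borel_measurable noise.jump_events"
    unfolding q_def[abs_def]
    by (rule jumps.integral_N_measurable_sub[OF noise.space_jump_events PQ(2) _ response_measurable])
      (rule noise.jump_measurable_jump_events)
  have p_M: "p \<in> borel_measurable M" and q_M: "q \<in> borel_measurable M"
    unfolding p_def[abs_def] q_def[abs_def]
    using PQ by (auto intro!: jumps.integral_N_measurable borel_measurable_times_ennreal)
  have sum: "vol s \<omega> = p \<omega> + q \<omega>" if w: "\<omega> \<in> space M" for \<omega>
  proof -
    have "vol s \<omega> = (\<integral>\<^sup>+ x. response s x * indicator P x + response s x * indicator Q x \<partial>N \<omega>)"
      unfolding vol_def
      by (intro nn_integral_cong) (auto simp: jumps.space_N[OF w] P_def Q_def indicator_def)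
    also have "\<dots> = p \<omega> + q \<omega>"
      unfolding p_def q_def using PQ
      by (intro nn_integral_add jumps.measurable_N[OF w] borel_measurable_times_ennreal) auto
    finally show ?thesis .
  qed
  have p2: "square_integrable M (\<lambda>\<omega>. enn2real (p \<omega>))"
    by (rule square_integrable_dominated_vol[OF p_M, of s]) (auto simp: sum)
  have q2: "square_integrable M (\<lambda>\<omega>. enn2real (q \<omega>))"
    by (rule square_integrable_dominated_vol[OF q_M, of s]) (auto simp: sum)
  show ?thesis
    unfolding noise.splits_at_def
  proof (intro exI conjI)
    show "(\<lambda>\<omega>. enn2real (p \<omega>) - c) \<in> borel_measurable (F a)" using p_F by simp
    show "square_integrable M (\<lambda>\<omega>. enn2real (p \<omega>) - c)"
      by (intro square_integrable_diff p2 square_integrable_const)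
    show "(\<lambda>\<omega>. enn2real (q \<omega>)) \<in> borel_measurable (noise.future a)" using q_future by simp
    show "(\<lambda>\<omega>. enn2real (q \<omega>)) \<in> borel_measurable noise.jump_events" using q_jump by simp
    show "square_integrable M (\<lambda>\<omega>. enn2real (q \<omega>))" by (rule q2)
    show "AE \<omega> in M. supOU N s \<omega> - c = enn2real (p \<omega>) - c + enn2real (q \<omega>)"
      using vol_finite[of s] AE_space
      by eventually_elim (auto simp: supOU_eq_vol sum enn2real_plus)
  qed
qed

end

section \<open>Drift and diffusion\<close>

context supOUSV_noises
begin

text \<open>For Fubini's theorem the volatility is replaced by a version that is measurable jointly in
  scenario and time and agrees with it at all times, outside one null set.\<close>

lemma supOU_jointly_measurable:
  obtains G V where "G \<in> sets M" "AE \<omega> in M. \<omega> \<in> G" "V \<in> borel_measurable (M \<Otimes>\<^sub>M (borel :: real measure))"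
    "\<And>\<omega> s. \<omega> \<in> G \<Longrightarrow> V (\<omega>, s) = supOU N s \<omega>"
proof -
  have "space (jump_intensity \<nu> \<pi>) \<noteq> {}"
    unfolding space_jump_intensity by (auto intro!: exI[of _ "1::real"])
  then obtain G where G: "G \<in> sets M" "AE \<omega> in M. \<omega> \<in> G"
    and joint: "\<And>(T :: real measure) f. (\<lambda>(s, x). f s x) \<in> borel_measurable (T \<Otimes>\<^sub>M jump_intensity \<nu> \<pi>) \<Longrightarrow>
      (\<lambda>(\<omega>, s). indicator G \<omega> * (\<integral>\<^sup>+ x. f s x \<partial>N \<omega>)) \<in> borel_measurable (M \<Otimes>\<^sub>M T)"
    by (rule jumps.integral_N_parametric_measurable) blast
  have "(\<lambda>(s, u, z, r). ennreal (indicator {..s} u * (z * exp (- r * (s - u)))))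
      \<in> borel_measurable (borel \<Otimes>\<^sub>M (borel \<Otimes>\<^sub>M (borel \<Otimes>\<^sub>M borel)))"
    unfolding indicator_def atMost_def mem_Collect_eq by measurable
  then have "(\<lambda>(s, u, z, r). ennreal (indicator {..s} u * (z * exp (- r * (s - u)))))
      \<in> borel_measurable (borel \<Otimes>\<^sub>M jump_intensity \<nu> \<pi>)"
    by (rule measurable_ident_trans[rotated])
      (intro ident_measurable_pair ident_borel ident_\<nu> ident_\<pi> measurable_ident_sets[OF sets_lborel])
  then have "(\<lambda>(s, x). response s x) \<in> borel_measurable (borel \<Otimes>\<^sub>M jump_intensity \<nu> \<pi>)"
    by (simp add: response_def case_prod_unfold)
  from joint[OF this] have meas: "(\<lambda>(\<omega>, s). indicator G \<omega> * vol s \<omega>) \<in> borel_measurable (M \<Otimes>\<^sub>M borel)"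
    unfolding vol_def .
  show ?thesis
  proof (rule that[OF G])
    show "(\<lambda>p. enn2real ((\<lambda>(\<omega>, s). indicator G \<omega> * vol s \<omega>) p)) \<in> borel_measurable (M \<Otimes>\<^sub>M borel)"
      using meas by (rule borel_measurable_enn2real)
    show "enn2real ((\<lambda>(\<omega>, s). indicator G \<omega> * vol s \<omega>) (\<omega>, s)) = supOU N s \<omega>" if "\<omega> \<in> G" for \<omega> s
      using that sets.sets_into_space[OF G(1)] by (simp add: supOU_eq_vol subset_iff)
  qed
qed

lemma supOU_centred_square_integrable: "square_integrable M (\<lambda>\<omega>. supOU N s \<omega> - jump_mean * mean_lifetime)"
  by (intro square_integrable_diff supOU_square_integrable square_integrable_const)

text \<open>Up to the factor \<open>\<mu>\<close> the drift is the average of the centred volatility over past times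
  distributed according to the memory law; the moments of the drift are therefore averages of
  moments of the volatility.\<close>

lemma drift_average:
  obtains D where "square_integrable M D"
    "AE \<omega> in M. supOUSV_drift M N \<rho> \<mu> t \<omega> = \<mu> * D \<omega>"
    "\<And>g. square_integrable M g \<Longrightarrow> expectation (\<lambda>\<omega>. g \<omega> * D \<omega>) =
      (\<integral>p. expectation (\<lambda>\<omega>. g \<omega> * (supOU N (snd p) \<omega> - jump_mean * mean_lifetime)) \<partial>memory_law t)"
proof -
  interpret Q: prob_space "memory_law t" by (rule prob_space_memory_law)
  interpret MQ: pair_prob_space M "memory_law t" ..
  have sets_Q: "sets (memory_law t) = sets (control_measure \<rho>)"
    by (simp add: memory_law_def)
  obtain G V where G: "G \<in> sets M" "AE \<omega> in M. \<omega> \<in> G" and V: "V \<in> borel_measurable (M \<Otimes>\<^sub>M (borel :: real measure))"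
    and V_eq: "\<And>\<omega> s. \<omega> \<in> G \<Longrightarrow> V (\<omega>, s) = supOU N s \<omega>"
    by (rule supOU_jointly_measurable) blast
  define W where "W \<omega> p = V (\<omega>, snd p) - jump_mean * mean_lifetime" for \<omega> and p :: "real \<times> real"
  have W_control: "(\<lambda>(\<omega>, p). W \<omega> p) \<in> borel_measurable (M \<Otimes>\<^sub>M control_measure \<rho>)"
    unfolding W_def using V by measurable
  then have W: "(\<lambda>(\<omega>, p). W \<omega> p) \<in> borel_measurable (M \<Otimes>\<^sub>M memory_law t)"
    using measurable_cong_sets[OF sets_pair_measure_cong[OF refl sets_Q] refl] by blast
  have W_M [measurable]: "(\<lambda>\<omega>. W \<omega> p) \<in> borel_measurable M" for p
    unfolding W_def using V by measurable
  have W_eq: "AE \<omega> in M. W \<omega> p = supOU N (snd p) \<omega> - jump_mean * mean_lifetime" for p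
    using G(2) by eventually_elim (simp add: W_def V_eq)
  have bound: "(\<integral>\<^sup>+ \<omega>. ennreal ((W \<omega> p)\<^sup>2) \<partial>M) \<le> ennreal (jump_square_mean / 2 * mean_lifetime)" for p
  proof -
    have "(\<integral>\<^sup>+ \<omega>. ennreal ((W \<omega> p)\<^sup>2) \<partial>M) = (\<integral>\<^sup>+ \<omega>. ennreal ((supOU N (snd p) \<omega> - jump_mean * mean_lifetime)\<^sup>2) \<partial>M)"
      using W_eq[of p] by (intro nn_integral_cong_AE) (auto elim!: eventually_mono)
    also have "\<dots> = ennreal (variance (supOU N (snd p)))"
      using supOU_centred_square_integrable[of "snd p"] unfolding supOU_mean
      by (intro nn_integral_eq_integral) (auto simp: square_integrable_def)
    finally show ?thesis by (simp add: supOU_variance)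
  qed
  define D where "D \<omega> = (\<integral>p. W \<omega> p \<partial>memory_law t)" for \<omega>
  note average = MQ.square_integrable_average[OF W bound]
  show ?thesis
  proof (rule that)
    show "square_integrable M D" unfolding D_def by (rule average(2))
    show "AE \<omega> in M. supOUSV_drift M N \<rho> \<mu> t \<omega> = \<mu> * D \<omega>"
      using G(2) AE_space
    proof eventually_elim
      case (elim \<omega>)
      have meas: "(\<lambda>p. \<mu> * W \<omega> p) \<in> borel_measurable (control_measure \<rho>)"
        using measurable_compose[OF measurable_Pair1'[OF elim(2)] W_control] by simp
      have "\<mu> * D \<omega> = (\<integral>p. \<mu> * W \<omega> p \<partial>memory_law t)" by (simp add: D_def)
      also have "\<dots> = (\<integral>p. memory_weight t (fst p) (snd p) *\<^sub>R (\<mu> * W \<omega> p) \<partial>control_measure \<rho>)"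
        unfolding memory_law_def
      proof (rule integral_density[OF meas memory_weight_measurable])
        show "AE p in control_measure \<rho>. 0 \<le> memory_weight t (fst p) (snd p)"
          by (intro AE_I2) (auto simp: memory_weight_def space_pair_measure space_\<rho>)
      qed
      also have "\<dots> = supOUSV_drift M N \<rho> \<mu> t \<omega>"
        unfolding supOUSV_drift_def supOU_mean
        by (intro Bochner_Integration.integral_cong)
          (auto simp: memory_weight_def W_def V_eq[OF elim(1)] indicator_def)
      finally show ?case by simp
    qed
    fix g assume g: "square_integrable M g"
    then have [measurable]: "g \<in> borel_measurable M" by (rule square_integrable_measurable)
    have "expectation (\<lambda>\<omega>. g \<omega> * D \<omega>) = (\<integral>p. expectation (\<lambda>\<omega>. g \<omega> * W \<omega> p) \<partial>memory_law t)"
      unfolding D_def by (rule average(3)[OF g])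
    also have "\<dots> = (\<integral>p. expectation (\<lambda>\<omega>. g \<omega> * (supOU N (snd p) \<omega> - jump_mean * mean_lifetime)) \<partial>memory_law t)"
    proof (rule Bochner_Integration.integral_cong[OF refl])
      fix p
      show "expectation (\<lambda>\<omega>. g \<omega> * W \<omega> p) = expectation (\<lambda>\<omega>. g \<omega> * (supOU N (snd p) \<omega> - jump_mean * mean_lifetime))"
        using W_eq[of p] by (intro integral_cong_AE) (auto elim!: eventually_mono)
    qed
    finally show "expectation (\<lambda>\<omega>. g \<omega> * D \<omega>) =
      (\<integral>p. expectation (\<lambda>\<omega>. g \<omega> * (supOU N (snd p) \<omega> - jump_mean * mean_lifetime)) \<partial>memory_law t)" .
  qed
qed

lemma diffusion_weight_integral:
  assumes \<sigma>: "\<sigma> > 0" and h: "h \<ge> 0"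
  shows "(\<integral>\<^sup>+ p. ennreal (\<sigma>\<^sup>2 * (exp (- fst p * h) * (if snd p \<le> t then fst p * exp (- (2 * fst p) * (t - snd p)) else 0)))
    \<partial>control_measure \<rho>) = ennreal (\<sigma>\<^sup>2 / 2 * I1 \<rho> h)"
proof -
  define w :: "real \<times> real \<Rightarrow> ennreal" where
    "w p = ennreal (\<sigma>\<^sup>2 * (exp (- fst p * h) * (if snd p \<le> t then fst p * exp (- (2 * fst p) * (t - snd p)) else 0)))" for p
  have "w \<in> borel_measurable (borel \<Otimes>\<^sub>M borel)" unfolding w_def by measurable
  then have w: "w \<in> borel_measurable (control_measure \<rho>)"
    by (rule measurable_ident_trans[rotated])
      (intro ident_measurable_pair ident_\<rho> measurable_ident_sets[OF sets_lborel])
  have "(\<integral>\<^sup>+ p. w p \<partial>control_measure \<rho>) = (\<integral>\<^sup>+ R. (\<integral>\<^sup>+ s. w (R, s) \<partial>lborel) \<partial>\<rho>)"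
    by (rule lborel.nn_integral_fst[OF w, symmetric])
  also have "\<dots> = (\<integral>\<^sup>+ R. ennreal (\<sigma>\<^sup>2 / 2 * exp (- R * h)) \<partial>\<rho>)"
  proof (intro nn_integral_cong)
    fix R assume "R \<in> space \<rho>"
    then have R: "R > 0" by (simp add: space_\<rho>)
    have "(\<integral>\<^sup>+ s. w (R, s) \<partial>lborel) = (\<integral>\<^sup>+ s. ennreal (\<sigma>\<^sup>2 * exp (- R * h) * R) *
        ennreal (if s \<le> t then exp (- (2 * R) * (t - s)) else 0) \<partial>lborel)"
      using R by (intro nn_integral_cong) (auto simp: w_def mult.assoc simp flip: ennreal_mult')
    also have "\<dots> = ennreal (\<sigma>\<^sup>2 * exp (- R * h) * R) *
        (\<integral>\<^sup>+ s. ennreal (if s \<le> t then exp (- (2 * R) * (t - s)) else 0) \<partial>lborel)"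
      by (rule nn_integral_cmult) measurable
    also have "(\<integral>\<^sup>+ s. ennreal (if s \<le> t then exp (- (2 * R) * (t - s)) else 0) \<partial>lborel) = ennreal (1 / (2 * R))"
      using R by (intro nn_integral_exp_past) simp
    also have "ennreal (\<sigma>\<^sup>2 * exp (- R * h) * R) * ennreal (1 / (2 * R)) = ennreal (\<sigma>\<^sup>2 / 2 * exp (- R * h))"
      using R by (simp flip: ennreal_mult')
    finally show "(\<integral>\<^sup>+ s. w (R, s) \<partial>lborel) = ennreal (\<sigma>\<^sup>2 / 2 * exp (- R * h))" .
  qed
  also have "\<dots> = ennreal (\<integral>R. \<sigma>\<^sup>2 / 2 * exp (- R * h) \<partial>\<rho>)"
  proof (intro nn_integral_eq_integral AE_I2 integrable_mult_right)
    show "integrable \<rho> (\<lambda>R. exp (- R * h))"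
    proof (rule \<rho>.integrable_const_bound[where B=1])
      show "AE R in \<rho>. norm (exp (- R * h)) \<le> 1"
        using h by (intro AE_I2) (simp add: space_\<rho>)
      show "(\<lambda>R. exp (- R * h)) \<in> borel_measurable \<rho>"
        by (rule measurable_ident_trans[OF ident_\<rho>]) measurable
    qed
  qed simp
  finally show ?thesis by (simp add: w_def I1_def)
qed

text \<open>By the isometry, only the common past \<open>s \<le> t\<close> contributes, and of the volatility only
  its mean enters.\<close>

lemma diffusion_covariance:
  assumes J: "has_ito_integral M F \<rho> B (supOUSV_diffusion N \<sigma> t) J"
    and J': "has_ito_integral M F \<rho> B (supOUSV_diffusion N \<sigma> (t + h)) J'"
    and \<sigma>: "\<sigma> > 0" and h: "h \<ge> 0"
  shows "expectation (\<lambda>\<omega>. J \<omega> * J' \<omega>) = \<sigma>\<^sup>2 * (jump_mean * mean_lifetime) / 2 * I1 \<rho> h"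
proof -
  let ?C = "M \<Otimes>\<^sub>M control_measure \<rho>"
  let ?w = "\<lambda>p. \<sigma>\<^sup>2 * (exp (- fst p * h) * (if snd p \<le> t then fst p * exp (- (2 * fst p) * (t - snd p)) else 0))"
  define \<Psi> where "\<Psi> = (\<lambda>(\<omega>, R, s). supOUSV_diffusion N \<sigma> t \<omega> R s * supOUSV_diffusion N \<sigma> (t + h) \<omega> R s)"
  obtain G V where G: "G \<in> sets M" "AE \<omega> in M. \<omega> \<in> G" and V: "V \<in> borel_measurable (M \<Otimes>\<^sub>M (borel :: real measure))"
    and V_eq: "\<And>\<omega> s. \<omega> \<in> G \<Longrightarrow> V (\<omega>, s) = supOU N s \<omega>"
    by (rule supOU_jointly_measurable) blast
  have \<Psi>_eq: "\<Psi> (\<omega>, p) = ?w p * supOU N (snd p) \<omega>"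
    if w: "\<omega> \<in> space M" and p: "p \<in> space (control_measure \<rho>)" for \<omega> p
  proof -
    obtain R s where ps: "p = (R, s)" and R: "R > 0"
      using p by (auto simp: space_pair_measure space_\<rho>)
    have Y: "0 \<le> R * supOU N s \<omega>" using R supOU_nonneg[OF w] by simp
    have "exp (- R * (t - s)) * exp (- R * (t + h - s)) = exp (- R * h) * exp (- (2 * R) * (t - s))"
      by (simp add: algebra_simps flip: exp_add)
    then have "(exp (- R * (t - s)) * (\<sigma> * sqrt (R * supOU N s \<omega>))) *
        (exp (- R * (t + h - s)) * (\<sigma> * sqrt (R * supOU N s \<omega>))) =
        \<sigma>\<^sup>2 * (exp (- R * h) * exp (- (2 * R) * (t - s))) * (sqrt (R * supOU N s \<omega>))\<^sup>2"
      by (simp add: power2_eq_square mult_ac)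
    also have "(sqrt (R * supOU N s \<omega>))\<^sup>2 = R * supOU N s \<omega>" using Y by simp
    finally show ?thesis
      using h by (auto simp: \<Psi>_def ps supOUSV_diffusion_def indicator_def mult_ac)
  qed
  have w_nonneg: "0 \<le> ?w p" if "p \<in> space (control_measure \<rho>)" for p
    using that by (auto simp: space_pair_measure space_\<rho>)
  have "\<Psi> \<in> borel_measurable (completion ?C)"
  proof -
    have "(\<lambda>(\<omega>, R, s). supOUSV_diffusion N \<sigma> t \<omega> R s) \<in> borel_measurable (completion ?C)"
      "(\<lambda>(\<omega>, R, s). supOUSV_diffusion N \<sigma> (t + h) \<omega> R s) \<in> borel_measurable (completion ?C)"
      using J J' by (simp_all add: has_ito_integral_def)
    from borel_measurable_times[OF this] show ?thesis by (simp add: \<Psi>_def case_prod_unfold)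
  qed
  moreover have "AE x in completion ?C. 0 \<le> \<Psi> x"
    using w_nonneg supOU_nonneg
    by (intro AE_I2) (auto simp: space_pair_measure[of M] \<Psi>_eq)
  ultimately have "(\<integral>x. \<Psi> x \<partial>completion ?C) = enn2real (\<integral>\<^sup>+ x. ennreal (\<Psi> x) \<partial>?C)"
    by (simp add: integral_eq_nn_integral nn_integral_completion)
  also have "(\<integral>\<^sup>+ x. ennreal (\<Psi> x) \<partial>?C) = (\<integral>\<^sup>+ x. ennreal (?w (snd x)) * ennreal (V (fst x, snd (snd x))) \<partial>?C)"
  proof (rule nn_integral_cong_AE)
    have "space M - G \<in> null_sets M"
    proof -
      have eq: "space M - G = {\<omega> \<in> space M. \<not> \<omega> \<in> G}" by auto
      have "{\<omega> \<in> space M. \<not> \<omega> \<in> G} \<in> sets M" using G(1) unfolding eq[symmetric] by simp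
      then show ?thesis using G(2) unfolding eq by (simp add: AE_iff_null)
    qed
    then have "(space M - G) \<times> space (control_measure \<rho>) \<in> null_sets ?C"
      by (rule RS.P.times_in_null_sets1[OF _ sets.top])
    then have "AE x in ?C. x \<notin> (space M - G) \<times> space (control_measure \<rho>)" by (rule AE_not_in)
    then show "AE x in ?C. ennreal (\<Psi> x) = ennreal (?w (snd x)) * ennreal (V (fst x, snd (snd x)))"
      using AE_space
    proof eventually_elim
      case (elim x)
      obtain \<omega> p where x: "x = (\<omega>, p)" by (cases x)
      from elim have w: "\<omega> \<in> space M" "\<omega> \<in> G" and p: "p \<in> space (control_measure \<rho>)"
        unfolding x space_pair_measure[of M] by auto
      show ?case
        using w_nonneg[OF p] by (simp only: x fst_conv snd_conv \<Psi>_eq[OF w(1) p] V_eq[OF w(2)] ennreal_mult')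
    qed
  qed
  also have "\<dots> = (\<integral>\<^sup>+ p. (\<integral>\<^sup>+ \<omega>. ennreal (?w p) * ennreal (V (\<omega>, snd p)) \<partial>M) \<partial>control_measure \<rho>)"
  proof -
    have wm: "(\<lambda>p. ennreal (?w p)) \<in> borel_measurable (control_measure \<rho>)"
      by (rule measurable_ident_trans[OF ident_measurable_pair[OF ident_\<rho> measurable_ident_sets[OF sets_lborel]]])
        measurable
    have Vm: "(\<lambda>x. V (fst x, snd (snd x))) \<in> borel_measurable ?C"
      by (rule measurable_compose[OF _ V]) measurable
    have "(\<lambda>x. ennreal (?w (snd x)) * ennreal (V (fst x, snd (snd x)))) \<in> borel_measurable ?C"
      by (rule borel_measurable_times_ennreal[OF measurable_compose[OF measurable_snd wm]
            measurable_compose[OF Vm measurable_ennreal]])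
    from noise.MC.nn_integral_snd[OF this, symmetric] show ?thesis
      unfolding fst_conv snd_conv .
  qed
  also have "\<dots> = (\<integral>\<^sup>+ p. ennreal (?w p) * ennreal (jump_mean * mean_lifetime) \<partial>control_measure \<rho>)"
  proof (intro nn_integral_cong)
    fix p :: "real \<times> real"
    have "(\<lambda>\<omega>. V (\<omega>, snd p)) \<in> borel_measurable M" using V by measurable
    then have "(\<integral>\<^sup>+ \<omega>. ennreal (?w p) * ennreal (V (\<omega>, snd p)) \<partial>M) =
        ennreal (?w p) * (\<integral>\<^sup>+ \<omega>. ennreal (V (\<omega>, snd p)) \<partial>M)"
      by (intro nn_integral_cmult) measurable
    also have "(\<integral>\<^sup>+ \<omega>. ennreal (V (\<omega>, snd p)) \<partial>M) = (\<integral>\<^sup>+ \<omega>. vol (snd p) \<omega> \<partial>M)"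
      using G(2) ennreal_supOU[of "snd p"]
      by (intro nn_integral_cong_AE, eventually_elim) (simp add: V_eq)
    finally show "(\<integral>\<^sup>+ \<omega>. ennreal (?w p) * ennreal (V (\<omega>, snd p)) \<partial>M) = ennreal (?w p) * ennreal (jump_mean * mean_lifetime)"
      by (simp only: vol_mean)
  qed
  also have "\<dots> = (\<integral>\<^sup>+ p. ennreal (?w p) \<partial>control_measure \<rho>) * ennreal (jump_mean * mean_lifetime)"
    by (rule nn_integral_multc,
        rule measurable_ident_trans[OF ident_measurable_pair[OF ident_\<rho> measurable_ident_sets[OF sets_lborel]]],
        measurable)
  also have "\<dots> = ennreal (\<sigma>\<^sup>2 / 2 * I1 \<rho> h * (jump_mean * mean_lifetime))"
    unfolding diffusion_weight_integral[OF \<sigma> h] using moments_nonneg by (intro ennreal_mult''[symmetric]) simp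
  also have "enn2real (ennreal (\<sigma>\<^sup>2 / 2 * I1 \<rho> h * (jump_mean * mean_lifetime))) = \<sigma>\<^sup>2 / 2 * I1 \<rho> h * (jump_mean * mean_lifetime)"
    using moments_nonneg by (intro enn2real_ennreal mult_nonneg_nonneg) (auto simp: I1_def)
  finally show ?thesis
    unfolding noise.ito_isometry[OF J J'] by (simp add: \<Psi>_def case_prod_unfold)
qed

lemma ito_integral_drift_orthogonal:
  assumes J: "has_ito_integral M F \<rho> B \<Phi> J"
    and D: "\<And>g. square_integrable M g \<Longrightarrow> expectation (\<lambda>\<omega>. g \<omega> * D \<omega>) =
      (\<integral>p. expectation (\<lambda>\<omega>. g \<omega> * (supOU N (snd p) \<omega> - jump_mean * mean_lifetime)) \<partial>memory_law t)"
  shows "expectation (\<lambda>\<omega>. J \<omega> * D \<omega>) = 0"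
  using D[OF noise.ito_integral_square_integrable[OF J]]
    noise.ito_integral_orthogonal[OF J supOU_splits supOU_centred_square_integrable] by simp

lemma supOUSV_autocovariance:
  assumes X: "is_supOUSV M F N B \<rho> \<mu> \<sigma> X" and \<sigma>: "\<sigma> > 0" and h: "h \<ge> 0"
  shows "expectation (\<lambda>\<omega>. (X t \<omega> - expectation (X t)) * (X (t + h) \<omega> - expectation (X (t + h)))) =
    \<sigma>\<^sup>2 * expectation (supOU N t) / 2 * I1 \<rho> h +
    \<mu>\<^sup>2 * variance (supOU N t) * inverse (\<integral>r. 1 / r \<partial>\<pi>) * (I2 \<rho> \<pi> h + I3 \<rho> \<pi> h)"
proof -
  have X_meas [measurable]: "X u \<in> borel_measurable M" for u
    using X by (simp add: is_supOUSV_def)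
  obtain J where J: "has_ito_integral M F \<rho> B (supOUSV_diffusion N \<sigma> t) J"
    and XJ: "AE \<omega> in M. X t \<omega> = supOUSV_drift M N \<rho> \<mu> t \<omega> + J \<omega>"
    using X unfolding is_supOUSV_def by blast
  obtain J' where J': "has_ito_integral M F \<rho> B (supOUSV_diffusion N \<sigma> (t + h)) J'"
    and XJ': "AE \<omega> in M. X (t + h) \<omega> = supOUSV_drift M N \<rho> \<mu> (t + h) \<omega> + J' \<omega>"
    using X unfolding is_supOUSV_def by blast
  obtain D where D: "square_integrable M D" "AE \<omega> in M. supOUSV_drift M N \<rho> \<mu> t \<omega> = \<mu> * D \<omega>"
    "\<And>g. square_integrable M g \<Longrightarrow> expectation (\<lambda>\<omega>. g \<omega> * D \<omega>) =
      (\<integral>p. expectation (\<lambda>\<omega>. g \<omega> * (supOU N (snd p) \<omega> - jump_mean * mean_lifetime)) \<partial>memory_law t)"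
    by (rule drift_average) blast
  obtain D' where D': "square_integrable M D'" "AE \<omega> in M. supOUSV_drift M N \<rho> \<mu> (t + h) \<omega> = \<mu> * D' \<omega>"
    "\<And>g. square_integrable M g \<Longrightarrow> expectation (\<lambda>\<omega>. g \<omega> * D' \<omega>) =
      (\<integral>p. expectation (\<lambda>\<omega>. g \<omega> * (supOU N (snd p) \<omega> - jump_mean * mean_lifetime)) \<partial>memory_law (t + h))"
    by (rule drift_average) blast
  note J2 = noise.ito_integral_square_integrable[OF J] and J'2 = noise.ito_integral_square_integrable[OF J']
  have [measurable]: "D \<in> borel_measurable M" "D' \<in> borel_measurable M"
      "J \<in> borel_measurable M" "J' \<in> borel_measurable M"
    using D(1) D'(1) J2 J'2 by (auto intro: square_integrable_measurable)
  have X_eq: "AE \<omega> in M. X t \<omega> = \<mu> * D \<omega> + J \<omega>" "AE \<omega> in M. X (t + h) \<omega> = \<mu> * D' \<omega> + J' \<omega>"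
    using XJ D(2) XJ' D'(2) by (auto elim: eventually_elim2)
  have centred: "expectation (\<lambda>\<omega>. supOU N s \<omega> - jump_mean * mean_lifetime) = 0" for s
    using square_integrable_integrable[OF supOU_square_integrable[of s]] by (simp add: supOU_mean prob_space)
  have D_mean: "expectation D = 0" "expectation D' = 0"
    using D(3)[OF square_integrable_const[of 1]] D'(3)[OF square_integrable_const[of 1]] by (simp_all add: centred)
  have X_mean: "expectation (X t) = 0" "expectation (X (t + h)) = 0"
  proof -
    have "expectation (X t) = expectation (\<lambda>\<omega>. \<mu> * D \<omega> + J \<omega>)"
      using X_eq(1) by (intro integral_cong_AE) auto
    also have "\<dots> = 0"
      using square_integrable_integrable[OF D(1)] square_integrable_integrable[OF J2]
      by (simp add: D_mean noise.ito_integral_mean[OF J])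
    finally show "expectation (X t) = 0" .
    have "expectation (X (t + h)) = expectation (\<lambda>\<omega>. \<mu> * D' \<omega> + J' \<omega>)"
      using X_eq(2) by (intro integral_cong_AE) auto
    also have "\<dots> = 0"
      using square_integrable_integrable[OF D'(1)] square_integrable_integrable[OF J'2]
      by (simp add: D_mean noise.ito_integral_mean[OF J'])
    finally show "expectation (X (t + h)) = 0" .
  qed
  have DD: "expectation (\<lambda>\<omega>. D \<omega> * D' \<omega>) = jump_square_mean / 2 * (I2 \<rho> \<pi> h + I3 \<rho> \<pi> h)"
  proof -
    have "expectation (\<lambda>\<omega>. D \<omega> * D' \<omega>) = expectation (\<lambda>\<omega>. D' \<omega> * D \<omega>)" by (simp add: mult.commute)
    also have "\<dots> = (\<integral>p. expectation (\<lambda>\<omega>. (supOU N (snd p) \<omega> - jump_mean * mean_lifetime) * D' \<omega>) \<partial>memory_law t)"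
      unfolding D(3)[OF D'(1)] by (simp add: mult.commute)
    also have "\<dots> = (\<integral>p. (\<integral>q. acov (snd q - snd p) \<partial>memory_law (t + h)) \<partial>memory_law t)"
      unfolding D'(3)[OF supOU_centred_square_integrable] supOU_covariance ..
    also have "\<dots> = jump_square_mean / 2 * (I2 \<rho> \<pi> h + I3 \<rho> \<pi> h)"
      unfolding acov_def integral_mult_right_zero memory_law_covariance[OF h] ..
    finally show ?thesis .
  qed
  have DJ: "expectation (\<lambda>\<omega>. D \<omega> * J' \<omega>) = 0"
    using ito_integral_drift_orthogonal[OF J' D(3)] by (simp add: mult.commute)
  have JD: "expectation (\<lambda>\<omega>. J \<omega> * D' \<omega>) = 0"
    by (rule ito_integral_drift_orthogonal[OF J D'(3)])
  have "expectation (\<lambda>\<omega>. (X t \<omega> - expectation (X t)) * (X (t + h) \<omega> - expectation (X (t + h)))) =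
      expectation (\<lambda>\<omega>. \<mu>\<^sup>2 * (D \<omega> * D' \<omega>) + \<mu> * (D \<omega> * J' \<omega>) + \<mu> * (J \<omega> * D' \<omega>) + J \<omega> * J' \<omega>)"
    unfolding X_mean using X_eq
    by (intro integral_cong_AE) (auto elim!: eventually_elim2 simp: power2_eq_square algebra_simps)
  also have "\<dots> = \<mu>\<^sup>2 * expectation (\<lambda>\<omega>. D \<omega> * D' \<omega>) + \<mu> * expectation (\<lambda>\<omega>. D \<omega> * J' \<omega>) +
      \<mu> * expectation (\<lambda>\<omega>. J \<omega> * D' \<omega>) + expectation (\<lambda>\<omega>. J \<omega> * J' \<omega>)"
    using square_integrable_mult[OF D(1) D'(1)] square_integrable_mult[OF D(1) J'2]
      square_integrable_mult[OF J2 D'(1)] square_integrable_mult[OF J2 J'2]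
    by simp
  also have "\<dots> = \<sigma>\<^sup>2 * (jump_mean * mean_lifetime) / 2 * I1 \<rho> h + \<mu>\<^sup>2 * (jump_square_mean / 2) * (I2 \<rho> \<pi> h + I3 \<rho> \<pi> h)"
    unfolding DD DJ JD diffusion_covariance[OF J J' \<sigma> h] by simp
  also have "jump_square_mean / 2 = variance (supOU N t) * inverse (\<integral>r. 1 / r \<partial>\<pi>)"
    using mean_lifetime_pos unfolding supOU_variance by (simp add: mean_lifetime_def[symmetric])
  finally show ?thesis by (simp add: supOU_mean mult.assoc)
qed

end

section \<open>The autocorrelation function\<close>

theorem proposition2:
  fixes M :: "'w measure" and F :: "real \<Rightarrow> 'w measure"
    and \<nu> \<pi> \<rho> :: "real measure" and \<mu> \<sigma> :: real
    and N :: "'w \<Rightarrow> (real \<times> real \<times> real) measure"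
    and B :: "(real \<times> real) set \<Rightarrow> 'w \<Rightarrow> real"
    and X :: "real \<Rightarrow> 'w \<Rightarrow> real" and t h :: real
  assumes "prob_space M" and "complete_measure M" and "complete_filtration M F"
    and "subordinator_levy_measure \<nu>" and "emeasure \<nu> (space \<nu>) \<noteq> 0"
    and "\<And>k::nat. k \<ge> 1 \<Longrightarrow> integrable \<nu> (\<lambda>z. z ^ k)"
    and "prob_space \<pi>" and "sets \<pi> = sets pos_borel" and "integrable \<pi> (\<lambda>r. 1 / r)"
    and "prob_space \<rho>" and "sets \<rho> = sets pos_borel"
    and "\<sigma> > 0"
    and "poisson_random_measure M (jump_intensity \<nu> \<pi>) N"
    and "white_noise M (control_measure \<rho>) B"
    and "independent_noises M (jump_intensity \<nu> \<pi>) N (control_measure \<rho>) B"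
    and "adapted_noises M F (jump_intensity \<nu> \<pi>) N (control_measure \<rho>) B"
    and "is_supOUSV M F N B \<rho> \<mu> \<sigma> X"
    and "h \<ge> 0"
  shows "autocorr M X t h =
    1 / prob_space.variance M (X t) *
      (\<sigma>\<^sup>2 * prob_space.expectation M (supOU N t) / 2 * I1 \<rho> h +
       \<mu>\<^sup>2 * prob_space.variance M (supOU N t) * inverse (\<integral>r. 1 / r \<partial>\<pi>) *
         (I2 \<rho> \<pi> h + I3 \<rho> \<pi> h))"
proof -
  have "memory_laws \<rho> \<pi>"
    by (intro memory_laws.intro memory_laws_axioms.intro assms)
  then interpret supOUSV_noises M F \<nu> \<pi> \<rho> N B
    by (intro supOUSV_noises.intro supOUSV_noises_axioms.intro assms)
  show ?thesis
    unfolding autocorr_def supOUSV_autocovariance[OF \<open>is_supOUSV M F N B \<rho> \<mu> \<sigma> X\<close> \<open>\<sigma> > 0\<close> \<open>h \<ge> 0\<close>]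
    by simp
qed

end
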